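(* Let $n$ be a positive integer. If $y\in I_n$ and $z\in I_n^{\mathsf{FPF}}$ then $$\hat{\mathfrak S}_y=\sum_{D\in\mathcal{ID}(y)}\ \prod_{(i,j)\in D}2^{-\delta_{ij}}(x_i+x_j)\qquad\text{and}\qquad \hat{\mathfrak S}^{\mathsf{FPF}}_z=\sum_{D\in\mathcal{FD}(z)}\ \prod_{(i,j)\in D}(x_i+x_j),$$ where $\delta_{ij}$ is the Kronecker delta.
   Context: **Permutations and atoms.** $[n]=\{1,\dots,n\}$; $S_n$ is the group of permutations of $\mathbb Z_{>0}$ fixing all $i>n$, $s_i=(i,i+1)$, $\ell$ is Coxeter length. $I_n=\{w\in S_n:w=w^{-1}\}$; $I_n^{\mathsf{FPF}}$ is the set of $z\in I_n$ with $z(i)\neq i$ for all $i\in[n]$ (nonempty only if $n$ is even). The Demazure product $\circ$ is the unique associative operation on $S_n$ with $s_i\circ s_i=s_i$ and $v\circ w=vw$ whenever $\ell(vw)=\ell(v)+\ell(w)$. $\mathcal A(y)$ is the set of minimal-length $w\in S_n$ with $y=w^{-1}\circ w$. For $n$ even, $1^{\mathsf{FPF}}_n=s_1s_3\cdots s_{n-1}$, and $\mathcal A^{\mathsf{FPF}}(z)$ is the set of minimal-length $w\in S_n$ with $z=w^{-1}1^{\mathsf{FPF}}_nw$. **Polynomials.** $\mathfrak S_w$ is the ordinary Schubert polynomial ($\mathfrak S_{n\cdots321}=x_1^{n-1}x_2^{n-2}\cdots x_{n-1}$ and $\mathfrak S_{ws_i}=\partial_i\mathfrak S_w$ if $w(i)>w(i+1)$,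 with $\partial_if=(f-s_if)/(x_i-x_{i+1})$). $\hat{\mathfrak S}_y=\sum_{w\in\mathcal A(y)}\mathfrak S_w$ and $\hat{\mathfrak S}^{\mathsf{FPF}}_z=\sum_{w\in\mathcal A^{\mathsf{FPF}}(z)}\mathfrak S_w$. **Pipe dreams.** Positions $(i,j)$ are in matrix coordinates. For $D\subseteq\{(i,j)\in[n]\times[n]:i+j\le n\}$ the wiring diagram of $D$ is drawn as follows: in a cell $(i,j)\in D$ one path joins the left edge to the right edge and another joins the bottom edge to the top edge (they cross); in a cell $(i,j)\notin D$ with $i+j\le n$ one path joins left to top and another joins bottom to right (they avoid each other); in a cell with $i+j=n+1$ a single path joins left to top. Connecting these gives $n$ pipes. $D$ is a reduced pipe dream if no two pipes cross more than once. It is a reduced pipe dream for $w\in S_n$ if, labeling left endpoints $1,\dots,n$ from top to bottom and top endpoints $1,\dots,n$ from left to right, the pipe with left endpoint $i$ has top endpoint $w(i)$ for each $i$. $\mathcal{PD}(w)$ is the set of reduced pipe dreams for $w$. A reduced pipe dream $D$ is symmetric if $(i,j)\in D$ implies $(j,i)\in D$. It is almost-symmetric if (1) whenever $(i,j)\in D$ with $i<j$, also $(j,i)\in D$; and (2) whenever $(j,i)\in D$ with $i<j$ but $(i,j)\notin D$, the two pipes crossing at $(j,i)$ are also the two pipes that avoid each other at $(i,j)$. **Involution pipe dreams.** $\mathcal{ID}(y)=\{D\cap\{(j,i)\in[n]\times[n]:i\le j\}: D\in\mathcal{PD}(y)\text{ almost-symmetric}\}$ and $\mathcal{FD}(z)=\{D\cap\{(j,i)\in[n]\times[n]:i<j\}: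 D\in\mathcal{PD}(z)\text{ symmetric}\}$. *)

theory Defs
  imports Complex_Main "HOL-Library.Poly_Mapping" "HOL-Combinatorics.Permutations"
begin

section \<open>Permutations\<close>

text \<open>
  A permutation of the positive integers is represented by a function on \<^typ>\<open>nat\<close> that fixes 0.
  Products of permutations are compositions of functions.
\<close>

definition Sym :: "nat \<Rightarrow> (nat \<Rightarrow> nat) set" where
  "Sym n = {w. w permutes {1..n}}"

abbreviation adj :: "nat \<Rightarrow> nat \<Rightarrow> nat" where
  "adj i \<equiv> transpose i (Suc i)"

definition word_prod :: "nat list \<Rightarrow> nat \<Rightarrow> nat" where
  "word_prod is = foldr (\<lambda>i w. adj i \<circ> w) is id"

definition cox_length :: "(nat \<Rightarrow> nat) \<Rightarrow> nat" where
  "cox_length w = (LEAST k. \<exists>is. length is = k \<and> set is \<subseteq> {1..} \<and> w = word_prod is)"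

definition Inv :: "nat \<Rightarrow> (nat \<Rightarrow> nat) set" where
  "Inv n = {w \<in> Sym n. w = inv w}"

definition Inv_FPF :: "nat \<Rightarrow> (nat \<Rightarrow> nat) set" where
  "Inv_FPF n = {z \<in> Inv n. \<forall>i\<in>{1..n}. z i \<noteq> i}"

text \<open>
  The last clause fixes the value outside \<open>Sym n\<close>, so that the operation is unique as a
  function on the whole type.
\<close>

definition is_demazure :: "nat \<Rightarrow> ((nat \<Rightarrow> nat) \<Rightarrow> (nat \<Rightarrow> nat) \<Rightarrow> (nat \<Rightarrow> nat)) \<Rightarrow> bool" where
  "is_demazure n f \<longleftrightarrow>
     (\<forall>u\<in>Sym n. \<forall>v\<in>Sym n. f u v \<in> Sym n) \<and>
     (\<forall>u\<in>Sym n. \<forall>v\<in>Sym n. \<forall>w\<in>Sym n. f (f u v) w = f u (f v w)) \<and>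
     (\<forall>i\<in>{1..<n}. f (adj i) (adj i) = adj i) \<and>
     (\<forall>v\<in>Sym n. \<forall>w\<in>Sym n.
        cox_length (v \<circ> w) = cox_length v + cox_length w \<longrightarrow> f v w = v \<circ> w) \<and>
     (\<forall>u v. u \<notin> Sym n \<or> v \<notin> Sym n \<longrightarrow> f u v = undefined)"

definition demazure :: "nat \<Rightarrow> (nat \<Rightarrow> nat) \<Rightarrow> (nat \<Rightarrow> nat) \<Rightarrow> (nat \<Rightarrow> nat)" where
  "demazure n = (THE f. is_demazure n f)"

definition atoms :: "nat \<Rightarrow> (nat \<Rightarrow> nat) \<Rightarrow> (nat \<Rightarrow> nat) set" where
  "atoms n y = {w. is_arg_min cox_length (\<lambda>w. w \<in> Sym n \<and> y = demazure n (inv w) w) w}"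

definition one_FPF :: "nat \<Rightarrow> nat \<Rightarrow> nat" where
  "one_FPF n = word_prod (filter odd [1..<n])"

definition atoms_FPF :: "nat \<Rightarrow> (nat \<Rightarrow> nat) \<Rightarrow> (nat \<Rightarrow> nat) set" where
  "atoms_FPF n z =
     {w. is_arg_min cox_length (\<lambda>w. w \<in> Sym n \<and> z = inv w \<circ> one_FPF n \<circ> w) w}"

section \<open>Schubert polynomials\<close>

text \<open>
  Polynomials in variables indexed by \<^typ>\<open>nat\<close>; monomials are finitely supported exponent
  functions. The coefficients are rational because of the factor 1/2 on the diagonal.
\<close>

type_synonym mpoly = "(nat \<Rightarrow>\<^sub>0 nat) \<Rightarrow>\<^sub>0 rat"

definition X :: "nat \<Rightarrow> mpoly" where
  "X i = Poly_Mapping.single (Poly_Mapping.single i 1) 1"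

definition Const :: "rat \<Rightarrow> mpoly" where
  "Const c = Poly_Mapping.single 0 c"

text \<open>
  The inner \<open>map_key\<close> permutes the exponents of a monomial, the outer one applies this to every
  monomial of the polynomial. \<open>map_key\<close> acts by precomposition; as \<open>adj i\<close> is an involution,
  there is no difference between the action and its inverse.
\<close>

definition swap_vars :: "nat \<Rightarrow> mpoly \<Rightarrow> mpoly" where
  "swap_vars i f = Poly_Mapping.map_key (Poly_Mapping.map_key (adj i)) f"

definition divided_diff :: "nat \<Rightarrow> mpoly \<Rightarrow> mpoly" where
  "divided_diff i f = (THE g. (X i - X (Suc i)) * g = f - swap_vars i f)"

definition longest :: "nat \<Rightarrow> nat \<Rightarrow> nat" where
  "longest n i = (if i \<in> {1..n} then n + 1 - i else i)"

inductive is_schubert :: "nat \<Rightarrow> (nat \<Rightarrow> nat) \<Rightarrow> mpoly \<Rightarrow> bool" for n where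
  longest: "is_schubert n (longest n) (\<Prod>i\<in>{1..<n}. X i ^ (n - i))"
| descent: "is_schubert n w f \<Longrightarrow> i \<in> {1..<n} \<Longrightarrow> w i > w (Suc i) \<Longrightarrow>
    is_schubert n (w \<circ> adj i) (divided_diff i f)"

definition schubert :: "nat \<Rightarrow> (nat \<Rightarrow> nat) \<Rightarrow> mpoly" where
  "schubert n w = (THE f. is_schubert n w f)"

definition inv_schubert :: "nat \<Rightarrow> (nat \<Rightarrow> nat) \<Rightarrow> mpoly" where
  "inv_schubert n y = (\<Sum>w\<in>atoms n y. schubert n w)"

definition inv_schubert_FPF :: "nat \<Rightarrow> (nat \<Rightarrow> nat) \<Rightarrow> mpoly" where
  "inv_schubert_FPF n z = (\<Sum>w\<in>atoms_FPF n z. schubert n w)"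

section \<open>Pipe dreams\<close>

definition triangle :: "nat \<Rightarrow> (nat \<times> nat) set" where
  "triangle n = {(i, j). i \<in> {1..n} \<and> j \<in> {1..n} \<and> i + j \<le> n}"

text \<open>
  \<open>LeftE i j\<close> and \<open>TopE i j\<close> are the left and the top edge of cell \<open>(i, j)\<close>. Since row indices
  increase downwards, the right edge of \<open>(i, j)\<close> is \<open>LeftE i (j + 1)\<close> and its bottom edge is
  \<open>TopE (i + 1) j\<close>. A path inside a cell is recorded by the pair of edges it joins, directed
  from the left or bottom edge to the right or top edge; consistently with this, every pipe is
  directed from its left endpoint to its top endpoint.
\<close>

datatype edge = LeftE nat nat | TopE nat nat

inductive_set strands :: "nat \<Rightarrow> (nat \<times> nat) set \<Rightarrow> (edge \<times> edge) set" for n D where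
  cross_h: "(i, j) \<in> triangle n \<Longrightarrow> (i, j) \<in> D \<Longrightarrow> (LeftE i j, LeftE i (j + 1)) \<in> strands n D"
| cross_v: "(i, j) \<in> triangle n \<Longrightarrow> (i, j) \<in> D \<Longrightarrow> (TopE (i + 1) j, TopE i j) \<in> strands n D"
| avoid_lt: "(i, j) \<in> triangle n \<Longrightarrow> (i, j) \<notin> D \<Longrightarrow> (LeftE i j, TopE i j) \<in> strands n D"
| avoid_br: "(i, j) \<in> triangle n \<Longrightarrow> (i, j) \<notin> D \<Longrightarrow>
    (TopE (i + 1) j, LeftE i (j + 1)) \<in> strands n D"
| diag: "i \<in> {1..n} \<Longrightarrow> j \<in> {1..n} \<Longrightarrow> i + j = n + 1 \<Longrightarrow> (LeftE i j, TopE i j) \<in> strands n D"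

text \<open>The edges that the pipe with left endpoint \<open>p\<close> runs through.\<close>

definition pipe :: "nat \<Rightarrow> (nat \<times> nat) set \<Rightarrow> nat \<Rightarrow> edge set" where
  "pipe n D p = {e. (LeftE p 1, e) \<in> (strands n D)\<^sup>*}"

definition cross_at :: "nat \<Rightarrow> (nat \<times> nat) set \<Rightarrow> nat \<Rightarrow> nat \<Rightarrow> nat \<times> nat \<Rightarrow> bool" where
  "cross_at n D p q c \<longleftrightarrow> c \<in> triangle n \<and> c \<in> D \<and> (case c of (i, j) \<Rightarrow>
     LeftE i j \<in> pipe n D p \<and> TopE (i + 1) j \<in> pipe n D q \<or>
     LeftE i j \<in> pipe n D q \<and> TopE (i + 1) j \<in> pipe n D p)"

definition avoid_at :: "nat \<Rightarrow> (nat \<times> nat) set \<Rightarrow> nat \<Rightarrow> nat \<Rightarrow> nat \<times> nat \<Rightarrow> bool" where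
  "avoid_at n D p q c \<longleftrightarrow> c \<in> triangle n \<and> c \<notin> D \<and> (case c of (i, j) \<Rightarrow>
     LeftE i j \<in> pipe n D p \<and> TopE (i + 1) j \<in> pipe n D q \<or>
     LeftE i j \<in> pipe n D q \<and> TopE (i + 1) j \<in> pipe n D p)"

definition reduced_pipe_dream :: "nat \<Rightarrow> (nat \<times> nat) set \<Rightarrow> bool" where
  "reduced_pipe_dream n D \<longleftrightarrow> D \<subseteq> triangle n \<and>
     (\<forall>p\<in>{1..n}. \<forall>q\<in>{1..n}. p \<noteq> q \<longrightarrow> card {c. cross_at n D p q c} \<le> 1)"

definition PD :: "nat \<Rightarrow> (nat \<Rightarrow> nat) \<Rightarrow> (nat \<times> nat) set set" where
  "PD n w = {D. reduced_pipe_dream n D \<and> (\<forall>p\<in>{1..n}. TopE 1 (w p) \<in> pipe n D p)}"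

definition symmetric :: "(nat \<times> nat) set \<Rightarrow> bool" where
  "symmetric D \<longleftrightarrow> (\<forall>i j. (i, j) \<in> D \<longrightarrow> (j, i) \<in> D)"

definition almost_symmetric :: "nat \<Rightarrow> (nat \<times> nat) set \<Rightarrow> bool" where
  "almost_symmetric n D \<longleftrightarrow>
     (\<forall>i j. i < j \<longrightarrow> (i, j) \<in> D \<longrightarrow> (j, i) \<in> D) \<and>
     (\<forall>i j. i < j \<longrightarrow> (j, i) \<in> D \<longrightarrow> (i, j) \<notin> D \<longrightarrow>
        (\<forall>p\<in>{1..n}. \<forall>q\<in>{1..n}. cross_at n D p q (j, i) \<longrightarrow> avoid_at n D p q (i, j)))"

definition ID :: "nat \<Rightarrow> (nat \<Rightarrow> nat) \<Rightarrow> (nat \<times> nat) set set" where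
  "ID n y = {D \<inter> {(j, i). j \<in> {1..n} \<and> i \<in> {1..n} \<and> i \<le> j} | D.
               D \<in> PD n y \<and> almost_symmetric n D}"

definition FD :: "nat \<Rightarrow> (nat \<Rightarrow> nat) \<Rightarrow> (nat \<times> nat) set set" where
  "FD n z = {D \<inter> {(j, i). j \<in> {1..n} \<and> i \<in> {1..n} \<and> i < j} | D.
               D \<in> PD n z \<and> symmetric D}"

definition kronecker :: "nat \<Rightarrow> nat \<Rightarrow> int" where
  "kronecker i j = (if i = j then 1 else 0)"

end

theory Submission
  imports Defs
begin

text \<open>
  Both sides are coefficients of the same product in a module over the nilCoxeter algebra. By Fomin and
  Stanley, \<open>\<SS>\<^sub>w\<close> is the coefficient of \<open>u\<^sub>w\<close> in \<open>A\<^sub>1(x\<^sub>1) \<dots> A\<^sub>n\<^sub>-\<^sub>1(x\<^sub>n\<^sub>-\<^sub>1)\<close>, where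
  \<open>A\<^sub>i(x) = h\<^sub>n\<^sub>-\<^sub>1(x) \<dots> h\<^sub>i(x)\<close> and \<open>h\<^sub>i(x) = 1 + x u\<^sub>i\<close>. Atoms describe the action of the \<open>u\<^sub>i\<close> on the span of
  the involutions, so the left-hand side is the coefficient of \<open>y\<close> in \<open>e A\<^sub>1(x\<^sub>1) \<dots> A\<^sub>n\<^sub>-\<^sub>1(x\<^sub>n\<^sub>-\<^sub>1)\<close>, with \<open>e\<close> the
  identity or \<open>1\<^sup>F\<^sup>P\<^sup>F\<close>. On \<open>e\<close> the factor \<open>A\<^sub>1(x)\<close> may be reversed to \<open>h\<^sub>1(x) \<dots> h\<^sub>n\<^sub>-\<^sub>1(x)\<close>, and
  the Yang-Baxter relation moves the reversed factor to the right through the others, which turns the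
  product into one of factors \<open>h\<^sub>i\<^sub>+\<^sub>j\<^sub>-\<^sub>1(x\<^sub>i + x\<^sub>j)\<close>, one for each cell on or below the diagonal (\<open>h\<^sub>2\<^sub>i\<^sub>-\<^sub>1(x\<^sub>i)\<close> on
  the diagonal). Its coefficients are sums over the sets of cells whose letters, read outwards from the
  diagonal, form an involution word of \<open>y\<close>. Such a set is the lower half of exactly one almost-symmetric
  pipe dream: a crossing below the diagonal gets a mirror image unless it commutes with the
  involution read so far.
\<close>

section \<open>Inversions and length\<close>

text \<open>The reversal of \<open>A_1(x)\<close> fails in the algebra. It holds on \<open>e\<close>
  because there different words have the same effect: \<open>u_a u_(a+1)\<close> and
  \<open>u_(a+1) u_a\<close> on the identity, \<open>u_m u_(m-1)\<close> and
  \<open>u_m u_(m+1)\<close> with \<open>m\<close> even on \<open>one_FPF n\<close>, where moreover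
  the odd generators act as 0. Once the reversed factor has passed, the others start one letter
  higher and stand next to \<open>e\<close> again, so the argument repeats with the start raised by
  two; hence only odd starts occur. The Demazure product and the Schubert polynomials are given by
  unique descriptions, so each is compared with a model: operators indexed by words for the former,
  coefficients of the product for the latter. Atoms are minimal elements of a set; the invariant
  \<open>L4\<close> turns minimality into an equation of lengths that survives the removal of a last
  letter. Pipes are paths through edges; sweeping the triangle by diagonals of constant content
  turns them into words in adjacent transpositions, where crossing at most once means being
  reduced.\<close>

definition invs :: "(nat \<Rightarrow> nat) \<Rightarrow> (nat \<times> nat) set" where
  "invs w = {(a, b). a < b \<and> w b < w a}"

definition ninv :: "(nat \<Rightarrow> nat) \<Rightarrow> nat" where
  "ninv w = card (invs w)"

lemma Sym_D: "w \<in> Sym n \<Longrightarrow> w permutes {1..n}" by (simp add: Sym_def)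

lemma bij_Sym: "w \<in> Sym n \<Longrightarrow> bij w"
  using Sym_D permutes_bij by blast

lemma id_Sym [simp]: "id \<in> Sym n"
  by (simp add: Sym_def permutes_id)

lemma adj_Sym: "k \<in> {1..<n} \<Longrightarrow> adj k \<in> Sym n"
  by (auto simp: Sym_def intro: permutes_swap_id)

lemma Sym_in: "w \<in> Sym n \<Longrightarrow> i \<in> {1..n} \<Longrightarrow> w i \<in> {1..n}"
  using permutes_in_image[OF Sym_D] by blast

lemma comp_Sym: "v \<in> Sym n \<Longrightarrow> w \<in> Sym n \<Longrightarrow> v \<circ> w \<in> Sym n"
  by (auto simp: Sym_def intro: permutes_compose)

lemma inv_Sym: "w \<in> Sym n \<Longrightarrow> inv w \<in> Sym n"
  by (auto simp: Sym_def intro: permutes_inv)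

lemma finite_Sym: "finite (Sym n)"
  unfolding Sym_def by (rule finite_permutations) simp

lemma inv_inv_Sym: "w \<in> Sym n \<Longrightarrow> inv (inv w) = w"
  by (rule inv_inv_eq[OF bij_Sym])

lemma adj_adj [simp]: "adj k \<circ> adj k = id" by simp

lemma comp_adj_adj [simp]: "w \<circ> adj k \<circ> adj k = w"
  by (simp add: comp_assoc)

lemma adj_adj_comp [simp]: "adj k \<circ> (adj k \<circ> w) = w"
  by (simp flip: comp_assoc)

lemma comp_adj_Sym_iff: "k \<in> {1..<n} \<Longrightarrow> w \<circ> adj k \<in> Sym n \<longleftrightarrow> w \<in> Sym n"
  by (metis comp_Sym adj_Sym comp_adj_adj)

lemma bij_comp_adj_iff [simp]: "bij (w \<circ> adj k) \<longleftrightarrow> bij w"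
  by (metis bij_comp bij_transpose comp_adj_adj)

lemma finite_invs:
  assumes "w \<in> Sym n"
  shows "finite (invs w)"
proof (rule finite_subset)
  have w: "w permutes {1..n}" using assms by (rule Sym_D)
  show "invs w \<subseteq> {1..n} \<times> {1..n}"
  proof
    fix x assume "x \<in> invs w"
    then obtain a b where x: "x = (a, b)" and ab: "a < b" "w b < w a" by (auto simp: invs_def)
    have "b \<le> n"
    proof (rule ccontr)
      assume b: "\<not> b \<le> n"
      then have "w b = b" using w by (simp add: permutes_not_in)
      moreover have "w a < b"
      proof (cases "a \<in> {1..n}")
        case True
        then have "w a \<in> {1..n}" by (rule Sym_in[OF assms])
        then show ?thesis using b by auto
      next
        case False
        then show ?thesis using w ab by (simp add: permutes_not_in)
      qed
      ultimately show False using ab by simp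
    qed
    moreover have "a \<noteq> 0"
    proof
      assume "a = 0"
      then have "w a = 0" using w by (simp add: permutes_not_in)
      then show False using ab by simp
    qed
    ultimately show "x \<in> {1..n} \<times> {1..n}" using ab x by auto
  qed
qed simp

lemma adj_less_iff: "(a, b) \<noteq> (k, Suc k) \<Longrightarrow> a < b \<Longrightarrow> adj k a < adj k b"
  by (auto simp: transpose_def)

text \<open>\<open>adj k\<close> preserves the order of every pair other than
  \<open>(k, Suc k)\<close>, so inversions are transported; at an ascent that one pair becomes a new
  inversion.\<close>

lemma invs_comp_adj:
  assumes "w k < w (Suc k)"
  shows "invs (w \<circ> adj k) = insert (k, Suc k) (map_prod (adj k) (adj k) ` invs w)"
proof (intro equalityI subsetI)
  fix x assume "x \<in> invs (w \<circ> adj k)"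
  then obtain a b where x: "x = (a, b)" "a < b" "w (adj k b) < w (adj k a)"
    by (auto simp: invs_def)
  show "x \<in> insert (k, Suc k) (map_prod (adj k) (adj k) ` invs w)"
  proof (cases "(a, b) = (k, Suc k)")
    case False
    then have "(adj k a, adj k b) \<in> invs w" using x adj_less_iff by (auto simp: invs_def)
    then have "map_prod (adj k) (adj k) (adj k a, adj k b) \<in> map_prod (adj k) (adj k) ` invs w"
      by (rule imageI)
    then show ?thesis using x by simp
  qed (use x in simp)
next
  fix x assume "x \<in> insert (k, Suc k) (map_prod (adj k) (adj k) ` invs w)"
  then consider "x = (k, Suc k)" | a b where "x = (adj k a, adj k b)" "a < b" "w b < w a"
    by (auto simp: invs_def)
  then show "x \<in> invs (w \<circ> adj k)"
  proof cases
    case 1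
    then show ?thesis using assms by (simp add: invs_def)
  next
    case 2
    then have "(a, b) \<noteq> (k, Suc k)" using assms by auto
    then show ?thesis using 2 adj_less_iff by (auto simp: invs_def)
  qed
qed

lemma inj_map_adj: "inj (map_prod (adj k) (adj k))"
  by (rule prod.inj_map) simp_all

lemma finite_invs_comp_adj: "w k < w (Suc k) \<Longrightarrow> finite (invs (w \<circ> adj k)) \<longleftrightarrow> finite (invs w)"
  by (simp add: invs_comp_adj finite_image_iff inj_on_subset[OF inj_map_adj])

text \<open>Assumes finiteness instead of membership in \<open>Sym n\<close> because
  \<open>cox_length\<close> admits words with letters of any size; for an infinite set
  \<open>card\<close> would be 0 and the count meaningless.\<close>

lemma ninv_asc_gen:
  assumes "finite (invs w)" "w k < w (Suc k)"
  shows "ninv (w \<circ> adj k) = Suc (ninv w)"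
proof -
  have "(k, Suc k) \<notin> map_prod (adj k) (adj k) ` invs w"
    using assms(2) by (auto simp: invs_def transpose_def split: if_splits)
  then show ?thesis
    using assms by (simp add: ninv_def invs_comp_adj card_image inj_on_subset[OF inj_map_adj])
qed

lemma ninv_asc: "w \<in> Sym n \<Longrightarrow> w k < w (Suc k) \<Longrightarrow> ninv (w \<circ> adj k) = Suc (ninv w)"
  using ninv_asc_gen finite_invs by blast

lemma bij_asc_or_desc: "bij w \<Longrightarrow> w k < w (Suc k) \<or> w (Suc k) < w k" for w :: "nat \<Rightarrow> nat"
  using bij_is_inj injD n_not_Suc_n linorder_neqE_nat by metis

lemma ninv_desc_gen:
  assumes "finite (invs w)" "w (Suc k) < w k"
  shows "ninv w = Suc (ninv (w \<circ> adj k))"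
proof -
  have "(w \<circ> adj k) k < (w \<circ> adj k) (Suc k)" using assms(2) by simp
  moreover from this have "finite (invs (w \<circ> adj k))"
    using finite_invs_comp_adj[of "w \<circ> adj k" k] assms(1) by simp
  ultimately show ?thesis using ninv_asc_gen[of "w \<circ> adj k" k] by simp
qed

lemma ninv_desc: "w \<in> Sym n \<Longrightarrow> w (Suc k) < w k \<Longrightarrow> ninv w = Suc (ninv (w \<circ> adj k))"
  using ninv_desc_gen finite_invs by blast

lemma ninv_id [simp]: "ninv id = 0"
  unfolding ninv_def invs_def by (auto simp: card_eq_0_iff)

lemma bij_betw_invs_inv:
  assumes "bij w"
  shows "bij_betw (\<lambda>(a, b). (w b, w a)) (invs w) (invs (inv w))"
  by (rule bij_betw_byWitness[where f' = "\<lambda>(a, b). (inv w b, inv w a)"])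
    (use assms in \<open>auto simp: invs_def bij_is_inj bij_is_surj surj_f_inv_f\<close>)

lemma ninv_inv: "bij w \<Longrightarrow> ninv (inv w) = ninv w"
  unfolding ninv_def using bij_betw_same_card[OF bij_betw_invs_inv] by metis

lemma finite_invs_inv: "bij w \<Longrightarrow> finite (invs (inv w)) \<longleftrightarrow> finite (invs w)"
  using bij_betw_finite[OF bij_betw_invs_inv] by blast

lemma inv_adj_comp: "bij w \<Longrightarrow> inv (adj k \<circ> w) = inv w \<circ> adj k"
  by (simp add: o_inv_distrib)

lemma ninv_left_asc_gen:
  assumes b: "bij w" and fin: "finite (invs w)" and asc: "inv w k < inv w (Suc k)"
  shows "ninv (adj k \<circ> w) = Suc (ninv w)"
proof -
  have "ninv (adj k \<circ> w) = ninv (inv (adj k \<circ> w))" using b by (metis bij_comp bij_transpose ninv_inv)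
  also have "\<dots> = ninv (inv w \<circ> adj k)" using b by (simp add: inv_adj_comp)
  also have "\<dots> = Suc (ninv w)" using ninv_asc_gen[of "inv w" k] asc fin b by (simp add: finite_invs_inv ninv_inv)
  finally show ?thesis .
qed

lemma ninv_left_asc: "w \<in> Sym n \<Longrightarrow> inv w k < inv w (Suc k) \<Longrightarrow> ninv (adj k \<circ> w) = Suc (ninv w)"
  using ninv_left_asc_gen[OF bij_Sym finite_invs] .

lemma ninv_left_desc:
  assumes "w \<in> Sym n" "inv w (Suc k) < inv w k"
  shows "ninv w = Suc (ninv (adj k \<circ> w))"
proof -
  have b: "bij w" using assms(1) by (rule bij_Sym)
  have "ninv w = ninv (inv w)" using b by (simp add: ninv_inv)
  also have "\<dots> = Suc (ninv (inv w \<circ> adj k))" using ninv_desc[OF inv_Sym] assms by simp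
  also have "inv w \<circ> adj k = inv (adj k \<circ> w)" using b by (simp add: inv_adj_comp)
  finally show ?thesis using b by (simp add: ninv_inv bij_comp)
qed

lemma Sym_no_descent:
  assumes w: "w \<in> Sym n" and asc: "\<And>k. k \<in> {1..<n} \<Longrightarrow> w k < w (Suc k)"
  shows "w = id"
proof (rule permutes_natset_ge[OF Sym_D[OF w]], intro ballI)
  fix i assume "i \<in> {1..n}"
  then show "i \<le> w i"
  proof (induction i)
    case (Suc i)
    show ?case
    proof (cases "i = 0")
      case True
      have "w (Suc i) \<in> {1..n}" using Suc.prems by (rule Sym_in[OF w])
      then show ?thesis using True by simp
    next
      case False
      then show ?thesis using Suc asc[of i] by simp
    qed
  qed simp
qed

lemma Sym_descent_ex:
  assumes "w \<in> Sym n" "w \<noteq> id"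
  obtains k where "k \<in> {1..<n}" "w (Suc k) < w k"
  using Sym_no_descent assms bij_asc_or_desc bij_Sym by metis

text \<open>Induction along the right weak order: every permutation but the identity has a descent
  in \<open>{1..<n}\<close>, and undoing it removes one inversion.\<close>

lemma Sym_induct [consumes 1, case_names id asc]:
  assumes "w \<in> Sym n" "P id"
    and "\<And>w k. w \<in> Sym n \<Longrightarrow> k \<in> {1..<n} \<Longrightarrow> w k < w (Suc k) \<Longrightarrow> P w \<Longrightarrow> P (w \<circ> adj k)"
  shows "P w"
  using assms(1)
proof (induction "ninv w" arbitrary: w rule: less_induct)
  case less
  show ?case
  proof (cases "w = id")
    case False
    then obtain k where k: "k \<in> {1..<n}" "w (Suc k) < w k" using Sym_descent_ex less by metis
    have "P (w \<circ> adj k)" using less k ninv_desc[of w n k] by (simp add: comp_adj_Sym_iff)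
    then have "P (w \<circ> adj k \<circ> adj k)"
      using assms(3)[of "w \<circ> adj k" k] k less by (simp add: comp_adj_Sym_iff)
    then show ?thesis by simp
  qed (use assms(2) in simp)
qed

section \<open>Words and Coxeter length\<close>

lemma word_prod_Nil [simp]: "word_prod [] = id" by (simp add: word_prod_def)
lemma word_prod_Cons [simp]: "word_prod (k # ks) = adj k \<circ> word_prod ks" by (simp add: word_prod_def)
lemma word_prod_append: "word_prod (ks @ ls) = word_prod ks \<circ> word_prod ls"
  by (induction ks) (simp_all add: comp_assoc)

lemma word_prod_Sym: "set ks \<subseteq> {1..<n} \<Longrightarrow> word_prod ks \<in> Sym n"
  by (induction ks) (simp_all add: comp_Sym adj_Sym)

lemma bij_word_prod: "bij (word_prod ks)"
proof (induction ks)
  case Nil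
  show "bij (word_prod [])" by simp
next
  case (Cons k ks)
  then show "bij (word_prod (k # ks))" unfolding word_prod_Cons by (simp add: bij_comp)
qed

lemma ninv_word_prod_aux: "finite (invs (word_prod ks)) \<and> ninv (word_prod ks) \<le> length ks"
proof (induction ks rule: rev_induct)
  case Nil
  show "finite (invs (word_prod [])) \<and> ninv (word_prod []) \<le> length []"
    using finite_invs[OF id_Sym] by simp
next
  case (snoc k ks)
  let ?w = "word_prod ks"
  have eq: "word_prod (ks @ [k]) = ?w \<circ> adj k" by (simp add: word_prod_append)
  consider "?w k < ?w (Suc k)" | "?w (Suc k) < ?w k" using bij_asc_or_desc bij_word_prod by blast
  then have "finite (invs (word_prod (ks @ [k]))) \<and> ninv (word_prod (ks @ [k])) \<le> length (ks @ [k])"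
  proof cases
    case 1
    then show ?thesis using snoc by (simp add: eq finite_invs_comp_adj ninv_asc_gen)
  next
    case 2
    then have "finite (invs (?w \<circ> adj k))" using snoc finite_invs_comp_adj[of "?w \<circ> adj k" k] by simp
    then show ?thesis using snoc ninv_desc_gen[of ?w k] 2 by (simp add: eq)
  qed
  then show ?case .
qed

lemma ninv_word_prod: "ninv (word_prod ks) \<le> length ks" using ninv_word_prod_aux by blast

lemma reduced_word_ex:
  "w \<in> Sym n \<Longrightarrow> \<exists>ks. set ks \<subseteq> {1..<n} \<and> length ks = ninv w \<and> w = word_prod ks"
proof (induction rule: Sym_induct)
  case (asc w k)
  then obtain ks where "set ks \<subseteq> {1..<n}" "length ks = ninv w" "w = word_prod ks" by blast
  then show ?case using asc ninv_asc[of w n k]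
    by (intro exI[of _ "ks @ [k]"]) (auto simp: word_prod_append simp del: comp_apply)
next
  case id
  show "\<exists>ks. set ks \<subseteq> {1..<n} \<and> length ks = ninv id \<and> id = word_prod ks"
    by (intro exI[of _ "[]"]) simp
qed

text \<open>The minimum runs over words in all positive letters. The lower bound
  \<open>ninv_word_prod\<close> is independent of \<open>n\<close>, and a reduced word with letters
  in \<open>{1..<n}\<close> attains it.\<close>

lemma cox_length_eq:
  assumes "w \<in> Sym n"
  shows "cox_length w = ninv w"
  unfolding cox_length_def
proof (rule Least_equality)
  show "\<exists>is. length is = ninv w \<and> set is \<subseteq> {1..} \<and> w = word_prod is"
    using reduced_word_ex[OF assms] by fastforce
qed (use ninv_word_prod in blast)

lemma ninv_comp_le:
  assumes "v \<in> Sym n" "w \<in> Sym n"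
  shows "ninv (v \<circ> w) \<le> ninv v + ninv w"
proof -
  obtain ks ls where "v = word_prod ks" "length ks = ninv v" "w = word_prod ls" "length ls = ninv w"
    using reduced_word_ex assms by metis
  then show ?thesis using ninv_word_prod[of "ks @ ls"] by (simp add: word_prod_append)
qed

section \<open>The Demazure product\<close>

definition dem_right :: "nat \<Rightarrow> (nat \<Rightarrow> nat) \<Rightarrow> nat \<Rightarrow> nat" where
  "dem_right k w = (if w k < w (Suc k) then w \<circ> adj k else w)"

definition dem_left :: "nat \<Rightarrow> (nat \<Rightarrow> nat) \<Rightarrow> nat \<Rightarrow> nat" where
  "dem_left k w = (if inv w k < inv w (Suc k) then adj k \<circ> w else w)"

lemma dem_right_Sym: "k \<in> {1..<n} \<Longrightarrow> w \<in> Sym n \<Longrightarrow> dem_right k w \<in> Sym n"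
  by (simp add: dem_right_def comp_Sym adj_Sym)

lemma dem_left_Sym: "k \<in> {1..<n} \<Longrightarrow> w \<in> Sym n \<Longrightarrow> dem_left k w \<in> Sym n"
  by (simp add: dem_left_def comp_Sym adj_Sym)

lemma dem_right_asc: "w k < w (Suc k) \<Longrightarrow> dem_right k w = w \<circ> adj k"
  by (simp add: dem_right_def)

lemma dem_left_asc: "inv w k < inv w (Suc k) \<Longrightarrow> dem_left k w = adj k \<circ> w"
  by (simp add: dem_left_def)

lemma adj_less_adj_iff: "{a, b} \<noteq> {k, Suc k} \<Longrightarrow> a \<noteq> b \<Longrightarrow> adj k a < adj k b \<longleftrightarrow> a < b"
  by (auto simp: transpose_def)

text \<open>The two tests interfere only if \<open>w\<close> maps \<open>{l, Suc l}\<close> onto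
  \<open>{k, Suc k}\<close>. Then \<open>adj k \<circ> w = w \<circ> adj l\<close>: at an ascent
  only the operator applied first acts, with the same result in either order, and at a descent
  neither acts.\<close>

lemma dem_left_right_commute:
  assumes w: "bij w"
  shows "dem_left k (dem_right l w) = dem_right l (dem_left k w)"
proof -
  have ne: "w l \<noteq> w (Suc l)" "inv w k \<noteq> inv w (Suc k)"
    using w by (metis bij_is_inj injD n_not_Suc_n, metis bij_imp_bij_inv bij_is_inj injD n_not_Suc_n w)
  have inj: "inv (w \<circ> adj l) = adj l \<circ> inv w" "inv (adj k \<circ> w) = inv w \<circ> adj k"
    using w by (simp_all add: o_inv_distrib)
  have iw: "inv w (w x) = x" for x using w by (simp add: bij_is_inj)
  have eq: "{w l, w (Suc l)} = {k, Suc k} \<longleftrightarrow> {inv w k, inv w (Suc k)} = {l, Suc l}"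
    unfolding doubleton_eq_iff using iw w by (metis bij_inv_eq_iff)
  show ?thesis
  proof (cases "{w l, w (Suc l)} = {k, Suc k}")
    case True
    then consider "w l = k" "w (Suc l) = Suc k" | "w l = Suc k" "w (Suc l) = k"
      by (auto simp: doubleton_eq_iff)
    then show ?thesis
    proof cases
      case 1
      have "adj k \<circ> w = w \<circ> adj l"
        using transpose_comp_eq[OF w, of k "Suc k"] 1 iw by metis
      moreover have "inv w k = l" "inv w (Suc k) = Suc l" using 1 iw by metis+
      ultimately show ?thesis using 1 inj by (simp add: dem_left_def dem_right_def)
    next
      case 2
      have "inv w k = Suc l" "inv w (Suc k) = l" using 2 iw by metis+
      then show ?thesis using 2 by (simp add: dem_left_def dem_right_def)
    qed
  next
    case False
    then have "adj k (w l) < adj k (w (Suc l)) \<longleftrightarrow> w l < w (Suc l)"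
      "adj l (inv w k) < adj l (inv w (Suc k)) \<longleftrightarrow> inv w k < inv w (Suc k)"
      using ne eq by (metis adj_less_adj_iff)+
    then show ?thesis using inj by (simp add: dem_left_def dem_right_def comp_assoc)
  qed
qed

section \<open>Construction of the product from words\<close>

definition dem_word :: "nat list \<Rightarrow> (nat \<Rightarrow> nat) \<Rightarrow> nat \<Rightarrow> nat" where
  "dem_word ks w = fold dem_right ks w"

lemma dem_word_Nil [simp]: "dem_word [] w = w" by (simp add: dem_word_def)
lemma dem_word_append: "dem_word (ks @ ls) w = dem_word ls (dem_word ks w)"
  by (simp add: dem_word_def)
lemma dem_word_snoc: "dem_word (ks @ [k]) w = dem_right k (dem_word ks w)"
  by (simp add: dem_word_def)
lemma dem_word_single [simp]: "dem_word [k] w = dem_right k w" by (simp add: dem_word_def)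

lemma dem_word_Sym: "set ks \<subseteq> {1..<n} \<Longrightarrow> w \<in> Sym n \<Longrightarrow> dem_word ks w \<in> Sym n"
  by (induction ks rule: rev_induct) (simp_all add: dem_word_snoc dem_right_Sym)

lemma dem_left_word_commute:
  assumes "set ks \<subseteq> {1..<n}" "w \<in> Sym n"
  shows "dem_left k (dem_word ks w) = dem_word ks (dem_left k w)"
  using assms(1)
proof (induction ks rule: rev_induct)
  case (snoc l ks)
  then have "dem_word ks w \<in> Sym n" using assms(2) dem_word_Sym by simp
  then show ?case using snoc dem_left_right_commute bij_Sym by (simp add: dem_word_snoc)
qed simp

text \<open>Stated for \<open>inv w\<close> because \<open>Sym_induct\<close> multiplies on the
  right, which inversion turns into multiplication on the left.\<close>

lemma dem_left_reach: "w \<in> Sym n \<Longrightarrow> \<exists>cs. set cs \<subseteq> {1..<n} \<and> inv w = fold dem_left cs id"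
proof (induction w rule: Sym_induct)
  case (asc w k)
  then obtain cs where cs: "set cs \<subseteq> {1..<n}" "inv w = fold dem_left cs id" by blast
  have "inv (w \<circ> adj k) = dem_left k (inv w)"
    using asc by (simp add: o_inv_distrib bij_Sym dem_left_asc inv_inv_Sym)
  then have "inv (w \<circ> adj k) = fold dem_left (cs @ [k]) id" using cs by simp
  then show "\<exists>cs. set cs \<subseteq> {1..<n} \<and> inv (w \<circ> adj k) = fold dem_left cs id"
    using cs(1) asc.hyps by (intro exI[of _ "cs @ [k]"]) (simp del: fold_append)
next
  case id
  show "\<exists>cs. set cs \<subseteq> {1..<n} \<and> inv id = fold dem_left cs id"
    by (intro exI[of _ "[]"]) simp
qed

lemma fold_dem_left_Sym: "set cs \<subseteq> {1..<n} \<Longrightarrow> w \<in> Sym n \<Longrightarrow> fold dem_left cs w \<in> Sym n"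
  by (induction cs rule: rev_induct) (simp_all add: dem_left_Sym)

text \<open>
  Every permutation is reached from the identity by the operators \<open>dem_left k\<close>, and these commute
  with all \<open>dem_right l\<close>. This replaces Matsumoto's theorem in the construction of the product.
\<close>

lemma dem_word_determined:
  assumes "set as \<subseteq> {1..<n}" "set bs \<subseteq> {1..<n}" "dem_word as id = dem_word bs id" "u \<in> Sym n"
  shows "dem_word as u = dem_word bs u"
proof -
  have step: "dem_word as (fold dem_left cs id) = fold dem_left cs (dem_word as id)"
    if "set cs \<subseteq> {1..<n}" "set as \<subseteq> {1..<n}" for as cs
    using that(1)
  proof (induction cs rule: rev_induct)
    case (snoc c cs)
    have "dem_word as (fold dem_left cs id) = fold dem_left cs (dem_word as id)"
      by (rule snoc.IH) (use snoc.prems in simp)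
    then show "dem_word as (fold dem_left (cs @ [c]) id) = fold dem_left (cs @ [c]) (dem_word as id)"
      using snoc.prems dem_left_word_commute[OF that(2), of "fold dem_left cs id" c]
      fold_dem_left_Sym[of cs n id] by simp
  qed simp
  obtain cs where "set cs \<subseteq> {1..<n}" "u = fold dem_left cs id"
    using dem_left_reach[OF inv_Sym[OF assms(4)]] inv_inv_Sym[OF assms(4)] by metis
  then show ?thesis using step assms by simp
qed

text \<open>If lengths add up, every letter is applied at an ascent: a single descent would leave
  the final length below the number of letters added.\<close>

lemma dem_word_additive:
  assumes "set ks \<subseteq> {1..<n}" "v \<in> Sym n" "ninv (v \<circ> word_prod ks) = ninv v + length ks"
  shows "dem_word ks v = v \<circ> word_prod ks"
  using assms(1,3)
proof (induction ks rule: rev_induct)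
  case (snoc k ks)
  let ?w = "v \<circ> word_prod ks"
  have w: "?w \<in> Sym n" using snoc.prems assms(2) by (simp add: comp_Sym word_prod_Sym)
  have ih: "dem_word ks v = ?w" if "ninv ?w = ninv v + length ks"
    by (rule snoc.IH) (use snoc.prems that in \<open>simp_all del: comp_apply\<close>)
  have prem: "ninv (v \<circ> word_prod (ks @ [k])) = ninv v + length (ks @ [k])" by (rule snoc.prems)
  have e: "v \<circ> word_prod (ks @ [k]) = ?w \<circ> adj k" by (simp add: word_prod_append comp_assoc)
  have le: "ninv ?w \<le> ninv v + length ks"
    using ninv_comp_le[OF assms(2) word_prod_Sym, of ks] ninv_word_prod[of ks] snoc.prems by simp
  have asc: "?w k < ?w (Suc k)"
  proof (rule ccontr)
    assume "\<not> ?w k < ?w (Suc k)"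
    then have "?w (Suc k) < ?w k" using bij_asc_or_desc bij_Sym w by metis
    from ninv_desc[OF w this] show False using prem le by (simp only: e) simp
  qed
  have "ninv (?w \<circ> adj k) = Suc (ninv ?w)" by (rule ninv_asc[OF w asc])
  then have "ninv ?w = ninv v + length ks" using prem by (simp del: comp_apply add: e)
  then have "dem_word ks v = ?w" by (rule ih)
  then show "dem_word (ks @ [k]) v = v \<circ> word_prod (ks @ [k])" using asc e by (simp only: dem_word_snoc dem_right_asc)
qed simp

lemma dem_word_reduced:
  assumes "w \<in> Sym n"
  shows "\<exists>ks. set ks \<subseteq> {1..<n} \<and> length ks = ninv w \<and> w = word_prod ks \<and> dem_word ks id = w"
proof -
  obtain ks where ks: "set ks \<subseteq> {1..<n}" "length ks = ninv w" "w = word_prod ks"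
    using reduced_word_ex assms by blast
  then show ?thesis using dem_word_additive[OF ks(1) id_Sym] by auto
qed

text \<open>By \<open>dem_word_determined\<close> the choice of the word does not affect the result.
  The value \<open>undefined\<close> matches the last clause of \<open>is_demazure\<close>.\<close>

definition dem :: "nat \<Rightarrow> (nat \<Rightarrow> nat) \<Rightarrow> (nat \<Rightarrow> nat) \<Rightarrow> nat \<Rightarrow> nat" where
  "dem n u w = (if u \<in> Sym n \<and> w \<in> Sym n
     then dem_word (SOME ks. set ks \<subseteq> {1..<n} \<and> dem_word ks id = w) u else undefined)"

lemma dem_eq:
  assumes "u \<in> Sym n" "set ks \<subseteq> {1..<n}" "dem_word ks id = w"
  shows "dem n u w = dem_word ks u"
proof -
  have w: "w \<in> Sym n" using dem_word_Sym[OF assms(2) id_Sym] assms(3) by simp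
  define ls where "ls = (SOME ks. set ks \<subseteq> {1..<n} \<and> dem_word ks id = w)"
  have "set ls \<subseteq> {1..<n} \<and> dem_word ls id = w"
    unfolding ls_def by (rule someI[of _ ks]) (use assms in simp)
  then show ?thesis unfolding dem_def ls_def[symmetric]
    using assms w dem_word_determined[of ls n ks u] by simp
qed

text \<open>Associativity is concatenation of words for \<open>v\<close> and \<open>w\<close>;
  additivity is \<open>dem_word_additive\<close> for a reduced word of \<open>v\<close>.\<close>

lemma is_demazure_dem: "is_demazure n (dem n)"
  unfolding is_demazure_def
proof (intro conjI ballI allI impI)
  fix u v assume uv: "u \<in> Sym n" "v \<in> Sym n"
  obtain ks where ks: "set ks \<subseteq> {1..<n}" "length ks = ninv v" "v = word_prod ks" "dem_word ks id = v"
    using dem_word_reduced uv by blast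
  have u: "dem n u v = dem_word ks u" using dem_eq uv ks by blast
  then show m: "dem n u v \<in> Sym n" using dem_word_Sym uv ks by simp
  show "cox_length (u \<circ> v) = cox_length u + cox_length v \<Longrightarrow> dem n u v = u \<circ> v"
    using dem_word_additive[OF ks(1) uv(1)] ks uv u by (simp add: cox_length_eq[of _ n] comp_Sym)
  fix w assume w: "w \<in> Sym n"
  obtain ls where ls: "set ls \<subseteq> {1..<n}" "dem_word ls id = w"
    using dem_word_reduced w by blast
  have "dem_word (ks @ ls) id = dem n v w"
    using dem_eq[OF uv(2) ls] ks by (simp add: dem_word_append)
  then have "dem n u (dem n v w) = dem_word (ks @ ls) u" using dem_eq[of u n "ks @ ls"] uv ks ls by simp
  then show "dem n (dem n u v) w = dem n u (dem n v w)"
    using dem_eq[OF m ls] u by (simp add: dem_word_append)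
next
  fix i assume i: "i \<in> {1..<n}"
  have "dem_word [i] id = adj i" by (simp add: dem_right_def)
  then have "dem n (adj i) (adj i) = dem_word [i] (adj i)"
    using dem_eq[of "adj i" n "[i]" "adj i"] i adj_Sym by simp
  then show "dem n (adj i) (adj i) = adj i" by (simp add: dem_right_def)
qed (auto simp: dem_def)

section \<open>Uniqueness of the product\<close>

lemma is_demazure_id:
  assumes "is_demazure n f" "v \<in> Sym n"
  shows "f v id = v" "f id v = v"
proof -
  have add: "cox_length (v \<circ> w) = cox_length v + cox_length w \<Longrightarrow> f v w = v \<circ> w"
    if "v \<in> Sym n" "w \<in> Sym n" for v w
    using assms(1) that unfolding is_demazure_def by blast
  show "f v id = v" "f id v = v"
    using add[of v id] add[of id v] assms(2) by (simp_all add: cox_length_eq[of _ n])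
qed

text \<open>At a descent, \<open>v\<close> is \<open>f u (adj k)\<close> with \<open>u\<close>
  shorter by one, and associativity with idempotence absorbs the second factor.\<close>

lemma is_demazure_adj:
  assumes f: "is_demazure n f" and v: "v \<in> Sym n" and k: "k \<in> {1..<n}"
  shows "f v (adj k) = dem_right k v"
proof -
  have add: "f v (adj k) = v \<circ> adj k" if "v \<in> Sym n" "v k < v (Suc k)" for v
  proof -
    have "ninv (adj k) = 1" using ninv_asc[of id n k] by simp
    then have "cox_length (v \<circ> adj k) = cox_length v + cox_length (adj k)"
      using that k by (simp add: cox_length_eq[of _ n] comp_Sym adj_Sym ninv_asc)
    then show ?thesis using f that k adj_Sym unfolding is_demazure_def by blast
  qed
  show ?thesis
  proof (cases "v k < v (Suc k)")
    case True
    then show ?thesis using add v by (simp add: dem_right_asc)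
  next
    case False
    let ?u = "v \<circ> adj k"
    have u: "?u \<in> Sym n" "?u k < ?u (Suc k)"
      using False v k bij_asc_or_desc[of v k] bij_Sym[OF v] by (simp_all add: comp_adj_Sym_iff)
    have "f ?u (adj k) = v" using add[of ?u] u by simp
    moreover have "f (f ?u (adj k)) (adj k) = f ?u (f (adj k) (adj k))" "f (adj k) (adj k) = adj k"
      using f u k adj_Sym unfolding is_demazure_def by blast+
    ultimately show ?thesis using False by (simp add: dem_right_def)
  qed
qed

lemma is_demazure_comp_adj:
  assumes f: "is_demazure n f" and "u \<in> Sym n" "v \<in> Sym n" "k \<in> {1..<n}" "v k < v (Suc k)"
  shows "f u (v \<circ> adj k) = dem_right k (f u v)"
proof -
  have "f v (adj k) = v \<circ> adj k" using is_demazure_adj[OF f] dem_right_asc assms by metis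
  moreover have "f (f u v) (adj k) = f u (f v (adj k))"
    using f assms(2,3) adj_Sym[OF assms(4)] unfolding is_demazure_def by blast
  moreover have "f u v \<in> Sym n"
    using f assms(2,3) unfolding is_demazure_def by blast
  ultimately show ?thesis using is_demazure_adj[OF f, of "f u v" k] assms by simp
qed

lemma is_demazure_unique:
  assumes f: "is_demazure n f" and g: "is_demazure n g"
  shows "f = g"
proof (intro ext)
  fix u v x
  have "f u v = g u v"
  proof (cases "u \<in> Sym n \<and> v \<in> Sym n")
    case True
    then have u: "u \<in> Sym n" by simp
    from True have "v \<in> Sym n" by simp
    then show ?thesis
    proof (induction v rule: Sym_induct)
      case id
      show "f u id = g u id" using is_demazure_id f g u by metis
    next
      case (asc v k)
      then show "f u (v \<circ> adj k) = g u (v \<circ> adj k)" 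
        using is_demazure_comp_adj f g u by simp
    qed
  next
    case False
    then show ?thesis using f g unfolding is_demazure_def by metis
  qed
  then show "f u v x = g u v x" by simp
qed

lemma is_demazure_demazure: "is_demazure n (demazure n)"
proof -
  have "demazure n = dem n"
    unfolding demazure_def
    by (rule the_equality[of "is_demazure n", OF is_demazure_dem])
      (rule is_demazure_unique[OF _ is_demazure_dem])
  then show ?thesis using is_demazure_dem by simp
qed

lemma demazure_Sym: "u \<in> Sym n \<Longrightarrow> v \<in> Sym n \<Longrightarrow> demazure n u v \<in> Sym n"
  using is_demazure_demazure unfolding is_demazure_def by blast

lemma demazure_assoc:
  "u \<in> Sym n \<Longrightarrow> v \<in> Sym n \<Longrightarrow> w \<in> Sym n \<Longrightarrow>
    demazure n (demazure n u v) w = demazure n u (demazure n v w)"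
  using is_demazure_demazure unfolding is_demazure_def by blast

lemma demazure_additive:
  "u \<in> Sym n \<Longrightarrow> v \<in> Sym n \<Longrightarrow> ninv (u \<circ> v) = ninv u + ninv v \<Longrightarrow> demazure n u v = u \<circ> v"
  using is_demazure_demazure[of n] unfolding is_demazure_def by (simp add: cox_length_eq[of _ n] comp_Sym)

lemmas demazure_id = is_demazure_id[OF is_demazure_demazure]
lemmas demazure_adj = is_demazure_adj[OF is_demazure_demazure]

text \<open>Lengths add in \<open>v \<circ> adj k\<close> and in its inverse, so both are Demazure
  products, and associativity brings \<open>demazure n (inv v) v\<close> into the middle.\<close>

lemma demazure_inv_step:
  assumes v: "v \<in> Sym n" and k: "k \<in> {1..<n}" and asc: "v k < v (Suc k)"
  shows "demazure n (inv (v \<circ> adj k)) (v \<circ> adj k)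
    = demazure n (adj k) (dem_right k (demazure n (inv v) v))"
proof -
  note S = v inv_Sym[OF v] adj_Sym[OF k]
  have i: "inv (v \<circ> adj k) = adj k \<circ> inv v" using v by (simp add: o_inv_distrib bij_Sym)
  have "ninv (adj k) = 1" using ninv_asc[of id n k] by simp
  moreover have "ninv (adj k \<circ> inv v) = Suc (ninv (inv v))"
    using S asc by (simp add: ninv_left_asc inv_inv_Sym)
  ultimately have "demazure n (adj k) (inv v) = adj k \<circ> inv v"
    using S by (simp add: demazure_additive)
  moreover have "demazure n v (adj k) = v \<circ> adj k" using S k asc by (simp add: demazure_adj dem_right_asc)
  ultimately have "demazure n (inv (v \<circ> adj k)) (v \<circ> adj k)
      = demazure n (demazure n (adj k) (inv v)) (demazure n v (adj k))" using i by simp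
  also have "\<dots> = demazure n (adj k) (demazure n (demazure n (inv v) v) (adj k))"
    using S by (simp add: demazure_assoc demazure_Sym)
  also have "\<dots> = demazure n (adj k) (dem_right k (demazure n (inv v) v))"
    using S k by (simp add: demazure_adj demazure_Sym)
  finally show ?thesis .
qed

section \<open>Involutions and their atoms\<close>

lemma Inv_iff: "y \<in> Inv n \<longleftrightarrow> y \<in> Sym n \<and> (\<forall>i. y (y i) = i)"
proof
  assume y: "y \<in> Inv n"
  then have "y \<in> Sym n" "y = inv y" by (auto simp: Inv_def)
  moreover have "inv y (y i) = i" for i using bij_is_inj[OF bij_Sym[OF calculation(1)]] by simp
  ultimately show "y \<in> Sym n \<and> (\<forall>i. y (y i) = i)" by metis
next
  assume y: "y \<in> Sym n \<and> (\<forall>i. y (y i) = i)"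
  then have "y \<circ> y = id" by (simp add: fun_eq_iff)
  then have "inv y = y" by (rule inv_unique_comp[rotated]) (use \<open>y \<circ> y = id\<close> in simp)
  then show "y \<in> Inv n" using y by (simp add: Inv_def)
qed

lemma Inv_Sym: "y \<in> Inv n \<Longrightarrow> y \<in> Sym n" by (simp add: Inv_def)
lemma Inv_inv: "y \<in> Inv n \<Longrightarrow> inv y = y" by (simp add: Inv_def)
lemma Inv_invol: "y \<in> Inv n \<Longrightarrow> y (y i) = i" by (simp add: Inv_iff)
lemma Inv_bij: "y \<in> Inv n \<Longrightarrow> bij y" using Inv_Sym bij_Sym by blast
lemma Inv_eq_iff: "y \<in> Inv n \<Longrightarrow> y i = y j \<longleftrightarrow> i = j" by (metis Inv_invol)
lemma Inv_asc_or_desc: "y \<in> Inv n \<Longrightarrow> y k < y (Suc k) \<or> y (Suc k) < y k"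
  using bij_asc_or_desc Inv_bij by blast
lemma id_Inv [simp]: "id \<in> Inv n" by (simp add: Inv_iff)

lemma conj_Inv: "y \<in> Inv n \<Longrightarrow> k \<in> {1..<n} \<Longrightarrow> adj k \<circ> y \<circ> adj k \<in> Inv n"
  by (simp add: Inv_iff comp_Sym adj_Sym)

text \<open>
  At an ascent \<open>k\<close> of \<open>y\<close> this is the Demazure conjugate of \<open>y\<close> by \<open>adj k\<close>, and at a descent
  it is the unique involution whose Demazure conjugate is \<open>y\<close>.
\<close>

definition tw :: "nat \<Rightarrow> (nat \<Rightarrow> nat) \<Rightarrow> nat \<Rightarrow> nat" where
  "tw k y = (if adj k \<circ> y \<circ> adj k = y then y \<circ> adj k else adj k \<circ> y \<circ> adj k)"

lemma tw_fix: "adj k \<circ> y \<circ> adj k = y \<Longrightarrow> tw k y = y \<circ> adj k"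
  by (simp add: tw_def)

lemma tw_move: "adj k \<circ> y \<circ> adj k \<noteq> y \<Longrightarrow> tw k y = adj k \<circ> y \<circ> adj k"
  by (simp add: tw_def)

lemma adj_eq_iff: "adj k a = b \<longleftrightarrow> a = adj k b" by auto

lemma conj_eq_comm: "adj k \<circ> y \<circ> adj k = y \<longleftrightarrow> adj k \<circ> y = y \<circ> adj k"
  by (metis adj_adj_comp comp_adj_adj comp_assoc)

lemma tw_Inv:
  assumes y: "y \<in> Inv n" and k: "k \<in> {1..<n}"
  shows "tw k y \<in> Inv n"
proof (cases "adj k \<circ> y \<circ> adj k = y")
  case True
  have "y (adj k (y (adj k i))) = i" for i
  proof -
    have "adj k (y (adj k i)) = y i" using True by (metis comp_apply)
    then show ?thesis using Inv_invol[OF y] by simp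
  qed
  then have "y \<circ> adj k \<in> Inv n" using y k by (simp add: Inv_iff comp_Sym adj_Sym)
  then show ?thesis using tw_fix[OF True] by simp
next
  case False
  then show ?thesis using conj_Inv[OF y k] tw_move by metis
qed

lemma tw_tw: "tw k (tw k y) = y"
proof (cases "adj k \<circ> y \<circ> adj k = y")
  case True
  then have t: "tw k y = y \<circ> adj k" by (rule tw_fix)
  have "adj k \<circ> (y \<circ> adj k) \<circ> adj k = y \<circ> adj k" using True by (metis comp_assoc)
  then have "tw k (y \<circ> adj k) = y \<circ> adj k \<circ> adj k" by (rule tw_fix)
  then show ?thesis using t by (simp only: comp_adj_adj)
next
  case False
  then have t: "tw k y = adj k \<circ> y \<circ> adj k" by (rule tw_move)
  have c: "adj k \<circ> (adj k \<circ> y \<circ> adj k) \<circ> adj k = y" by (simp only: comp_assoc adj_adj_comp adj_adj comp_id)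
  then have "tw k (adj k \<circ> y \<circ> adj k) = adj k \<circ> (adj k \<circ> y \<circ> adj k) \<circ> adj k"
    using False by (intro tw_move) metis
  then show ?thesis using t c by metis
qed

lemma conj_eq_iff:
  assumes y: "y \<in> Inv n"
  shows "adj k \<circ> y \<circ> adj k = y \<longleftrightarrow> {y k, y (Suc k)} = {k, Suc k}"
proof
  assume "adj k \<circ> y \<circ> adj k = y"
  then have "adj k (y (Suc k)) = y k" by (metis comp_apply transpose_apply_first)
  then have "y (Suc k) = adj k (y k)" using adj_eq_iff by metis
  moreover have "y (Suc k) \<noteq> y k" using Inv_eq_iff[OF y] by simp
  ultimately show "{y k, y (Suc k)} = {k, Suc k}" by (auto simp: transpose_def split: if_splits)
next
  assume a: "{y k, y (Suc k)} = {k, Suc k}"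
  show "adj k \<circ> y \<circ> adj k = y"
  proof
    fix i
    consider "y k = k" "y (Suc k) = Suc k" | "y k = Suc k" "y (Suc k) = k"
      using a by (auto simp: doubleton_eq_iff)
    then show "(adj k \<circ> y \<circ> adj k) i = y i"
      by cases (use Inv_eq_iff[OF y, of i k] Inv_eq_iff[OF y, of i "Suc k"] in \<open>auto simp: transpose_def\<close>)
  qed
qed

lemma asc_conj_eq:
  assumes y: "y \<in> Inv n" and asc: "y k < y (Suc k)"
  shows "adj k \<circ> y \<circ> adj k = y \<longleftrightarrow> {y k, y (Suc k)} = {k, Suc k}"
    and "adj k \<circ> y \<circ> adj k = y \<longleftrightarrow> y k = k \<and> y (Suc k) = Suc k"
  using conj_eq_iff[OF y] asc by (auto simp: doubleton_eq_iff)

lemma desc_conj_eq: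
  assumes y: "y \<in> Inv n" and desc: "y (Suc k) < y k"
  shows "adj k \<circ> y \<circ> adj k = y \<longleftrightarrow> {y k, y (Suc k)} = {k, Suc k}"
    and "adj k \<circ> y \<circ> adj k = y \<longleftrightarrow> y k = Suc k \<and> y (Suc k) = k"
  using conj_eq_iff[OF y] desc by (auto simp: doubleton_eq_iff)

text \<open>The second multiplication is at an ascent as well: \<open>adj k\<close> keeps the order
  of \<open>y k\<close> and \<open>y (Suc k)\<close> unless they are \<open>k\<close> and
  \<open>Suc k\<close>.\<close>

lemma ninv_conj_asc:
  assumes y: "y \<in> Inv n" and asc: "y k < y (Suc k)" and ne: "adj k \<circ> y \<circ> adj k \<noteq> y"
  shows "ninv (adj k \<circ> y \<circ> adj k) = Suc (Suc (ninv y))"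
proof -
  have fin: "finite (invs (y \<circ> adj k))" using finite_invs[OF Inv_Sym[OF y]] asc by (simp add: finite_invs_comp_adj)
  have i: "inv (y \<circ> adj k) = adj k \<circ> y" using y by (simp add: o_inv_distrib Inv_bij Inv_inv)
  have "{y k, y (Suc k)} \<noteq> {k, Suc k}" using ne asc_conj_eq(1)[OF y asc] by simp
  then have "adj k (y k) < adj k (y (Suc k))" using adj_less_adj_iff[of "y k" "y (Suc k)" k] asc by simp
  then have "ninv (adj k \<circ> (y \<circ> adj k)) = Suc (ninv (y \<circ> adj k))"
    using fin Inv_bij[OF y] by (intro ninv_left_asc_gen) (simp_all add: i)
  also have "ninv (y \<circ> adj k) = Suc (ninv y)" using Inv_Sym[OF y] asc by (rule ninv_asc)
  finally show ?thesis by (simp only: comp_assoc)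
qed

text \<open>Four times the length of the atoms of \<open>y\<close>.\<close>

definition L4 :: "(nat \<Rightarrow> nat) \<Rightarrow> nat" where
  "L4 y = 2 * ninv y + card {i. y i \<noteq> i}"

lemma L4_id [simp]: "L4 id = 0" by (simp add: L4_def)

lemma finite_supp: "y \<in> Sym n \<Longrightarrow> finite {i. y i \<noteq> i}"
  by (rule finite_subset[of _ "{1..n}"]) (auto dest!: Sym_D simp: permutes_def)

text \<open>The weights in \<open>L4\<close> are chosen for this. A commuting letter adds one
  inversion and turns two fixed points into moved points, 2 + 2; any other letter adds two
  inversions and only relabels the moved points, 4 + 0.\<close>

lemma tw_asc:
  assumes y: "y \<in> Inv n" and asc: "y k < y (Suc k)"
  shows "tw k y (Suc k) < tw k y k" "L4 (tw k y) = L4 y + 4"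
proof -
  have S: "y \<in> Sym n" using y by (rule Inv_Sym)
  have n1: "ninv (y \<circ> adj k) = Suc (ninv y)" using S asc by (rule ninv_asc)
  have "tw k y (Suc k) < tw k y k \<and> L4 (tw k y) = L4 y + 4"
  proof (cases "adj k \<circ> y \<circ> adj k = y")
    case True
    then have t: "tw k y = y \<circ> adj k" by (rule tw_fix)
    have f: "y k = k" "y (Suc k) = Suc k" using True asc_conj_eq(2)[OF y asc] by auto
    have "{i. (y \<circ> adj k) i \<noteq> i} = insert k (insert (Suc k) {i. y i \<noteq> i})"
      using f by (auto simp: transpose_def)
    then have "card {i. (y \<circ> adj k) i \<noteq> i} = card {i. y i \<noteq> i} + 2"
      using f finite_supp[OF S] by (simp del: comp_apply)
    then have "L4 (y \<circ> adj k) = L4 y + 4" using n1 by (simp add: L4_def del: comp_apply)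
    then show ?thesis unfolding t using f by simp
  next
    case False
    have t: "tw k y = adj k \<circ> (y \<circ> adj k)" using tw_move[OF False] by (simp only: comp_assoc)
    have ne: "{y k, y (Suc k)} \<noteq> {k, Suc k}" "y k \<noteq> y (Suc k)"
      using False asc_conj_eq(1)[OF y asc] asc by auto
    have less: "adj k (y k) < adj k (y (Suc k))" using adj_less_adj_iff[OF ne] asc by simp
    have n2: "ninv (adj k \<circ> (y \<circ> adj k)) = Suc (Suc (ninv y))"
      using ninv_conj_asc[OF y asc False] by (simp only: comp_assoc)
    have "{i. (adj k \<circ> (y \<circ> adj k)) i \<noteq> i} = adj k ` {i. y i \<noteq> i}"
    proof (intro equalityI subsetI)
      fix i assume "i \<in> {i. (adj k \<circ> (y \<circ> adj k)) i \<noteq> i}"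
      then have "y (adj k i) \<noteq> adj k i" using adj_eq_iff[of k "y (adj k i)" i] by simp
      then show "i \<in> adj k ` {i. y i \<noteq> i}" by (intro image_eqI[of _ _ "adj k i"]) simp_all
    qed (auto simp: adj_eq_iff)
    then have "card {i. (adj k \<circ> (y \<circ> adj k)) i \<noteq> i} = card {i. y i \<noteq> i}"
      by (simp add: card_image del: comp_apply)
    then have "L4 (adj k \<circ> (y \<circ> adj k)) = L4 y + 4" using n2 by (simp add: L4_def del: comp_apply)
    then show ?thesis unfolding t using less by simp
  qed
  then show "tw k y (Suc k) < tw k y k" "L4 (tw k y) = L4 y + 4" by auto
qed

lemma tw_desc:
  assumes y: "y \<in> Inv n" and k: "k \<in> {1..<n}" and desc: "y (Suc k) < y k"
  shows "tw k y k < tw k y (Suc k)" "L4 y = L4 (tw k y) + 4"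
proof -
  show a: "tw k y k < tw k y (Suc k)"
  proof (cases "adj k \<circ> y \<circ> adj k = y")
    case True
    then have t: "tw k y = y \<circ> adj k" by (rule tw_fix)
    show ?thesis unfolding t using desc by simp
  next
    case False
    then have t: "tw k y = adj k \<circ> y \<circ> adj k" by (rule tw_move)
    have ne: "{y (Suc k), y k} \<noteq> {k, Suc k}" "y (Suc k) \<noteq> y k"
      using False desc_conj_eq(1)[OF y desc] desc by auto
    show ?thesis unfolding t using adj_less_adj_iff[OF ne] desc by simp
  qed
  show "L4 y = L4 (tw k y) + 4" using tw_asc(2)[OF tw_Inv[OF y k] a] by (simp only: tw_tw)
qed

lemma demazure_adj_left:
  assumes w: "w \<in> Sym n" and k: "k \<in> {1..<n}"
  shows "demazure n (adj k) w = dem_left k w"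
proof -
  have k1: "ninv (adj k) = 1" using ninv_asc[of id n k] by simp
  have add: "demazure n (adj k) w = adj k \<circ> w" if "w \<in> Sym n" "inv w k < inv w (Suc k)" for w
    using that k k1 by (intro demazure_additive) (simp_all add: adj_Sym ninv_left_asc)
  show ?thesis
  proof (cases "inv w k < inv w (Suc k)")
    case True
    then show ?thesis using add w by (simp add: dem_left_asc)
  next
    case False
    let ?u = "adj k \<circ> w"
    have u: "?u \<in> Sym n" using w k by (simp add: comp_Sym adj_Sym)
    have "inv ?u = inv w \<circ> adj k" using w by (simp add: inv_adj_comp bij_Sym)
    then have "inv ?u k < inv ?u (Suc k)"
      using False bij_asc_or_desc[of "inv w" k] bij_Sym[OF inv_Sym[OF w]] by simp
    then have e: "demazure n (adj k) ?u = w" using add[of ?u] u by simp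
    have "demazure n (adj k) (adj k) = adj k"
      using k adj_Sym[OF k] by (simp add: demazure_adj dem_right_def)
    then have "demazure n (adj k) (demazure n (adj k) ?u) = demazure n (adj k) ?u"
      using demazure_assoc[of "adj k" n "adj k" ?u] u k adj_Sym by metis
    then show ?thesis unfolding e using False by (simp add: dem_left_def)
  qed
qed

text \<open>At an ascent the right factor acts, and the left one acts in addition unless
  \<open>adj k\<close> commutes with \<open>y\<close>, which is the case distinction in
  \<open>tw\<close>. At a descent neither acts, since \<open>y\<close> is its own inverse.\<close>

lemma demazure_conj:
  assumes y: "y \<in> Inv n" and k: "k \<in> {1..<n}"
  shows "demazure n (adj k) (dem_right k y) = (if y k < y (Suc k) then tw k y else y)"
proof -
  have S: "dem_right k y \<in> Sym n" using y k by (simp add: dem_right_Sym Inv_Sym)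
  show ?thesis
  proof (cases "y k < y (Suc k)")
    case True
    have i: "inv (y \<circ> adj k) = adj k \<circ> y"
      using y by (simp add: o_inv_distrib Inv_bij Inv_inv)
    have "dem_left k (y \<circ> adj k) = tw k y"
    proof (cases "adj k \<circ> y \<circ> adj k = y")
      case eq: True
      then have t: "tw k y = y \<circ> adj k" by (rule tw_fix)
      show ?thesis unfolding t using asc_conj_eq(2)[OF y True] eq by (simp add: dem_left_def i)
    next
      case False
      have t: "tw k y = adj k \<circ> (y \<circ> adj k)" using tw_move[OF False] by (simp only: comp_assoc)
      have "adj k (y k) < adj k (y (Suc k))"
        using asc_conj_eq(1)[OF y True] False True by (intro adj_less_adj_iff[THEN iffD2]) auto
      then show ?thesis unfolding t by (simp add: dem_left_def i)
    qed
    then show ?thesis using True S k by (simp add: demazure_adj_left dem_right_asc)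
  next
    case False
    then show ?thesis using S k y by (simp add: demazure_adj_left dem_right_def dem_left_def Inv_inv)
  qed
qed

section \<open>Atoms of an involution\<close>

definition dem_inv :: "nat \<Rightarrow> (nat \<Rightarrow> nat) \<Rightarrow> nat \<Rightarrow> nat" where
  "dem_inv n w = demazure n (inv w) w"

lemma dem_inv_id: "dem_inv n id = id"
  by (simp add: dem_inv_def demazure_id)

text \<open>Each letter raises \<open>L4\<close> by 4 or is absorbed, so no \<open>w\<close> is
  shorter than a quarter of \<open>L4 (dem_inv n w)\<close>.\<close>

lemma dem_inv_aux:
  "w \<in> Sym n \<Longrightarrow> dem_inv n w \<in> Inv n \<and> L4 (dem_inv n w) \<le> 4 * ninv w"
proof (induction w rule: Sym_induct)
  case id
  show "dem_inv n id \<in> Inv n \<and> L4 (dem_inv n id) \<le> 4 * ninv id" by (simp add: dem_inv_id)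
next
  case (asc v k)
  have "dem_inv n (v \<circ> adj k) = (if dem_inv n v k < dem_inv n v (Suc k) then tw k (dem_inv n v) else dem_inv n v)"
    unfolding dem_inv_def using demazure_inv_step[OF asc.hyps] demazure_conj asc dem_inv_def by metis
  moreover have "ninv (v \<circ> adj k) = Suc (ninv v)" using asc.hyps by (metis ninv_asc)
  ultimately show "dem_inv n (v \<circ> adj k) \<in> Inv n \<and> L4 (dem_inv n (v \<circ> adj k)) \<le> 4 * ninv (v \<circ> adj k)"
    using asc.IH asc.hyps tw_Inv tw_asc(2) by auto
qed

lemma dem_inv_Inv: "w \<in> Sym n \<Longrightarrow> dem_inv n w \<in> Inv n"
  and dem_inv_L4: "w \<in> Sym n \<Longrightarrow> L4 (dem_inv n w) \<le> 4 * ninv w"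
  using dem_inv_aux by blast+

lemma dem_inv_step:
  assumes "v \<in> Sym n" "k \<in> {1..<n}" "v k < v (Suc k)"
  shows "dem_inv n (v \<circ> adj k) = (if dem_inv n v k < dem_inv n v (Suc k) then tw k (dem_inv n v) else dem_inv n v)"
  unfolding dem_inv_def using demazure_inv_step[OF assms] demazure_conj[OF dem_inv_Inv, of v n k] assms
  by (simp add: dem_inv_def)

lemma dem_inv_desc:
  assumes w: "w \<in> Sym n" and k: "k \<in> {1..<n}" and d: "w (Suc k) < w k"
  shows "dem_inv n w (Suc k) < dem_inv n w k"
proof -
  let ?v = "w \<circ> adj k"
  have v: "?v \<in> Sym n" "?v k < ?v (Suc k)" using w k d by (simp_all add: comp_adj_Sym_iff)
  have "dem_inv n w = (if dem_inv n ?v k < dem_inv n ?v (Suc k) then tw k (dem_inv n ?v) else dem_inv n ?v)"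
    using dem_inv_step[OF v(1) k v(2)] by (simp only: comp_adj_adj)
  then show ?thesis using tw_asc(1)[OF dem_inv_Inv[OF v(1)]] Inv_asc_or_desc[OF dem_inv_Inv[OF v(1)]]
    by (auto split: if_splits)
qed

text \<open>Minimal length is replaced by equality in \<open>dem_inv_L4\<close>, a condition that
  can be followed letter by letter; \<open>atoms_eq\<close> identifies the two.\<close>

definition inv_atoms :: "nat \<Rightarrow> (nat \<Rightarrow> nat) \<Rightarrow> (nat \<Rightarrow> nat) set" where
  "inv_atoms n y = {w \<in> Sym n. dem_inv n w = y \<and> 4 * ninv w = L4 y}"

lemma inv_atoms_step:
  assumes y: "y \<in> Inv n" and k: "k \<in> {1..<n}"
  shows "w \<in> inv_atoms n y \<and> w (Suc k) < w k \<longleftrightarrow> y (Suc k) < y k \<and> w \<circ> adj k \<in> inv_atoms n (tw k y)"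
proof
  assume w: "w \<in> inv_atoms n y \<and> w (Suc k) < w k"
  define v where "v = w \<circ> adj k"
  have wv: "w = v \<circ> adj k" by (simp only: v_def comp_adj_adj)
  have wS: "w \<in> Sym n" "dem_inv n w = y" "4 * ninv w = L4 y" using w by (auto simp: inv_atoms_def)
  have v: "v \<in> Sym n" "v k < v (Suc k)" using w wS k by (simp_all add: v_def comp_adj_Sym_iff)
  have nv: "ninv w = Suc (ninv v)" unfolding v_def using w wS ninv_desc by blast
  have Dv: "dem_inv n v \<in> Inv n" "L4 (dem_inv n v) \<le> 4 * ninv v"
    using dem_inv_Inv dem_inv_L4 v by blast+
  have "y = (if dem_inv n v k < dem_inv n v (Suc k) then tw k (dem_inv n v) else dem_inv n v)"
    using dem_inv_step[OF v(1) k v(2)] wS wv by simp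
  \<comment> \<open>An absorbed letter would make \<open>w\<close> longer than a quarter of
    \<open>L4 y\<close>.\<close>
  then have a: "dem_inv n v k < dem_inv n v (Suc k)" "y = tw k (dem_inv n v)"
    using Dv nv wS by (auto split: if_splits simp del: comp_apply)
  then have "tw k y = dem_inv n v" by (simp only: tw_tw)
  moreover have "L4 y = L4 (dem_inv n v) + 4" "y (Suc k) < y k" using tw_asc[OF Dv(1) a(1)] a(2) by simp_all
  ultimately show "y (Suc k) < y k \<and> w \<circ> adj k \<in> inv_atoms n (tw k y)"
    using v nv wS unfolding v_def[symmetric] by (simp add: inv_atoms_def)
next
  assume w: "y (Suc k) < y k \<and> w \<circ> adj k \<in> inv_atoms n (tw k y)"
  define v where "v = w \<circ> adj k"
  have wv: "w = v \<circ> adj k" by (simp only: v_def comp_adj_adj)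
  have v: "v \<in> Sym n" "dem_inv n v = tw k y" "4 * ninv v = L4 (tw k y)"
    using w unfolding v_def[symmetric] by (auto simp: inv_atoms_def)
  have t: "tw k y k < tw k y (Suc k)" "L4 y = L4 (tw k y) + 4" using tw_desc[OF y k] w by auto
  \<comment> \<open>By \<open>dem_inv_desc\<close>, a descent of \<open>v\<close> at
    \<open>k\<close> would also be one of \<open>tw k y\<close>.\<close>
  have a: "v k < v (Suc k)"
    using dem_inv_desc[OF v(1) k] bij_asc_or_desc[OF bij_Sym[OF v(1)], of k] v(2) t(1)
    by fastforce
  have "dem_inv n w = tw k (tw k y)"
    using dem_inv_step[OF v(1) k a] v(2) t(1) wv by simp
  moreover have "ninv w = Suc (ninv v)" using ninv_asc[OF v(1) a] wv by simp
  moreover have "w \<in> Sym n" using v(1) k wv by (simp add: comp_adj_Sym_iff)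
  ultimately show "w \<in> inv_atoms n y \<and> w (Suc k) < w k"
    using v(3) t(2) a by (simp add: inv_atoms_def tw_tw v_def)
qed

lemma inv_atoms_nonempty: "y \<in> Inv n \<Longrightarrow> inv_atoms n y \<noteq> {}"
proof (induction "L4 y" arbitrary: y rule: less_induct)
  case less
  show ?case
  proof (cases "y = id")
    case True
    then have "id \<in> inv_atoms n y" by (simp add: inv_atoms_def dem_inv_id)
    then show ?thesis by blast
  next
    case False
    then obtain k where k: "k \<in> {1..<n}" "y (Suc k) < y k"
      using Sym_descent_ex Inv_Sym less.prems by metis
    then have "inv_atoms n (tw k y) \<noteq> {}"
      using less tw_desc(2)[OF less.prems k] tw_Inv[OF less.prems k(1)] by simp
    then obtain v where "v \<in> inv_atoms n (tw k y)" by blast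
    then have "v \<circ> adj k \<circ> adj k \<in> inv_atoms n (tw k y)" by (simp only: comp_adj_adj)
    then have "v \<circ> adj k \<in> inv_atoms n y" using inv_atoms_step[OF less.prems k(1)] k(2) by blast
    then show ?thesis by blast
  qed
qed

text \<open>A lower bound that is attained somewhere characterizes the minimizers. The offset
  \<open>c\<close> is 0 for involutions and \<open>L4 (one_FPF n)\<close> for fixed-point-free
  ones.\<close>

lemma arg_min_cox_length:
  assumes low: "\<And>w. w \<in> Sym n \<Longrightarrow> d w = y \<Longrightarrow> l \<le> 4 * ninv w + c"
    and ne: "{w \<in> Sym n. d w = y \<and> 4 * ninv w + c = l} \<noteq> {}"
  shows "{w. is_arg_min cox_length (\<lambda>w. w \<in> Sym n \<and> y = d w) w} = {w \<in> Sym n. d w = y \<and> 4 * ninv w + c = l}"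
proof -
  obtain u where u: "u \<in> Sym n" "d u = y" "4 * ninv u + c = l" using ne by blast
  have "is_arg_min cox_length (\<lambda>w. w \<in> Sym n \<and> y = d w) w \<longleftrightarrow> w \<in> Sym n \<and> d w = y \<and> 4 * ninv w + c = l" for w
  proof
    assume "is_arg_min cox_length (\<lambda>w. w \<in> Sym n \<and> y = d w) w"
    then have w: "w \<in> Sym n" "d w = y" "\<not> cox_length u < cox_length w" using u by (auto simp: is_arg_min_def)
    then have "ninv w \<le> ninv u" using u by (simp add: cox_length_eq[of _ n])
    then show "w \<in> Sym n \<and> d w = y \<and> 4 * ninv w + c = l" using w low[of w] u by simp
  next
    assume "w \<in> Sym n \<and> d w = y \<and> 4 * ninv w + c = l"
    then show "is_arg_min cox_length (\<lambda>w. w \<in> Sym n \<and> y = d w) w"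
      using low by (fastforce simp: is_arg_min_def cox_length_eq[of _ n])
  qed
  then show ?thesis by simp
qed

lemma atoms_eq:
  assumes "y \<in> Inv n"
  shows "atoms n y = inv_atoms n y"
proof -
  have "{w. is_arg_min cox_length (\<lambda>w. w \<in> Sym n \<and> y = dem_inv n w) w} =
      {w \<in> Sym n. dem_inv n w = y \<and> 4 * ninv w + 0 = L4 y}"
    using dem_inv_L4 inv_atoms_nonempty[OF assms] by (intro arg_min_cox_length) (auto simp: inv_atoms_def)
  then show ?thesis by (simp add: atoms_def inv_atoms_def dem_inv_def)
qed

section \<open>Fixed-point-free involutions\<close>

lemma Inv_FPF_Inv: "z \<in> Inv_FPF n \<Longrightarrow> z \<in> Inv n" by (simp add: Inv_FPF_def)

lemma Inv_FPF_neq: "z \<in> Inv_FPF n \<Longrightarrow> i \<in> {1..n} \<Longrightarrow> z i \<noteq> i" by (simp add: Inv_FPF_def)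

text \<open>A commuting ascent needs the fixed points \<open>k\<close> and \<open>Suc k\<close>.
  Hence at ascents of fixed-point-free involutions \<open>tw\<close> is the ordinary conjugation
  that occurs in \<open>atoms_FPF\<close>.\<close>

lemma FPF_asc:
  assumes z: "z \<in> Inv_FPF n" and k: "k \<in> {1..<n}" and asc: "z k < z (Suc k)"
  shows "adj k \<circ> z \<circ> adj k \<noteq> z" "tw k z = adj k \<circ> z \<circ> adj k"
proof -
  show "adj k \<circ> z \<circ> adj k \<noteq> z"
    using asc_conj_eq(2)[OF Inv_FPF_Inv[OF z] asc] Inv_FPF_neq[OF z, of k] k by auto
  then show "tw k z = adj k \<circ> z \<circ> adj k" by (rule tw_move)
qed

lemma conj_FPF:
  assumes z: "z \<in> Inv_FPF n" and k: "k \<in> {1..<n}"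
  shows "adj k \<circ> z \<circ> adj k \<in> Inv_FPF n"
proof -
  have "(adj k \<circ> z \<circ> adj k) i \<noteq> i" if "i \<in> {1..n}" for i
  proof -
    have "adj k i \<in> {1..n}" using Sym_in[OF adj_Sym[OF k] that] .
    then show ?thesis using Inv_FPF_neq[OF z, of "adj k i"] adj_eq_iff[of k "z (adj k i)" i] by simp
  qed
  then show ?thesis using conj_Inv[OF Inv_FPF_Inv[OF z] k] by (simp add: Inv_FPF_def del: comp_apply)
qed

lemma filter_odd_upt: "filter odd [1..<2 * Suc m] = filter odd [1..<2 * m] @ [Suc (2 * m)]"
proof (cases "m = 0")
  case True
  then show ?thesis by (simp add: upt_conv_Cons numeral_2_eq_2)
next
  case False
  then have "[1..<2 * Suc m] = [1..<2 * m] @ [2 * m, Suc (2 * m)]" by simp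
  then show ?thesis by simp
qed

lemma one_FPF_apply:
  "one_FPF (2 * m) i = (if i \<in> {1..2 * m} then if odd i then Suc i else i - 1 else i)"
proof (induction m arbitrary: i)
  case 0
  show ?case by (simp add: one_FPF_def)
next
  case (Suc m)
  have "one_FPF (2 * Suc m) = one_FPF (2 * m) \<circ> adj (Suc (2 * m))"
    unfolding one_FPF_def filter_odd_upt by (simp add: word_prod_append)
  then show ?case using Suc[of "adj (Suc (2 * m)) i"]
    by (auto simp: transpose_def)
qed

lemma one_FPF_FPF: "even n \<Longrightarrow> one_FPF n \<in> Inv_FPF n"
proof -
  assume "even n"
  then obtain m where n: "n = 2 * m" by blast
  have "Suc i \<le> 2 * m" if "odd i" "i \<le> 2 * m" for i using that by (metis Suc_leI dvd_triv_left le_neq_implies_less)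
  then have "one_FPF n (one_FPF n i) = i" for i
    unfolding n one_FPF_apply by (auto elim!: evenE)
  moreover have "one_FPF n \<in> Sym n"
    unfolding one_FPF_def by (rule word_prod_Sym) auto
  moreover have "one_FPF n i \<noteq> i" if "i \<in> {1..n}" for i
    using that unfolding n one_FPF_apply by auto
  ultimately show ?thesis by (simp add: Inv_FPF_def Inv_iff)
qed

text \<open>
  A first descent \<open>k \<ge> j\<close> of \<open>z\<close> satisfies \<open>z k \<ge> z j + (k - j)\<close>; together with \<open>z k = k + 1\<close> this
  forces \<open>z j = j + 1\<close> for the smallest \<open>j\<close> not yet known to be matched with a neighbour.
\<close>

lemma FPF_minimal:
  assumes z: "z \<in> Inv_FPF n"
    and desc: "\<And>k. k \<in> {1..<n} \<Longrightarrow> z (Suc k) < z k \<Longrightarrow> z k = Suc k"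
  shows "even n \<and> z = one_FPF n"
proof -
  have zI: "z \<in> Inv n" using z by (rule Inv_FPF_Inv)
  have main: "z j = (if odd j then Suc j else j - 1)" if "j \<in> {1..n}" for j
    using that
  proof (induction j rule: less_induct)
    case (less j)
    show ?case
    proof (cases "odd j")
      case False
      then have "j - 1 \<in> {1..n}" "j - 1 < j" "odd (j - 1)" using less.prems by (auto elim!: evenE)
      then have "z (j - 1) = j" using less.IH[of "j - 1"] by auto
      then have "z j = j - 1" using Inv_invol[OF zI, of "j - 1"] by simp
      then show ?thesis using False by simp
    next
      case True
      have zin: "z j \<in> {1..n}" using Sym_in[OF Inv_Sym[OF zI] less.prems] .
      \<comment> \<open>Otherwise \<open>z j\<close> is smaller than \<open>j\<close>, and the
        induction hypothesis makes its partner an even number or a number below it; but its partner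
        is the odd \<open>j\<close>.\<close>
      have "j < z j"
      proof (rule ccontr)
        assume "\<not> j < z j"
        then have "z j < j" using Inv_FPF_neq[OF z less.prems] by simp
        then have a: "z (z j) = (if odd (z j) then Suc (z j) else z j - 1)" using less.IH zin by blast
        have "z (z j) = j" using Inv_invol[OF zI] .
        then show False using a \<open>z j < j\<close> True zin by (metis Suc_pred atLeastAtMost_iff even_Suc less_imp_diff_less less_irrefl not_less_eq odd_pos)
      qed
      \<comment> \<open>Otherwise \<open>z\<close> would increase from \<open>j\<close> to
        \<open>z j\<close>, against \<open>z (z j) = j\<close>.\<close>
      have "\<exists>k\<ge>j. k < z j \<and> z (Suc k) < z k"
      proof (rule ccontr)
        assume no: "\<not> ?thesis"
        have "z j \<le> z (j + d)" if "j + d \<le> z j" for d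
          using that
        proof (induction d)
          case (Suc d)
          then have "z (j + d) < z (Suc (j + d))"
            using no Inv_asc_or_desc[OF zI, of "j + d"] by auto
          then show ?case using Suc by simp
        qed simp
        from this[of "z j - j"] have "z j \<le> z (z j)" using \<open>j < z j\<close> by simp
        then show False using Inv_invol[OF zI, of j] \<open>j < z j\<close> by simp
      qed
      then obtain k0 where k0: "j \<le> k0 \<and> z (Suc k0) < z k0" "k0 < z j" by blast
      define k where "k = (LEAST k. j \<le> k \<and> z (Suc k) < z k)"
      have k: "j \<le> k \<and> z (Suc k) < z k" unfolding k_def using k0(1) by (rule LeastI)
      have least: "k \<le> l" if "j \<le> l \<and> z (Suc l) < z l" for l
        unfolding k_def using that by (rule Least_le)
      have "k < z j" using least[OF k0(1)] k0(2) by simp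
      have grow: "z j + d \<le> z (j + d)" if "j + d \<le> k" for d
        using that
      proof (induction d)
        case (Suc d)
        then have "\<not> z (Suc (j + d)) < z (j + d)" using least[of "j + d"] by auto
        then have "z (j + d) < z (Suc (j + d))" using Inv_asc_or_desc[OF zI, of "j + d"] by auto
        then show ?case using Suc by simp
      qed simp
      have "z k = Suc k" using desc[of k] k \<open>k < z j\<close> less.prems zin by auto
      then have "z j \<le> Suc j" using grow[of "k - j"] k by auto
      then show ?thesis using \<open>j < z j\<close> True by simp
    qed
  qed
  have ev: "even n"
  proof (rule ccontr)
    assume "odd n"
    then have "n \<in> {1..n}" by (auto elim!: oddE)
    then have "z n = Suc n" "z n \<in> {1..n}"
      using main[of n] \<open>odd n\<close> Sym_in[OF Inv_Sym[OF zI], of n] by simp_all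
    then show False by simp
  qed
  then obtain m where n: "n = 2 * m" by blast
  have "z = one_FPF n"
  proof
    fix i
    show "z i = one_FPF n i"
    proof (cases "i \<in> {1..n}")
      case True
      then show ?thesis using main[OF True] one_FPF_apply[of m i] n by simp
    next
      case False
      then have "z i = i" using permutes_not_in[OF Sym_D[OF Inv_Sym[OF zI]]] by blast
      then show ?thesis using False one_FPF_apply[of m i] n by auto
    qed
  qed
  then show ?thesis using ev by simp
qed

definition conj_FPF_one :: "nat \<Rightarrow> (nat \<Rightarrow> nat) \<Rightarrow> nat \<Rightarrow> nat" where
  "conj_FPF_one n w = inv w \<circ> one_FPF n \<circ> w"

lemma conj_FPF_one_id: "conj_FPF_one n id = one_FPF n" by (simp add: conj_FPF_one_def)

lemma conj_FPF_one_step: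
  "w \<in> Sym n \<Longrightarrow> conj_FPF_one n (w \<circ> adj k) = adj k \<circ> conj_FPF_one n w \<circ> adj k"
  by (simp add: conj_FPF_one_def o_inv_distrib bij_Sym comp_assoc)

lemma L4_conj_le:
  assumes z: "z \<in> Inv n" and k: "k \<in> {1..<n}"
  shows "L4 (adj k \<circ> z \<circ> adj k) \<le> L4 z + 4"
proof (cases "adj k \<circ> z \<circ> adj k = z")
  case True
  then show ?thesis by simp
next
  case False
  then have t: "adj k \<circ> z \<circ> adj k = tw k z" by (rule tw_move[symmetric])
  show ?thesis unfolding t
    using tw_asc(2)[OF z, of k] tw_desc(2)[OF z k] Inv_asc_or_desc[OF z, of k] by auto
qed

lemma conj_FPF_one_aux:
  assumes n: "even n"
  shows "w \<in> Sym n \<Longrightarrow> conj_FPF_one n w \<in> Inv_FPF n \<and> L4 (conj_FPF_one n w) \<le> 4 * ninv w + L4 (one_FPF n)"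
proof (induction w rule: Sym_induct)
  case id
  show "conj_FPF_one n id \<in> Inv_FPF n \<and> L4 (conj_FPF_one n id) \<le> 4 * ninv id + L4 (one_FPF n)"
    using one_FPF_FPF[OF n] by (simp add: conj_FPF_one_id)
next
  case (asc v k)
  have "ninv (v \<circ> adj k) = Suc (ninv v)" using asc.hyps by (metis ninv_asc)
  then show "conj_FPF_one n (v \<circ> adj k) \<in> Inv_FPF n \<and>
      L4 (conj_FPF_one n (v \<circ> adj k)) \<le> 4 * ninv (v \<circ> adj k) + L4 (one_FPF n)"
    unfolding conj_FPF_one_step[OF asc.hyps(1)]
    using asc.IH conj_FPF[OF _ asc.hyps(2)] L4_conj_le[OF Inv_FPF_Inv asc.hyps(2), of "conj_FPF_one n v"] by simp
qed

lemma conj_FPF_one_FPF: "even n \<Longrightarrow> w \<in> Sym n \<Longrightarrow> conj_FPF_one n w \<in> Inv_FPF n"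
  and conj_FPF_one_L4: "even n \<Longrightarrow> w \<in> Sym n \<Longrightarrow> L4 (conj_FPF_one n w) \<le> 4 * ninv w + L4 (one_FPF n)"
  using conj_FPF_one_aux by blast+

definition fpf_atoms :: "nat \<Rightarrow> (nat \<Rightarrow> nat) \<Rightarrow> (nat \<Rightarrow> nat) set" where
  "fpf_atoms n y = {w \<in> Sym n. conj_FPF_one n w = y \<and> 4 * ninv w + L4 (one_FPF n) = L4 y}"

text \<open>Stated for all involutions \<open>y\<close>, as \<open>atom_module\<close> requires. In
  both directions the smaller involution is fixed-point-free and has an ascent at \<open>k\<close>,
  so \<open>tw\<close> is conjugation there.\<close>

lemma fpf_atoms_step:
  assumes n: "even n" and y: "y \<in> Inv n" and k: "k \<in> {1..<n}"
  shows "w \<in> fpf_atoms n y \<and> w (Suc k) < w k \<longleftrightarrow> y (Suc k) < y k \<and> w \<circ> adj k \<in> fpf_atoms n (tw k y)"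
proof
  assume w: "w \<in> fpf_atoms n y \<and> w (Suc k) < w k"
  define v where "v = w \<circ> adj k"
  have wv: "w = v \<circ> adj k" by (simp only: v_def comp_adj_adj)
  have wS: "w \<in> Sym n" "conj_FPF_one n w = y" "4 * ninv w + L4 (one_FPF n) = L4 y"
    using w by (auto simp: fpf_atoms_def)
  have v: "v \<in> Sym n" "v k < v (Suc k)" using w wS k by (simp_all add: v_def comp_adj_Sym_iff)
  have nv: "ninv w = Suc (ninv v)" unfolding v_def using w wS ninv_desc by blast
  define x where "x = conj_FPF_one n v"
  have x: "x \<in> Inv_FPF n" "L4 x \<le> 4 * ninv v + L4 (one_FPF n)"
    unfolding x_def using conj_FPF_one_FPF conj_FPF_one_L4 n v by blast+
  have yx: "y = adj k \<circ> x \<circ> adj k" using wS(2) wv conj_FPF_one_step[OF v(1)] x_def by metis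
  have lt: "L4 x < L4 y" using x nv wS by simp
  \<comment> \<open>Conjugation at a descent of \<open>x\<close> either fixes \<open>x\<close> or
    lowers \<open>L4\<close>, whereas \<open>lt\<close> says that \<open>L4\<close> grows.\<close>
  have a: "x k < x (Suc k)"
  proof (rule ccontr)
    assume "\<not> x k < x (Suc k)"
    then have d: "x (Suc k) < x k" using Inv_asc_or_desc Inv_FPF_Inv x(1) by blast
    have "y \<noteq> x" using lt by blast
    then have "y = tw k x" unfolding yx using tw_move[of k x] by (metis yx)
    then show False using tw_desc(2)[OF Inv_FPF_Inv[OF x(1)] k d] lt by simp
  qed
  have yt: "y = tw k x" using FPF_asc(2)[OF x(1) k a] yx by simp
  then have "tw k y = x" by (simp only: tw_tw)
  moreover have "L4 y = L4 x + 4" "y (Suc k) < y k" using tw_asc[OF Inv_FPF_Inv[OF x(1)] a] yt by simp_all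
  ultimately show "y (Suc k) < y k \<and> w \<circ> adj k \<in> fpf_atoms n (tw k y)"
    using v nv wS unfolding v_def[symmetric] by (simp add: fpf_atoms_def x_def)
next
  assume w: "y (Suc k) < y k \<and> w \<circ> adj k \<in> fpf_atoms n (tw k y)"
  define v where "v = w \<circ> adj k"
  have wv: "w = v \<circ> adj k" by (simp only: v_def comp_adj_adj)
  have v: "v \<in> Sym n" "conj_FPF_one n v = tw k y" "4 * ninv v + L4 (one_FPF n) = L4 (tw k y)"
    using w unfolding v_def[symmetric] by (auto simp: fpf_atoms_def)
  have t: "tw k y k < tw k y (Suc k)" "L4 y = L4 (tw k y) + 4" using tw_desc[OF y k] w by auto
  have F: "tw k y \<in> Inv_FPF n" using conj_FPF_one_FPF[OF n v(1)] v(2) by simp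
  have wS: "w \<in> Sym n" using v(1) k wv by (simp add: comp_adj_Sym_iff)
  have Ew: "conj_FPF_one n w = y"
    using conj_FPF_one_step[OF v(1), of k] v(2) FPF_asc(2)[OF F k t(1)] tw_tw[of k y] wv by simp
  \<comment> \<open>At a descent \<open>w\<close> would be shorter than \<open>v\<close> although
    \<open>L4 y\<close> exceeds \<open>L4 (tw k y)\<close>, against
    \<open>conj_FPF_one_L4\<close>.\<close>
  have a: "v k < v (Suc k)"
  proof (rule ccontr)
    assume "\<not> v k < v (Suc k)"
    then have "v (Suc k) < v k" using bij_asc_or_desc[OF bij_Sym[OF v(1)]] by blast
    then have "ninv v = Suc (ninv w)" using ninv_desc[OF v(1)] wv by (metis comp_adj_adj)
    then show False using conj_FPF_one_L4[OF n wS] Ew v(3) t(2) by simp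
  qed
  have "ninv w = Suc (ninv v)" using ninv_asc[OF v(1) a] wv by simp
  then show "w \<in> fpf_atoms n y \<and> w (Suc k) < w k"
    using v(3) t(2) a Ew wS by (simp add: fpf_atoms_def v_def)
qed

text \<open>A descent with \<open>z k \<noteq> Suc k\<close> is undone by conjugation, which creates
  no fixed point. If there is no such descent, \<open>FPF_minimal\<close> identifies
  \<open>z\<close> and also yields the parity of \<open>n\<close>.\<close>

lemma fpf_atoms_nonempty: "z \<in> Inv_FPF n \<Longrightarrow> even n \<and> fpf_atoms n z \<noteq> {}"
proof (induction "L4 z" arbitrary: z rule: less_induct)
  case less
  have zI: "z \<in> Inv n" using less.prems by (rule Inv_FPF_Inv)
  show ?case
  proof (cases "\<exists>k\<in>{1..<n}. z (Suc k) < z k \<and> z k \<noteq> Suc k")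
    case False
    then have z: "even n \<and> z = one_FPF n" using FPF_minimal[OF less.prems] by blast
    then have "id \<in> fpf_atoms n z" by (simp add: fpf_atoms_def conj_FPF_one_id)
    then show ?thesis using z by blast
  next
    case True
    then obtain k where k: "k \<in> {1..<n}" "z (Suc k) < z k" "z k \<noteq> Suc k" by blast
    then have t: "tw k z = adj k \<circ> z \<circ> adj k" using desc_conj_eq(2)[OF zI k(2)] by (intro tw_move) auto
    have F: "tw k z \<in> Inv_FPF n" unfolding t by (rule conj_FPF[OF less.prems k(1)])
    then have ih: "even n" "fpf_atoms n (tw k z) \<noteq> {}"
      using less.hyps[of "tw k z"] tw_desc(2)[OF zI k(1,2)] by simp_all
    then obtain v where "v \<in> fpf_atoms n (tw k z)" by blast
    then have "v \<circ> adj k \<circ> adj k \<in> fpf_atoms n (tw k z)" by (simp only: comp_adj_adj)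
    then have "v \<circ> adj k \<in> fpf_atoms n z" using fpf_atoms_step[OF ih(1) zI k(1)] k(2) by blast
    then show ?thesis using ih by blast
  qed
qed

lemma Inv_FPF_even: "z \<in> Inv_FPF n \<Longrightarrow> even n" using fpf_atoms_nonempty by blast

lemma atoms_FPF_eq:
  assumes "z \<in> Inv_FPF n"
  shows "atoms_FPF n z = fpf_atoms n z"
proof -
  have "{w. is_arg_min cox_length (\<lambda>w. w \<in> Sym n \<and> z = conj_FPF_one n w) w} =
      {w \<in> Sym n. conj_FPF_one n w = z \<and> 4 * ninv w + L4 (one_FPF n) = L4 z}"
    using conj_FPF_one_L4 fpf_atoms_nonempty[OF assms] by (intro arg_min_cox_length) (auto simp: fpf_atoms_def)
  then show ?thesis by (simp add: atoms_FPF_def fpf_atoms_def conj_FPF_one_def)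
qed

section \<open>The nilCoxeter algebra\<close>

text \<open>
  A function from permutations to polynomials stands for a formal linear combination of
  permutations. \<open>nil_op k\<close> is right multiplication by the generator \<open>u\<^sub>k\<close> of the nilCoxeter algebra,
  and \<open>factor k c\<close> is right multiplication by \<open>1 + c u\<^sub>k\<close>.
\<close>

definition nil_op :: "nat \<Rightarrow> ((nat \<Rightarrow> nat) \<Rightarrow> mpoly) \<Rightarrow> (nat \<Rightarrow> nat) \<Rightarrow> mpoly" where
  "nil_op k f w = (if w (Suc k) < w k then f (w \<circ> adj k) else 0)"

definition factor :: "nat \<Rightarrow> mpoly \<Rightarrow> ((nat \<Rightarrow> nat) \<Rightarrow> mpoly) \<Rightarrow> (nat \<Rightarrow> nat) \<Rightarrow> mpoly" where
  "factor k c f w = f w + c * nil_op k f w"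

definition act :: "(nat \<times> mpoly) list \<Rightarrow> ((nat \<Rightarrow> nat) \<Rightarrow> mpoly) \<Rightarrow> (nat \<Rightarrow> nat) \<Rightarrow> mpoly" where
  "act xs f = fold (\<lambda>(k, c). factor k c) xs f"

lemma act_Nil [simp]: "act [] f = f" by (simp add: act_def)
lemma act_Cons [simp]: "act ((k, c) # xs) f = act xs (factor k c f)" by (simp add: act_def)
lemma act_append [simp]: "act (xs @ ys) f = act ys (act xs f)" by (simp add: act_def)

lemma adj_commute: "Suc k < l \<Longrightarrow> adj k \<circ> adj l = adj l \<circ> adj k"
  by (auto simp: fun_eq_iff transpose_def)

lemma adj_braid: "adj k \<circ> (adj (Suc k) \<circ> adj k) = adj (Suc k) \<circ> (adj k \<circ> adj (Suc k))"
  by (auto simp: fun_eq_iff transpose_def)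

lemma factor_commute:
  assumes "Suc k < l"
  shows "factor l d (factor k c f) = factor k c (factor l d f)"
proof
  fix w :: "nat \<Rightarrow> nat"
  have "w \<circ> adj k \<circ> adj l = w \<circ> adj l \<circ> adj k" using adj_commute[OF assms] by (simp only: comp_assoc)
  then show "factor l d (factor k c f) w = factor k c (factor l d f) w"
    using assms by (simp add: factor_def nil_op_def algebra_simps)
qed

lemma factor_commute': "Suc k < l \<or> Suc l < k \<Longrightarrow> factor l d (factor k c f) = factor k c (factor l d f)"
  using factor_commute by metis

text \<open>The generator squares to zero, so parameters add; in particular
  \<open>factor k (- c)\<close> undoes \<open>factor k c\<close>.\<close>

lemma factor_add: "factor k d (factor k c f) = factor k (c + d) f"
  by (rule ext) (simp add: factor_def nil_op_def algebra_simps)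

lemma factor_zero [simp]: "factor k 0 f = f"
  by (rule ext) (simp add: factor_def)

text \<open>The sum in the middle balances the terms with one or two distinct generators, squares of
  generators vanish, and the top terms agree by the braid relation.\<close>

lemma factor_yang_baxter:
  "factor k q (factor (Suc k) (p + q) (factor k p f)) = factor (Suc k) p (factor k (p + q) (factor (Suc k) q f))"
proof
  fix w :: "nat \<Rightarrow> nat"
  \<comment> \<open>Every descent condition that arises compares two of the three values of
    \<open>w\<close> at \<open>k\<close>, \<open>Suc k\<close> and
    \<open>Suc (Suc k)\<close>.\<close>
  define a b c where abc: "a = w k" "b = w (Suc k)" "c = w (Suc (Suc k))"
  define s t where st: "s = adj k" "t = adj (Suc k)"
  have v: "s k = Suc k" "s (Suc k) = k" "s (Suc (Suc k)) = Suc (Suc k)"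
    "t k = k" "t (Suc k) = Suc (Suc k)" "t (Suc (Suc k)) = Suc k"
    by (simp_all add: st)
  have ss: "w \<circ> s \<circ> s = w" "w \<circ> t \<circ> t = w" by (simp_all only: st comp_adj_adj)
  have br: "w \<circ> s \<circ> t \<circ> s = w \<circ> t \<circ> s \<circ> t" using adj_braid[of k] by (simp only: st comp_assoc)
  note e = factor_def nil_op_def st[symmetric] comp_apply v abc[symmetric]
  have L: "factor k q (factor (Suc k) (p + q) (factor k p f)) w =
    f w + (if b < a then p * f (w \<circ> s) else 0)
    + (p + q) * (if c < b then f (w \<circ> t) + (if c < a then p * f (w \<circ> t \<circ> s) else 0) else 0)
    + q * (if b < a then f (w \<circ> s) + (p + q) * (if c < a then f (w \<circ> s \<circ> t)
        + p * (if c < b then f (w \<circ> s \<circ> t \<circ> s) else 0) else 0) else 0)"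
    by (simp add: e algebra_simps)
  have R: "factor (Suc k) p (factor k (p + q) (factor (Suc k) q f)) w =
    f w + (if c < b then q * f (w \<circ> t) else 0)
    + (p + q) * (if b < a then f (w \<circ> s) + (if c < a then q * f (w \<circ> s \<circ> t) else 0) else 0)
    + p * (if c < b then f (w \<circ> t) + (p + q) * (if c < a then f (w \<circ> t \<circ> s)
        + q * (if b < a then f (w \<circ> t \<circ> s \<circ> t) else 0) else 0) else 0)"
    by (simp add: e algebra_simps)
  show "factor k q (factor (Suc k) (p + q) (factor k p f)) w = factor (Suc k) p (factor k (p + q) (factor (Suc k) q f)) w"
    unfolding L R br by (simp add: algebra_simps)
qed

lemma act_factor_commute:
  assumes "\<And>l d. (l, d) \<in> set xs \<Longrightarrow> Suc k < l \<or> Suc l < k"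
  shows "act xs (factor k c f) = factor k c (act xs f)"
  using assms
proof (induction xs arbitrary: f)
  case (Cons x xs)
  obtain l d where x: "x = (l, d)" by (cases x)
  then have "factor l d (factor k c f) = factor k c (factor l d f)"
    using Cons.prems[of l d] by (intro factor_commute') auto
  moreover have "act xs (factor k c (factor l d f)) = factor k c (act xs (factor l d f))"
    by (rule Cons.IH) (use Cons.prems in auto)
  ultimately show "act (x # xs) (factor k c f) = factor k c (act (x # xs) f)"
    using x by simp
qed simp

text \<open>The entries satisfying \<open>P\<close> move to the end, and both groups keep their
  order; only pairs that change places must commute. This splits off one column of cells.\<close>

lemma act_partition:
  assumes "sorted_wrt (\<lambda>x y. P x \<longrightarrow> \<not> P y \<longrightarrow> Suc (fst (g x)) < fst (g y) \<or> Suc (fst (g y)) < fst (g x)) xs"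
  shows "act (map g xs) f = act (map g (filter (\<lambda>x. \<not> P x) xs) @ map g (filter P xs)) f"
  using assms
proof (induction xs arbitrary: f)
  case (Cons x xs)
  obtain k c where x: "g x = (k, c)" by (cases "g x")
  have ih: "act (map g xs) f = act (map g (filter (\<lambda>x. \<not> P x) xs) @ map g (filter P xs)) f" for f
    by (rule Cons.IH) (use Cons.prems in simp)
  show "act (map g (x # xs)) f = act (map g (filter (\<lambda>x. \<not> P x) (x # xs)) @ map g (filter P (x # xs))) f"
  proof (cases "P x")
    case True
    have "act (map g (filter (\<lambda>x. \<not> P x) xs)) (factor k c f) = factor k c (act (map g (filter (\<lambda>x. \<not> P x) xs)) f)"
    proof (rule act_factor_commute)
      fix l d assume "(l, d) \<in> set (map g (filter (\<lambda>x. \<not> P x) xs))"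
      then obtain y where "y \<in> set xs" "\<not> P y" "g y = (l, d)" by auto
      then show "Suc k < l \<or> Suc l < k" using Cons.prems True x by force
    qed
    then show ?thesis using True x ih[of "factor k c f"] by simp
  next
    case False
    then show ?thesis using x ih[of "factor k c f"] by simp
  qed
qed simp

section \<open>Descending and ascending factors\<close>

context
  fixes n :: nat
begin

text \<open>The factor \<open>A_k(x)\<close>; \<open>asc_factors k x\<close> is its reversal. Since
  \<open>act\<close> starts at the head of the list and multiplies on the right, lists read like
  products.\<close>

definition desc_factors :: "nat \<Rightarrow> mpoly \<Rightarrow> (nat \<times> mpoly) list" where
  "desc_factors k x = map (\<lambda>j. (j, x)) (rev [k..<n])"

definition asc_factors :: "nat \<Rightarrow> mpoly \<Rightarrow> (nat \<times> mpoly) list" where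
  "asc_factors k x = map (\<lambda>j. (j, x)) [k..<n]"

lemma desc_factors_snoc: "k < n \<Longrightarrow> desc_factors k x = desc_factors (Suc k) x @ [(k, x)]"
  by (simp add: desc_factors_def upt_conv_Cons)

lemma asc_factors_Cons: "k < n \<Longrightarrow> asc_factors k x = (k, x) # asc_factors (Suc k) x"
  by (simp add: asc_factors_def upt_conv_Cons)

lemma desc_factors_empty [simp]: "n \<le> k \<Longrightarrow> desc_factors k x = []"
  by (simp add: desc_factors_def)

lemma asc_factors_empty [simp]: "n \<le> k \<Longrightarrow> asc_factors k x = []"
  by (simp add: asc_factors_def)

lemma set_desc_factors: "(l, d) \<in> set (desc_factors k x) \<longleftrightarrow> k \<le> l \<and> l < n \<and> d = x"
  by (auto simp: desc_factors_def)

lemma set_asc_factors: "(l, d) \<in> set (asc_factors k x) \<longleftrightarrow> k \<le> l \<and> l < n \<and> d = x"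
  by (auto simp: asc_factors_def)

lemma desc_factors_commute: "Suc j < k \<Longrightarrow> act (desc_factors k x) (factor j c f) = factor j c (act (desc_factors k x) f)"
  by (rule act_factor_commute) (auto simp: set_desc_factors)

lemma asc_factors_commute: "Suc j < k \<Longrightarrow> act (asc_factors k x) (factor j c f) = factor j c (act (asc_factors k x) f)"
  by (rule act_factor_commute) (auto simp: set_asc_factors)

text \<open>At the largest letter the two adjacent factors merge into one with parameter
  \<open>x + y\<close>; Yang-Baxter then moves the merged factor down letter by letter to
  \<open>k\<close>.\<close>

lemma act_asc_desc:
  assumes "k < n"
  shows "act (asc_factors k x @ desc_factors k y) f =
    act (desc_factors (Suc k) y @ [(k, x + y)] @ asc_factors (Suc k) x) f"
  using assms
proof (induction "n - k" arbitrary: k f)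
  case (Suc d)
  show ?case
  proof (cases "Suc k = n")
    case True
    then show ?thesis by (simp add: desc_factors_snoc asc_factors_Cons factor_add)
  next
    case False
    then have k: "Suc k < n" using Suc.prems by simp
    define f1 where "f1 = act (desc_factors (Suc (Suc k)) y) f"
    have ih: "act (desc_factors (Suc k) y) (act (asc_factors (Suc k) x) g) =
        act (asc_factors (Suc (Suc k)) x) (factor (Suc k) (x + y) (act (desc_factors (Suc (Suc k)) y) g))" for g
      using Suc.hyps(1)[of "Suc k" g] Suc.hyps(2) k by simp
    have "act (asc_factors k x @ desc_factors k y) f =
        factor k y (act (desc_factors (Suc k) y) (act (asc_factors (Suc k) x) (factor k x f)))"
      using Suc.prems by (simp add: desc_factors_snoc asc_factors_Cons)
    also have "\<dots> = factor k y (act (asc_factors (Suc (Suc k)) x)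
        (factor (Suc k) (x + y) (act (desc_factors (Suc (Suc k)) y) (factor k x f))))"
      by (simp only: ih)
    also have "\<dots> = act (asc_factors (Suc (Suc k)) x)
        (factor k y (factor (Suc k) (x + y) (factor k x f1)))"
      by (simp add: f1_def desc_factors_commute asc_factors_commute)
    also have "\<dots> = act (asc_factors (Suc (Suc k)) x)
        (factor (Suc k) x (factor k (x + y) (factor (Suc k) y f1)))"
      by (simp only: factor_yang_baxter)
    also have "\<dots> = act (desc_factors (Suc k) y @ [(k, x + y)] @ asc_factors (Suc k) x) f"
      using k by (simp add: f1_def desc_factors_snoc[of "Suc k"] asc_factors_Cons[of "Suc k"])
    finally show ?thesis .
  qed
qed simp

text \<open>The symmetry of \<open>A_k(x) A_k(y)\<close> in \<open>x\<close> and \<open>y\<close>,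
  from which the divided difference recursion is derived.\<close>

lemma act_desc_desc:
  "act (desc_factors k x @ desc_factors k y) f = act (desc_factors k y @ desc_factors k x) f"
proof (induction "n - k" arbitrary: k f)
  case (Suc d)
  have kn: "k < n" using Suc.hyps(2) by simp
  show ?case
  proof (cases "Suc k = n")
    case True
    then show ?thesis using kn by (simp add: desc_factors_snoc factor_add add.commute)
  next
    case False
    then have k: "Suc k < n" using kn by simp
    have ih: "act (desc_factors (Suc k) y) (act (desc_factors (Suc k) x) f) =
        act (desc_factors (Suc k) x) (act (desc_factors (Suc k) y) f)"
      using Suc.hyps(1)[of "Suc k" f] Suc.hyps(2) by simp
    have exp: "act (desc_factors k x @ desc_factors k y) f =
        factor k y (factor (Suc k) y (factor k x (factor (Suc k) (- y)
          (act (desc_factors (Suc k) y) (act (desc_factors (Suc k) x) f)))))" for x y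
    proof -
      \<comment> \<open>A factor is invertible, so \<open>A_(k+2)(y)\<close> can be written through
        \<open>A_(k+1)(y)\<close>; this exposes the product that is symmetric by induction.\<close>
      have "act (desc_factors (Suc (Suc k)) y) g = factor (Suc k) (- y) (act (desc_factors (Suc k) y) g)" for g
        using k by (simp add: desc_factors_snoc[of "Suc k"] factor_add)
      note inv = this[of "act (desc_factors (Suc k) x) f"]
      show ?thesis unfolding inv[symmetric]
        using kn k by (simp add: desc_factors_snoc[of k] desc_factors_snoc[of "Suc k" y] desc_factors_commute)
    qed
    define g where "g = act (desc_factors (Suc k) y) (act (desc_factors (Suc k) x) f)"
    \<comment> \<open>Splitting the last parameter \<open>y\<close> into \<open>(y - x) + x\<close>
      creates a Yang-Baxter triple.\<close>
    have "factor k y (factor (Suc k) y (factor k x (factor (Suc k) (- y) g))) =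
        factor k x (factor k (y - x) (factor (Suc k) (x + (y - x)) (factor k x (factor (Suc k) (- y) g))))"
      by (simp add: factor_add)
    also have "\<dots> = factor k x (factor (Suc k) x (factor k (x + (y - x)) (factor (Suc k) (y - x) (factor (Suc k) (- y) g))))"
      by (simp only: factor_yang_baxter)
    also have "\<dots> = factor k x (factor (Suc k) x (factor k y (factor (Suc k) (- x) g)))"
      by (simp add: factor_add)
    finally show ?thesis unfolding exp[of x y] exp[of y x] using ih by (simp only: g_def)
  qed
qed simp

text \<open>In each passage by \<open>act_asc_desc\<close> the reversed factor loses its first
  letter, leaves \<open>(j, x + y j)\<close> behind and raises the start of the descending factor by
  one. At \<open>n\<close> it is used up.\<close>

lemma act_asc_chain:
  assumes "k \<le> n"
  shows "act (asc_factors k x @ concat (map (\<lambda>j. desc_factors j (y j)) [k..<n])) f =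
    act (concat (map (\<lambda>j. desc_factors (Suc j) (y j)) [k..<n]) @ map (\<lambda>j. (j, x + y j)) [k..<n]) f"
  using assms
proof (induction "n - k" arbitrary: k f)
  case (Suc d)
  have kn: "k < n" using Suc.hyps(2) by simp
  have ih: "act (concat (map (\<lambda>j. desc_factors j (y j)) [Suc k..<n])) (act (asc_factors (Suc k) x) g) =
     act (map (\<lambda>j. (j, x + y j)) [Suc k..<n]) (act (concat (map (\<lambda>j. desc_factors (Suc j) (y j)) [Suc k..<n])) g)" for g
    using Suc.hyps(1)[of "Suc k" g] Suc.hyps(2) kn by simp
  have "act (asc_factors k x @ concat (map (\<lambda>j. desc_factors j (y j)) [k..<n])) f =
     act (concat (map (\<lambda>j. desc_factors j (y j)) [Suc k..<n])) (act (asc_factors k x @ desc_factors k (y k)) f)"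
    using kn by (simp add: upt_conv_Cons)
  also have "\<dots> = act (concat (map (\<lambda>j. desc_factors j (y j)) [Suc k..<n])) (act (asc_factors (Suc k) x)
      (factor k (x + y k) (act (desc_factors (Suc k) (y k)) f)))"
    using act_asc_desc[OF kn, of x "y k" f] by simp
  also have "\<dots> = act (map (\<lambda>j. (j, x + y j)) [Suc k..<n])
      (act (concat (map (\<lambda>j. desc_factors (Suc j) (y j)) [Suc k..<n]))
        (factor k (x + y k) (act (desc_factors (Suc k) (y k)) f)))"
    by (simp only: ih)
  \<comment> \<open>The remaining letters are at least \<open>k + 2\<close>.\<close>
  also have "act (concat (map (\<lambda>j. desc_factors (Suc j) (y j)) [Suc k..<n]))
        (factor k (x + y k) (act (desc_factors (Suc k) (y k)) f)) =
      factor k (x + y k) (act (concat (map (\<lambda>j. desc_factors (Suc j) (y j)) [Suc k..<n]))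
        (act (desc_factors (Suc k) (y k)) f))"
    by (rule act_factor_commute) (auto simp: set_desc_factors)
  finally show ?case using kn by (simp add: upt_conv_Cons)
next
  case 0
  from "0.hyps" show ?case by simp
qed

end

section \<open>The module spanned by involutions\<close>

definition unit_at :: "(nat \<Rightarrow> nat) \<Rightarrow> (nat \<Rightarrow> nat) \<Rightarrow> mpoly" where
  "unit_at v w = (if w = v then 1 else 0)"

text \<open>Written on coefficients. On basis elements the generator takes \<open>y\<close> to
  \<open>tw k y\<close> at an ascent and to 0 at a descent; the preimage is unique because
  \<open>tw k\<close> is self-inverse.\<close>

definition nil_op_Inv :: "nat \<Rightarrow> nat \<Rightarrow> ((nat \<Rightarrow> nat) \<Rightarrow> mpoly) \<Rightarrow> (nat \<Rightarrow> nat) \<Rightarrow> mpoly" where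
  "nil_op_Inv n k f y = (if y \<in> Inv n \<and> y (Suc k) < y k then f (tw k y) else 0)"

definition factor_Inv :: "nat \<Rightarrow> nat \<Rightarrow> mpoly \<Rightarrow> ((nat \<Rightarrow> nat) \<Rightarrow> mpoly) \<Rightarrow> (nat \<Rightarrow> nat) \<Rightarrow> mpoly" where
  "factor_Inv n k c f y = f y + c * nil_op_Inv n k f y"

definition act_Inv :: "nat \<Rightarrow> (nat \<times> mpoly) list \<Rightarrow> ((nat \<Rightarrow> nat) \<Rightarrow> mpoly) \<Rightarrow> (nat \<Rightarrow> nat) \<Rightarrow> mpoly" where
  "act_Inv n xs f = fold (\<lambda>(k, c). factor_Inv n k c) xs f"

lemma act_Inv_Nil [simp]: "act_Inv n [] f = f" by (simp add: act_Inv_def)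
lemma act_Inv_Cons [simp]: "act_Inv n ((k, c) # xs) f = act_Inv n xs (factor_Inv n k c f)"
  by (simp add: act_Inv_def)
lemma act_Inv_append [simp]: "act_Inv n (xs @ ys) f = act_Inv n ys (act_Inv n xs f)"
  by (simp add: act_Inv_def)

lemma nil_op_Inv_unit:
  assumes y: "y \<in> Inv n" and k: "k \<in> {1..<n}"
  shows "nil_op_Inv n k (unit_at y) = (if y k < y (Suc k) then unit_at (tw k y) else (\<lambda>_. 0))"
proof
  fix z
  have "z \<in> Inv n \<and> z (Suc k) < z k \<and> tw k z = y \<longleftrightarrow> y k < y (Suc k) \<and> z = tw k y"
    using tw_desc(1)[OF _ k, of z] tw_tw tw_asc(1)[OF y] tw_Inv[OF y k] by metis
  then show "nil_op_Inv n k (unit_at y) z = (if y k < y (Suc k) then unit_at (tw k y) else (\<lambda>_. 0)) z"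
    by (auto simp: nil_op_Inv_def unit_at_def)
qed

lemma nil_op_Inv_linear:
  "nil_op_Inv n k (\<lambda>y. f y + c * g y) = (\<lambda>y. nil_op_Inv n k f y + c * nil_op_Inv n k g y)"
  "nil_op_Inv n k (\<lambda>y. 0) = (\<lambda>y. 0)"
  by (auto simp: nil_op_Inv_def fun_eq_iff)

text \<open>
  The right module over the nilCoxeter algebra spanned by involutions, generated by \<open>e\<close>:
  \<open>At y\<close> is the set of permutations \<open>w\<close> such that \<open>u\<^sub>w\<close> carries \<open>e\<close> to \<open>y\<close>. The flag \<open>g\<close>
  tells whether the odd generators \<open>u\<^sub>1, u\<^sub>3, ...\<close> contribute when applied to \<open>e\<close>.
\<close>

locale atom_module =
  fixes n :: nat and e :: "nat \<Rightarrow> nat" and At :: "(nat \<Rightarrow> nat) \<Rightarrow> (nat \<Rightarrow> nat) set" and g :: bool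
  assumes e_Inv: "e \<in> Inv n"
    and At_Sym: "At y \<subseteq> Sym n"
    and At_step: "y \<in> Inv n \<Longrightarrow> k \<in> {1..<n} \<Longrightarrow>
      w \<in> At y \<and> w (Suc k) < w k \<longleftrightarrow> y (Suc k) < y k \<and> w \<circ> adj k \<in> At (tw k y)"
    and At_id: "y \<in> Inv n \<Longrightarrow> id \<in> At y \<longleftrightarrow> y = e"
begin

lemma finite_At: "finite (At y)"
  using finite_Sym At_Sym finite_subset by blast

text \<open>The module map that applies a nilCoxeter element to the generator \<open>e\<close>: the
  coefficient of each \<open>w\<close> in \<open>At y\<close> is added to that of
  \<open>y\<close>.\<close>

definition to_Inv :: "((nat \<Rightarrow> nat) \<Rightarrow> mpoly) \<Rightarrow> (nat \<Rightarrow> nat) \<Rightarrow> mpoly" where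
  "to_Inv f y = (if y \<in> Inv n then \<Sum>w\<in>At y. f w else 0)"

lemma to_Inv_unit: "to_Inv (unit_at id) = unit_at e"
proof
  fix y
  show "to_Inv (unit_at id) y = unit_at e y"
  proof (cases "y \<in> Inv n")
    case True
    have "(\<Sum>w\<in>At y. unit_at id w) = (\<Sum>w\<in>At y. if w = id then 1 else 0)"
      by (simp add: unit_at_def)
    also have "\<dots> = (if id \<in> At y then 1 else 0)"
      using finite_At by (simp add: sum.delta')
    finally show ?thesis using True At_id[OF True] by (simp add: to_Inv_def unit_at_def)
  next
    case False
    then show ?thesis using e_Inv by (auto simp: to_Inv_def unit_at_def)
  qed
qed

text \<open>\<open>At_step\<close> makes removal of the letter \<open>k\<close> a bijection between
  the elements of \<open>At y\<close> with descent \<open>k\<close> and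
  \<open>At (tw k y)\<close>.\<close>

lemma to_Inv_nil_op:
  assumes k: "k \<in> {1..<n}"
  shows "to_Inv (nil_op k f) = nil_op_Inv n k (to_Inv f)"
proof
  fix y
  show "to_Inv (nil_op k f) y = nil_op_Inv n k (to_Inv f) y"
  proof (cases "y \<in> Inv n")
    case True
    have "(\<Sum>w\<in>At y. nil_op k f w) = (\<Sum>w\<in>{w\<in>At y. w (Suc k) < w k}. f (w \<circ> adj k))"
      using finite_At by (simp add: nil_op_def sum.inter_filter)
    also have "\<dots> = (if y (Suc k) < y k then \<Sum>v\<in>At (tw k y). f v else 0)"
    proof (cases "y (Suc k) < y k")
      case desc: True
      have "{w\<in>At y. w (Suc k) < w k} = (\<lambda>v. v \<circ> adj k) ` At (tw k y)"
      proof (intro equalityI subsetI)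
        fix w assume "w \<in> {w\<in>At y. w (Suc k) < w k}"
        then have "w \<circ> adj k \<in> At (tw k y)" using At_step[OF True k] by blast
        then show "w \<in> (\<lambda>v. v \<circ> adj k) ` At (tw k y)"
          by (intro image_eqI[of _ _ "w \<circ> adj k"]) (simp_all del: comp_apply)
      next
        fix w assume "w \<in> (\<lambda>v. v \<circ> adj k) ` At (tw k y)"
        then obtain v where v: "w = v \<circ> adj k" "v \<in> At (tw k y)" by blast
        then have "w \<circ> adj k \<in> At (tw k y)" by (simp del: comp_apply)
        then show "w \<in> {w\<in>At y. w (Suc k) < w k}" using At_step[OF True k] desc by blast
      qed
      moreover have "inj_on (\<lambda>v. v \<circ> adj k) (At (tw k y))" by (rule inj_on_inverseI[of _ "\<lambda>v. v \<circ> adj k"]) (rule comp_adj_adj)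
      ultimately show ?thesis using desc by (simp add: sum.reindex comp_def[of "\<lambda>w. f (w \<circ> adj k)"])
    next
      case False
      then have "{w\<in>At y. w (Suc k) < w k} = {}" using At_step[OF True k] by blast
      then show ?thesis using False by (simp only: if_False sum.empty)
    qed
    finally show ?thesis using True tw_Inv[OF True k] by (simp add: to_Inv_def nil_op_Inv_def)
  qed (simp add: to_Inv_def nil_op_Inv_def)
qed

lemma to_Inv_factor:
  assumes "k \<in> {1..<n}"
  shows "to_Inv (factor k c f) = factor_Inv n k c (to_Inv f)"
proof
  fix y
  have "to_Inv (factor k c f) y = to_Inv f y + c * to_Inv (nil_op k f) y"
    by (simp add: to_Inv_def factor_def sum.distrib sum_distrib_left)
  then show "to_Inv (factor k c f) y = factor_Inv n k c (to_Inv f) y"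
    using to_Inv_nil_op[OF assms] by (simp add: factor_Inv_def)
qed

lemma to_Inv_act:
  assumes "fst ` set xs \<subseteq> {1..<n}"
  shows "to_Inv (act xs f) = act_Inv n xs (to_Inv f)"
  using assms
proof (induction xs arbitrary: f)
  case (Cons x xs)
  obtain k c where x: "x = (k, c)" by (cases x)
  have "to_Inv (act xs (factor k c f)) = act_Inv n xs (to_Inv (factor k c f))"
    by (rule Cons.IH) (use Cons.prems in simp)
  then show "to_Inv (act (x # xs) f) = act_Inv n (x # xs) (to_Inv f)"
    using x Cons.prems to_Inv_factor[of k c f] by simp
qed simp

end

section \<open>Cells on and below the diagonal\<close>

definition diag_factor :: "bool \<Rightarrow> nat \<Rightarrow> mpoly \<Rightarrow> (nat \<times> mpoly) list" where
  "diag_factor g k x = (if g then [(k, x)] else [])"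

definition content_cells :: "nat \<Rightarrow> nat \<Rightarrow> (nat \<times> nat) list" where
  "content_cells n d = map (\<lambda>i. (i + d, i)) (filter (\<lambda>i. 2 * i + d \<le> n) [1..<n])"

text \<open>The cells ordered outwards from the diagonal, which is included iff \<open>g\<close>.
  Within one diagonal the letters differ by at least 2, so any order would give the same
  product.\<close>

definition lower_cells :: "nat \<Rightarrow> bool \<Rightarrow> (nat \<times> nat) list" where
  "lower_cells n g = concat (map (content_cells n) (if g then [0..<n] else [1..<n]))"

definition cell_letter :: "nat \<times> nat \<Rightarrow> nat" where
  "cell_letter c = fst c + snd c - 1"

text \<open>On the diagonal this is the halved sum of the theorem, by
  \<open>half_double\<close>.\<close>

definition cell_weight :: "nat \<times> nat \<Rightarrow> mpoly" where
  "cell_weight c = (if fst c = snd c then X (snd c) else X (snd c) + X (fst c))"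

definition cell_factor :: "nat \<times> nat \<Rightarrow> nat \<times> mpoly" where
  "cell_factor c = (cell_letter c, cell_weight c)"

text \<open>What is left of the product after \<open>i - 1\<close> passages. Each passage has raised
  every start by one, so the factor starting at \<open>j\<close> carries the variable of index
  \<open>j - (i - 1)\<close>, and the first start is \<open>2 * i - 1\<close>.\<close>

definition tail_factors :: "nat \<Rightarrow> nat \<Rightarrow> (nat \<times> mpoly) list" where
  "tail_factors n i = concat (map (\<lambda>j. desc_factors n j (X (Suc j - i))) [2 * i - 1..<n])"

text \<open>What the passage of the reversed factor in \<open>X i\<close> leaves behind: the letter
  \<open>j\<close> belongs to the cell \<open>(Suc j - i, i)\<close> of column
  \<open>i\<close>.\<close>

definition column_factors :: "nat \<Rightarrow> bool \<Rightarrow> nat \<Rightarrow> (nat \<times> mpoly) list" where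
  "column_factors n g i = diag_factor g (2 * i - 1) (X i) @ map (\<lambda>j. (j, X i + X (Suc j - i))) [2 * i..<n]"

lemma set_content_cells: "(j, i) \<in> set (content_cells n d) \<longleftrightarrow> j = i + d \<and> 1 \<le> i \<and> i < n \<and> i + j \<le> n"
  by (auto simp: content_cells_def)

lemma set_lower_cells:
  "(j, i) \<in> set (lower_cells n g) \<longleftrightarrow> 1 \<le> i \<and> i \<le> j \<and> i + j \<le> n \<and> (g \<or> i \<noteq> j)"
  by (cases g) (auto simp: lower_cells_def set_content_cells Bex_def intro!: exI[of _ "j - i"])

lemma sorted_wrtI_all: "(\<And>x y. x \<in> set xs \<Longrightarrow> y \<in> set xs \<Longrightarrow> P x y) \<Longrightarrow> sorted_wrt P xs"
  by (induction xs) auto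

lemma sorted_content_cells_concat:
  assumes "sorted ds"
  shows "sorted_wrt (\<lambda>x y. fst x - snd x \<le> fst y - snd y) (concat (map (content_cells n) ds))"
  using assms
proof (induction ds)
  case (Cons d ds)
  have "sorted_wrt (\<lambda>x y. fst x - snd x \<le> fst y - snd y) (content_cells n d)"
    by (rule sorted_wrtI_all) (auto simp: set_content_cells)
  then show ?case using Cons by (auto simp: sorted_wrt_append set_content_cells)
qed simp

lemma lower_cells_sorted: "sorted_wrt (\<lambda>x y. fst x - snd x \<le> fst y - snd y) (lower_cells n g)"
  by (simp add: lower_cells_def sorted_content_cells_concat)

lemma filter_eq_upt: "filter (\<lambda>j. j = i) [a..<n] = (if a \<le> i \<and> i < n then [i] else [])"
  by (induction n) auto

lemma filter_le_upt: "filter (\<lambda>d. c + d \<le> n) [a..<m] = [a..<min m (Suc n - c)]"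
proof (induction m)
  case (Suc m)
  show ?case
  proof (cases "c + m \<le> n")
    case False
    then have "min m (Suc n - c) = Suc n - c" "min (Suc m) (Suc n - c) = Suc n - c" by auto
    then show ?thesis using Suc False by simp
  qed (use Suc in simp)
qed simp

lemma concat_map_if: "concat (map (\<lambda>d. if P d then [h d] else []) xs) = map h (filter P xs)"
  by (induction xs) auto

lemma column_cells:
  assumes "1 \<le> i" "2 * i \<le> n"
  shows "map cell_factor (filter (\<lambda>c. snd c = i) (lower_cells n g)) = column_factors n g i"
proof -
  have one: "filter (\<lambda>c. snd c = i) (content_cells n d) = (if 2 * i + d \<le> n then [(i + d, i)] else [])" for d
  proof -
    have "filter (\<lambda>c. snd c = i) (content_cells n d) =
        map (\<lambda>i. (i + d, i)) (filter (\<lambda>i. 2 * i + d \<le> n) (filter (\<lambda>j. j = i) [1..<n]))"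
      by (simp add: content_cells_def filter_map comp_def conj_commute)
    also have "filter (\<lambda>j. j = i) [1..<n] = [i]" using assms by (simp add: filter_eq_upt)
    finally show ?thesis by simp
  qed
  have many: "filter (\<lambda>c. snd c = i) (concat (map (content_cells n) [a..<n])) = map (\<lambda>d. (i + d, i)) [a..<Suc n - 2 * i]" for a
  proof -
    have "filter (\<lambda>c. snd c = i) (concat (map (content_cells n) [a..<n])) =
      concat (map (\<lambda>d. if 2 * i + d \<le> n then [(i + d, i)] else []) [a..<n])"
      by (simp add: filter_concat comp_def one)
    also have "\<dots> = map (\<lambda>d. (i + d, i)) [a..<min n (Suc n - 2 * i)]"
      by (simp only: concat_map_if filter_le_upt)
    also have "min n (Suc n - 2 * i) = Suc n - 2 * i" using assms by simp
    finally show ?thesis .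
  qed
  have rest: "map cell_factor (map (\<lambda>d. (i + d, i)) [1..<Suc n - 2 * i]) =
      map (\<lambda>j. (j, X i + X (Suc j - i))) [2 * i..<n]"
  proof -
    have "[2 * i..<n] = map (\<lambda>d. 2 * i + d - 1) [1..<Suc n - 2 * i]"
      by (rule nth_equalityI) (use assms in \<open>simp_all add: Suc_diff_le del: upt_Suc\<close>)
    moreover have "cell_factor (i + d, i) = (2 * i + d - 1, X i + X (Suc (2 * i + d - 1) - i))" if "1 \<le> d" for d
      using that assms by (simp add: cell_factor_def cell_letter_def cell_weight_def)
    ultimately show ?thesis by (simp del: upt_Suc)
  qed
  show ?thesis
  proof (cases g)
    case True
    have "[0..<Suc n - 2 * i] = 0 # [1..<Suc n - 2 * i]" using assms by (simp add: upt_conv_Cons)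
    then have "map cell_factor (filter (\<lambda>c. snd c = i) (lower_cells n g)) =
        cell_factor (i, i) # map cell_factor (map (\<lambda>d. (i + d, i)) [1..<Suc n - 2 * i])"
      using True by (simp add: lower_cells_def many)
    then show ?thesis unfolding rest using True
      by (simp add: column_factors_def diag_factor_def cell_factor_def cell_letter_def cell_weight_def mult_2)
  next
    case False
    then show ?thesis using many[of 1] rest
      by (simp add: lower_cells_def column_factors_def diag_factor_def)
  qed
qed

text \<open>The reversal of a descending factor, valid only when it acts on the generator. Odd
  \<open>k\<close> suffices since the passages begin at \<open>2 * i - 1\<close>. If
  \<open>g\<close> is false, the factor with letter \<open>k\<close> disappears because it acts
  trivially on the generator.\<close>

locale boundary_module = atom_module +
  assumes boundary: "odd k \<Longrightarrow> k < n \<Longrightarrow>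
    to_Inv (act (desc_factors n k x) (unit_at id)) =
    to_Inv (act (diag_factor g k x @ asc_factors n (Suc k) x) (unit_at id))"
begin

text \<open>The new tail stands before the column, hence next to the generator, where the next
  reversal can be applied.\<close>

lemma tail_factors_step:
  assumes i: "1 \<le> i" "2 * i \<le> n"
  shows "to_Inv (act (tail_factors n i) (unit_at id)) =
    to_Inv (act (tail_factors n (Suc i) @ column_factors n g i) (unit_at id))"
proof -
  let ?k = "2 * i - 1"
  let ?rest = "concat (map (\<lambda>j. desc_factors n j (X (Suc j - i))) [2 * i..<n])"
  have P: "tail_factors n i = desc_factors n ?k (X i) @ ?rest"
  proof -
    have "[?k..<n] = ?k # [2 * i..<n]" using upt_conv_Cons[of ?k n] i by simp
    moreover have "Suc ?k - i = i" using i by simp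
    ultimately show ?thesis by (simp add: tail_factors_def)
  qed
  have letters: "fst ` set ?rest \<subseteq> {1..<n}"
    using i by (auto simp: set_desc_factors)
  have "to_Inv (act (tail_factors n i) (unit_at id)) =
      act_Inv n ?rest (to_Inv (act (desc_factors n ?k (X i)) (unit_at id)))"
    unfolding P using to_Inv_act[OF letters] by simp
  also have "\<dots> = act_Inv n ?rest (to_Inv (act (diag_factor g ?k (X i) @ asc_factors n (Suc ?k) (X i)) (unit_at id)))"
    using boundary[of ?k "X i"] i by simp
  also have "\<dots> = to_Inv (act (diag_factor g ?k (X i) @ asc_factors n (2 * i) (X i) @ ?rest) (unit_at id))"
    using to_Inv_act[OF letters] i by simp
  also have "act (diag_factor g ?k (X i) @ asc_factors n (2 * i) (X i) @ ?rest) (unit_at id) =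
      act (diag_factor g ?k (X i) @ concat (map (\<lambda>j. desc_factors n (Suc j) (X (Suc j - i))) [2 * i..<n])
        @ map (\<lambda>j. (j, X i + X (Suc j - i))) [2 * i..<n]) (unit_at id)"
    using act_asc_chain[OF i(2), of "X i" "\<lambda>j. X (Suc j - i)"] by simp
  also have "concat (map (\<lambda>j. desc_factors n (Suc j) (X (Suc j - i))) [2 * i..<n]) = tail_factors n (Suc i)"
  proof -
    have "concat (map (\<lambda>j. desc_factors n (Suc j) (X (Suc j - i))) [2 * i..<n]) =
        concat (map (\<lambda>j. desc_factors n j (X (j - i))) (map Suc [2 * i..<n]))"
      by (simp add: comp_def)
    \<comment> \<open>The shift adds an entry \<open>n\<close>, whose descending factor is
      empty.\<close>
    also have "map Suc [2 * i..<n] = [Suc (2 * i)..<n] @ [n]" if "2 * i < n"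
      using that by (simp add: map_Suc_upt)
    moreover have "map Suc [2 * i..<n] = []" "[Suc (2 * i)..<n] = []" if "\<not> 2 * i < n"
      using that by simp_all
    ultimately show ?thesis by (cases "2 * i < n") (simp_all add: tail_factors_def)
  qed
  also have "act (diag_factor g ?k (X i) @ tail_factors n (Suc i)
        @ map (\<lambda>j. (j, X i + X (Suc j - i))) [2 * i..<n]) (unit_at id) =
     act (tail_factors n (Suc i) @ column_factors n g i) (unit_at id)"
  proof (cases g)
    case True
    \<comment> \<open>The diagonal letter is \<open>2 * i - 1\<close>, while the new tail has
      letters from \<open>2 * i + 1\<close> on.\<close>
    have "act (tail_factors n (Suc i)) (factor ?k (X i) (unit_at id)) =
        factor ?k (X i) (act (tail_factors n (Suc i)) (unit_at id))"
      using i by (intro act_factor_commute) (auto simp: tail_factors_def set_desc_factors)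
    then show ?thesis using True by (simp add: diag_factor_def column_factors_def)
  next
    case False
    then show ?thesis by (simp add: diag_factor_def column_factors_def)
  qed
  finally show ?thesis .
qed

lemma tail_factors_cells:
  assumes "1 \<le> i"
  shows "to_Inv (act (tail_factors n i) (unit_at id)) =
    to_Inv (act (map cell_factor (filter (\<lambda>c. i \<le> snd c) (lower_cells n g))) (unit_at id))"
  using assms
proof (induction "n - i" arbitrary: i rule: less_induct)
  case less
  show ?case
  proof (cases "2 * i \<le> n")
    case False
    then have "filter (\<lambda>c. i \<le> snd c) (lower_cells n g) = []"
      by (auto simp: filter_empty_conv set_lower_cells)
    moreover have "tail_factors n i = []" using False by (simp add: tail_factors_def)
    ultimately show ?thesis by (simp only: list.map)
  next
    case True
    let ?L = "filter (\<lambda>c. i \<le> snd c) (lower_cells n g)"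
    have sub: "filter (\<lambda>c. \<not> snd c = i) ?L = filter (\<lambda>c. Suc i \<le> snd c) (lower_cells n g)"
      "filter (\<lambda>c. snd c = i) ?L = filter (\<lambda>c. snd c = i) (lower_cells n g)"
      unfolding filter_filter by (auto intro!: filter_cong)
    have sorted: "sorted_wrt (\<lambda>x y. fst x - snd x \<le> fst y - snd y) ?L"
      by (rule sorted_wrt_filter[OF lower_cells_sorted])
    \<comment> \<open>A cell of column \<open>i\<close> read before one of a later column is no
      farther from the diagonal, so its letter is smaller by at least 2.\<close>
    have "sorted_wrt (\<lambda>x y. snd x = i \<longrightarrow> \<not> snd y = i \<longrightarrow>
        Suc (fst (cell_factor x)) < fst (cell_factor y) \<or> Suc (fst (cell_factor y)) < fst (cell_factor x)) ?L"
      by (rule sorted_wrt_mono_rel[OF _ sorted])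
        (use less.prems in \<open>auto simp: set_lower_cells cell_factor_def cell_letter_def\<close>)
    from act_partition[OF this, of "unit_at id"]
    have cells: "act (map cell_factor ?L) (unit_at id) =
      act (map cell_factor (filter (\<lambda>c. Suc i \<le> snd c) (lower_cells n g)) @ column_factors n g i) (unit_at id)"
      using column_cells[OF less.prems True, of g] unfolding sub by simp
    have letters: "fst ` set (column_factors n g i) \<subseteq> {1..<n}"
      using less.prems True by (auto simp: column_factors_def diag_factor_def)
    have "to_Inv (act (tail_factors n i) (unit_at id)) =
      act_Inv n (column_factors n g i) (to_Inv (act (tail_factors n (Suc i)) (unit_at id)))"
      using tail_factors_step[OF less.prems True] to_Inv_act[OF letters] by simp
    also have "to_Inv (act (tail_factors n (Suc i)) (unit_at id)) =
      to_Inv (act (map cell_factor (filter (\<lambda>c. Suc i \<le> snd c) (lower_cells n g))) (unit_at id))"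
      by (rule less.hyps) (use True less.prems in auto)
    also have "act_Inv n (column_factors n g i) \<dots> =
      to_Inv (act (map cell_factor ?L) (unit_at id))"
      unfolding cells using to_Inv_act[OF letters] by simp
    finally show ?thesis .
  qed
qed

lemma to_Inv_staircase:
  "to_Inv (act (concat (map (\<lambda>j. desc_factors n j (X j)) [1..<n])) (unit_at id)) =
    act_Inv n (map cell_factor (lower_cells n g)) (unit_at e)"
proof -
  have "filter (\<lambda>c. 1 \<le> snd c) (lower_cells n g) = lower_cells n g"
    by (auto simp: filter_id_conv set_lower_cells)
  moreover have "fst ` set (map cell_factor (lower_cells n g)) \<subseteq> {1..<n}"
    by (auto simp: set_lower_cells cell_factor_def cell_letter_def)
  ultimately show ?thesis
    using tail_factors_cells[of 1] to_Inv_act[of "map cell_factor (lower_cells n g)"] to_Inv_unit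
    by (simp add: tail_factors_def)
qed

end

section \<open>Reversal of a factor at the generator\<close>

lemma factor_Inv_unit:
  assumes "y \<in> Inv n" "k \<in> {1..<n}"
  shows "factor_Inv n k x (unit_at y) = (\<lambda>z. unit_at y z + x * (if y k < y (Suc k) then unit_at (tw k y) z else 0))"
  using nil_op_Inv_unit[OF assms] by (simp add: factor_Inv_def fun_eq_iff)

lemma factor_Inv_linear:
  "factor_Inv n k x (\<lambda>y. f y + c * g y) = (\<lambda>y. factor_Inv n k x f y + c * factor_Inv n k x g y)"
  by (simp add: factor_Inv_def nil_op_Inv_linear fun_eq_iff algebra_simps)

context atom_module
begin

text \<open>The two largest letters are applied to \<open>e\<close> first and may be swapped there.
  The largest then commutes past all remaining letters to the end, and induction reverses the
  others.\<close>

lemma desc_factors_reverse: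
  assumes swap: "\<And>a. a \<ge> k \<Longrightarrow> Suc a < n \<Longrightarrow>
      factor_Inv n a x (factor_Inv n (Suc a) x (unit_at e)) = factor_Inv n (Suc a) x (factor_Inv n a x (unit_at e))"
    and k: "1 \<le> k"
  shows "m \<le> n \<Longrightarrow> to_Inv (act (map (\<lambda>j. (j, x)) (rev [k..<m])) (unit_at id)) =
      to_Inv (act (map (\<lambda>j. (j, x)) [k..<m]) (unit_at id))"
proof (induction m)
  case (Suc m)
  have ih: "to_Inv (act (map (\<lambda>j. (j, x)) (rev [k..<m])) (unit_at id)) =
      to_Inv (act (map (\<lambda>j. (j, x)) [k..<m]) (unit_at id))"
    by (rule Suc.IH) (use Suc.prems in simp)
  consider "m < k" | "m = k" | "k < m" by linarith
  then show ?case
  proof cases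
    case 3
    then obtain l where l: "m = Suc l" "k \<le> l" by (cases m) auto
    let ?r = "map (\<lambda>j. (j, x)) (rev [k..<l])"
    have lett: "fst ` set ?r \<subseteq> {1..<n}" using Suc.prems l k by auto
    have "to_Inv (act (map (\<lambda>j. (j, x)) (rev [k..<Suc m])) (unit_at id)) =
        to_Inv (act ?r (factor l x (factor m x (unit_at id))))"
      using l by simp
    also have "\<dots> = act_Inv n ?r (factor_Inv n l x (factor_Inv n m x (unit_at e)))"
      using to_Inv_act[OF lett] to_Inv_factor[of l] to_Inv_factor[of m] l k Suc.prems to_Inv_unit by simp
    also have "\<dots> = act_Inv n ?r (factor_Inv n m x (factor_Inv n l x (unit_at e)))"
      using swap[of l] l Suc.prems by simp
    also have "\<dots> = to_Inv (act ?r (factor m x (factor l x (unit_at id))))"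
      using to_Inv_act[OF lett] to_Inv_factor[of l] to_Inv_factor[of m] l k Suc.prems to_Inv_unit by simp
    also have "act ?r (factor m x (factor l x (unit_at id))) = factor m x (act ?r (factor l x (unit_at id)))"
      by (rule act_factor_commute) (use l in auto)
    also have "act ?r (factor l x (unit_at id)) = act (map (\<lambda>j. (j, x)) (rev [k..<m])) (unit_at id)"
      using l by simp
    also have "to_Inv (factor m x \<dots>) = factor_Inv n m x (to_Inv (act (map (\<lambda>j. (j, x)) [k..<m]) (unit_at id)))"
      using ih Suc.prems k 3 to_Inv_factor[of m] by simp
    also have "\<dots> = to_Inv (act (map (\<lambda>j. (j, x)) [k..<Suc m]) (unit_at id))"
      using Suc.prems k 3 to_Inv_factor[of m] by simp
    finally show ?thesis .
  qed simp_all
qed simp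

end

lemma inv_atoms_module: "atom_module n id (inv_atoms n)"
proof
  show "id \<in> inv_atoms n y \<longleftrightarrow> y = id" for y by (auto simp: inv_atoms_def dem_inv_id)
  show "inv_atoms n y \<subseteq> Sym n" for y by (auto simp: inv_atoms_def)
qed (simp, rule inv_atoms_step)

lemma tw_id: "tw k id = adj k" by (simp add: tw_def)

lemma tw_adj: 
  assumes "k = Suc l \<or> l = Suc k"
  shows "tw k (adj l) = adj k \<circ> adj l \<circ> adj k"
proof (rule tw_move)
  have "(adj k \<circ> adj l \<circ> adj k) k \<noteq> adj l k" using assms by (auto simp: transpose_def)
  then show "adj k \<circ> adj l \<circ> adj k \<noteq> adj l" by metis
qed

text \<open>From the identity, \<open>a\<close> followed by \<open>Suc a\<close> and
  \<open>Suc a\<close> followed by \<open>a\<close> both lead to the same transposition, the two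
  sides of the braid relation.\<close>

lemma inv_atoms_boundary: "boundary_module n id (inv_atoms n) True"
proof -
  interpret atom_module n id "inv_atoms n" True by (rule inv_atoms_module)
  show ?thesis
  proof
    fix k x assume k: "odd k" "k < n"
    have swap: "factor_Inv n a x (factor_Inv n (Suc a) x (unit_at id)) =
        factor_Inv n (Suc a) x (factor_Inv n a x (unit_at id))" if "k \<le> a" "Suc a < n" for a
    proof -
      have a: "a \<in> {1..<n}" "Suc a \<in> {1..<n}" using that k by (auto elim!: oddE)
      have I: "adj a \<in> Inv n" "adj (Suc a) \<in> Inv n" using a by (simp_all add: Inv_iff adj_Sym)
      have "tw a (adj (Suc a)) = tw (Suc a) (adj a)"
        using adj_braid[of a] by (simp add: tw_adj comp_assoc)
      moreover have "adj (Suc a) a < adj (Suc a) (Suc a)" "adj a (Suc a) < adj a (Suc (Suc a))" by simp_all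
      ultimately show ?thesis
        using a I by (intro ext) (simp add: factor_Inv_unit tw_id factor_Inv_linear algebra_simps)
    qed
    have "1 \<le> k" using k by (auto elim!: oddE)
    from desc_factors_reverse[OF swap this, of n]
    show "to_Inv (act (desc_factors n k x) (unit_at id)) =
      to_Inv (act (diag_factor True k x @ asc_factors n (Suc k) x) (unit_at id))"
      using k by (simp add: desc_factors_def asc_factors_def diag_factor_def upt_conv_Cons)
  qed
qed

lemma fpf_atoms_module:
  assumes "even n"
  shows "atom_module n (one_FPF n) (fpf_atoms n)"
proof
  show "one_FPF n \<in> Inv n" using one_FPF_FPF[OF assms] by (rule Inv_FPF_Inv)
  show "id \<in> fpf_atoms n y \<longleftrightarrow> y = one_FPF n" for y by (auto simp: fpf_atoms_def conj_FPF_one_id)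
  show "fpf_atoms n y \<subseteq> Sym n" for y by (auto simp: fpf_atoms_def)
qed (rule fpf_atoms_step[OF assms])

text \<open>Near \<open>m\<close> the generator has the cycles \<open>(m-1, m)\<close> and
  \<open>(m+1, m+2)\<close>. The letter \<open>m\<close> turns them into \<open>(m-1, m+1)\<close>
  and \<open>(m, m+2)\<close>, and then \<open>m - 1\<close> and \<open>m + 1\<close> both give
  \<open>(m-1, m+2)\<close> and \<open>(m, m+1)\<close>. Odd letters are descents of the
  generator.\<close>

lemma one_FPF_swap:
  assumes n: "even n" and m: "even m" "2 \<le> m" "Suc m < n"
  shows "factor_Inv n (m - 1) x (factor_Inv n m x (unit_at (one_FPF n))) =
    factor_Inv n (Suc m) x (factor_Inv n m x (unit_at (one_FPF n)))"
    and "factor_Inv n (Suc m) x (unit_at (one_FPF n)) = unit_at (one_FPF n)"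
    and "factor_Inv n (m - 1) x (unit_at (one_FPF n)) = unit_at (one_FPF n)"
proof -
  let ?e = "one_FPF n"
  obtain l where l: "m = Suc l" using m by (cases m) auto
  obtain n' where n': "n = 2 * n'" using n by blast
  have F: "?e \<in> Inv_FPF n" using n by (rule one_FPF_FPF)
  have k: "l \<in> {1..<n}" "m \<in> {1..<n}" "Suc m \<in> {1..<n}" using l m by (auto elim!: evenE)
  have odd: "odd l" "Suc m < 2 * n'" using l m n' by simp_all
  have "Suc (Suc m) \<le> n" using m by simp
  then have ev: "?e l = m" "?e m = l" "?e (Suc m) = Suc (Suc m)" "?e (Suc (Suc m)) = Suc m"
    using m odd k unfolding n' by (simp_all add: one_FPF_apply l)
  define f where "f = adj m \<circ> ?e \<circ> adj m"
  have tw: "tw m ?e = f" unfolding f_def using FPF_asc(2)[OF F k(2)] ev l by simp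
  have fF: "f \<in> Inv_FPF n" unfolding f_def by (rule conj_FPF[OF F k(2)])
  have fv: "f l = Suc m" "f m = Suc (Suc m)" "f (Suc m) = l" "f (Suc (Suc m)) = m"
    using ev l by (simp_all add: f_def)
  have asc: "f l < f (Suc l)" "f (Suc m) < f (Suc (Suc m))" using fv l by simp_all
  have t: "tw l f = adj l \<circ> f \<circ> adj l" "tw (Suc m) f = adj (Suc m) \<circ> f \<circ> adj (Suc m)"
    using FPF_asc(2)[OF fF k(1) asc(1)] FPF_asc(2)[OF fF k(3) asc(2)] by simp_all
  have "tw l f = tw (Suc m) f"
  proof
    fix i
    consider "i \<in> {l, m, Suc m, Suc (Suc m)}" | "i \<notin> {l, m, Suc m, Suc (Suc m)}" by blast
    then show "tw l f i = tw (Suc m) f i"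
    proof cases
      case 1
      then show ?thesis unfolding t using fv l by auto
    next
      case 2
      then have "f i \<notin> {l, m, Suc m, Suc (Suc m)}"
        using fv Inv_invol[OF Inv_FPF_Inv[OF fF], of i] by auto
      then show ?thesis unfolding t using 2 l by simp
    qed
  qed
  have FI: "f \<in> Inv n" "?e \<in> Inv n" using fF F Inv_FPF_Inv by auto
  have e1: "factor_Inv n (Suc m) x (unit_at ?e) = unit_at ?e" "factor_Inv n l x (unit_at ?e) = unit_at ?e"
    using factor_Inv_unit[OF FI(2) k(3)] factor_Inv_unit[OF FI(2) k(1)] ev l by (simp_all add: fun_eq_iff)
  then show "factor_Inv n (Suc m) x (unit_at ?e) = unit_at ?e" "factor_Inv n (m - 1) x (unit_at ?e) = unit_at ?e"
    using l by simp_all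
  have e2: "factor_Inv n m x (unit_at ?e) = (\<lambda>z. unit_at ?e z + x * unit_at f z)"
    using factor_Inv_unit[OF FI(2) k(2)] ev l tw by (intro ext) simp
  have "factor_Inv n l x (factor_Inv n m x (unit_at ?e)) = factor_Inv n (Suc m) x (factor_Inv n m x (unit_at ?e))"
    unfolding e2 factor_Inv_linear e1
    using factor_Inv_unit[OF FI(1) k(1)] factor_Inv_unit[OF FI(1) k(3)] asc \<open>tw l f = tw (Suc m) f\<close>
    by (simp add: fun_eq_iff)
  then show "factor_Inv n (m - 1) x (factor_Inv n m x (unit_at ?e)) =
    factor_Inv n (Suc m) x (factor_Inv n m x (unit_at ?e))" using l by simp
qed

text \<open>The list is reversed two letters at a time, because the exchange relation links an even
  letter with both of its odd neighbours.\<close>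

lemma fpf_atoms_boundary:
  assumes n: "even n"
  shows "boundary_module n (one_FPF n) (fpf_atoms n) False"
proof -
  interpret atom_module n "one_FPF n" "fpf_atoms n" False using n by (rule fpf_atoms_module)
  let ?e = "one_FPF n"
  show ?thesis
  proof
    fix k x assume k: "odd k" "k < n"
    have main: "to_Inv (act (map (\<lambda>j. (j, x)) (rev [k..<Suc k + 2 * d])) (unit_at id)) =
        to_Inv (act (map (\<lambda>j. (j, x)) [Suc k..<Suc k + 2 * d]) (unit_at id))" if "Suc k + 2 * d \<le> n" for d
      using that
    proof (induction d)
      case 0
      have "factor_Inv n k x (unit_at ?e) = unit_at ?e"
      proof -
        have k1: "k \<in> {1..<n}" "?e \<in> Inv n" using k e_Inv by (auto elim!: oddE)
        obtain n' where n': "n = 2 * n'" using n by blast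
        have "Suc k \<le> n" using k by simp
        then have "?e k = Suc k" "?e (Suc k) = k" using k k1 unfolding n' by (simp_all add: one_FPF_apply)
        then show ?thesis using factor_Inv_unit[OF k1(2,1)] by (simp add: fun_eq_iff)
      qed
      then show "to_Inv (act (map (\<lambda>j. (j, x)) (rev [k..<Suc k + 2 * 0])) (unit_at id)) =
          to_Inv (act (map (\<lambda>j. (j, x)) [Suc k..<Suc k + 2 * 0]) (unit_at id))"
        using to_Inv_factor[of k x "unit_at id"] to_Inv_unit k odd_pos[of k] by simp
    next
      case (Suc d)
      define l where "l = k + 2 * d"
      define m where "m = Suc l"
      have lm: "Suc k + 2 * d = m" "Suc k + 2 * Suc d = Suc (Suc m)" "k \<le> l" by (simp_all add: m_def l_def)
      have m: "even m" "2 \<le> m" "Suc m < n" using k lm Suc.prems unfolding m_def l_def by (auto elim!: oddE)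
      have lk: "l = m - 1" "l \<in> {1..<n}" "m \<in> {1..<n}" "Suc m \<in> {1..<n}" using m m_def by auto
      let ?r = "map (\<lambda>j. (j, x)) (rev [k..<l])"
      have lett: "fst ` set ?r \<subseteq> {1..<n}" using m k m_def by (auto elim!: oddE)
      note T = to_Inv_act[OF lett] to_Inv_factor[OF lk(2)] to_Inv_factor[OF lk(3)] to_Inv_factor[OF lk(4)] to_Inv_unit
      have "rev [k..<Suc (Suc m)] = Suc m # m # l # rev [k..<l]" using lm m_def by simp
      then have "to_Inv (act (map (\<lambda>j. (j, x)) (rev [k..<Suc (Suc m)])) (unit_at id)) =
          act_Inv n ?r (factor_Inv n l x (factor_Inv n m x (factor_Inv n (Suc m) x (unit_at ?e))))"
        using T by simp
      \<comment> \<open>The first factor, with the odd letter \<open>Suc m\<close>, acts trivially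
        and is dropped; after \<open>m\<close>, the letter \<open>l\<close> may be replaced by
        \<open>Suc m\<close>.\<close>
      also have "\<dots> = act_Inv n ?r (factor_Inv n (Suc m) x (factor_Inv n m x (unit_at ?e)))"
        using one_FPF_swap(1,2)[OF n m, of x] lk(1) by simp
      also have "\<dots> = to_Inv (act ?r (factor (Suc m) x (factor m x (unit_at id))))" using T by simp
      also have "act ?r (factor (Suc m) x (factor m x (unit_at id))) =
          factor (Suc m) x (act ?r (factor m x (unit_at id)))"
        by (rule act_factor_commute) (auto simp: m_def)
      also have "act ?r (factor m x (unit_at id)) = factor m x (act ?r (unit_at id))"
        by (rule act_factor_commute) (auto simp: m_def)
      \<comment> \<open>The factor with the odd letter \<open>l\<close> acts trivially on the
        generator and is inserted to complete \<open>rev [k..<m]\<close>.\<close>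
      also have "to_Inv (factor (Suc m) x (factor m x (act ?r (unit_at id)))) =
          factor_Inv n (Suc m) x (factor_Inv n m x (act_Inv n ?r (factor_Inv n l x (unit_at ?e))))"
        using T one_FPF_swap(3)[OF n m, of x] lk(1) by simp
      also have "act_Inv n ?r (factor_Inv n l x (unit_at ?e)) = to_Inv (act (map (\<lambda>j. (j, x)) (rev [k..<m])) (unit_at id))"
        using T lm by (simp add: m_def)
      also have "\<dots> = to_Inv (act (map (\<lambda>j. (j, x)) [Suc k..<m]) (unit_at id))"
        unfolding lm(1)[symmetric] by (rule Suc.IH) (use Suc.prems in simp)
      also have "factor_Inv n (Suc m) x (factor_Inv n m x \<dots>) =
          to_Inv (act (map (\<lambda>j. (j, x)) ([Suc k..<m] @ [m, Suc m])) (unit_at id))"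
        using T by simp
      also have "[Suc k..<m] @ [m, Suc m] = [Suc k..<Suc (Suc m)]" using lm m_def by simp
      finally show ?case unfolding lm .
    qed
    have "n = Suc k + 2 * ((n - Suc k) div 2)" using n k by (auto elim!: oddE evenE)
    then show "to_Inv (act (desc_factors n k x) (unit_at id)) =
      to_Inv (act (diag_factor False k x @ asc_factors n (Suc k) x) (unit_at id))"
      using main[of "(n - Suc k) div 2"] by (simp add: desc_factors_def asc_factors_def diag_factor_def)
  qed
qed

section \<open>Schubert polynomials as coefficients\<close>

lemma poly_mapping_add_induct [case_names zero add]:
  fixes p :: "'a \<Rightarrow>\<^sub>0 'b::comm_monoid_add"
  assumes "P 0" "\<And>p k v. P p \<Longrightarrow> P (p + Poly_Mapping.single k v)"
  shows "P p"
proof (induction p rule: update_induct)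
  case (update g a b)
  have "Poly_Mapping.update a b g = g + Poly_Mapping.single a b"
    using update by (intro poly_mapping_eqI) (auto simp: lookup_update lookup_add lookup_single in_keys_iff when_def)
  then show ?case using assms(2) update by metis
qed (use assms in simp)

section \<open>Interchanging two variables\<close>

definition swap_exps :: "nat \<Rightarrow> (nat \<Rightarrow>\<^sub>0 nat) \<Rightarrow> (nat \<Rightarrow>\<^sub>0 nat)" where
  "swap_exps i m = Poly_Mapping.map_key (adj i) m"

lemma swap_exps_swap_exps [simp]: "swap_exps i (swap_exps i m) = m"
  by (simp add: swap_exps_def map_key_compose map_key_id[unfolded id_def[symmetric]])

lemma inj_swap_exps: "inj (swap_exps i)"
  by (rule inj_on_inverseI[of _ "swap_exps i"]) simp

lemma swap_exps_add: "swap_exps i (m + m') = swap_exps i m + swap_exps i m'"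
  by (simp add: swap_exps_def map_key_plus)

lemma swap_exps_single: "swap_exps i (Poly_Mapping.single j c) = Poly_Mapping.single (adj i j) c"
  using map_key_single[of "adj i" "adj i j" c] by (simp add: swap_exps_def)

lemma swap_vars_eq: "swap_vars i f = Poly_Mapping.map_key (swap_exps i) f"
  by (simp add: swap_vars_def swap_exps_def[abs_def])

lemma swap_vars_add: "swap_vars i (f + g) = swap_vars i f + swap_vars i g"
  by (simp add: swap_vars_eq map_key_plus inj_swap_exps)

lemma swap_vars_zero [simp]: "swap_vars i 0 = 0"
  by (simp add: swap_vars_eq inj_swap_exps)

lemma swap_vars_single: "swap_vars i (Poly_Mapping.single m c) = Poly_Mapping.single (swap_exps i m) c"
  using map_key_single[OF inj_swap_exps, of i "swap_exps i m" c] by (simp add: swap_vars_eq)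

lemma swap_vars_one [simp]: "swap_vars i 1 = 1"
  using swap_vars_single[of i 0 1] by (simp add: swap_exps_def)

lemma swap_vars_mult_single:
  "swap_vars i (f * Poly_Mapping.single m c) = swap_vars i f * swap_vars i (Poly_Mapping.single m c)"
  by (induction f rule: poly_mapping_add_induct)
    (simp_all add: swap_vars_add distrib_right mult_single swap_vars_single swap_exps_add)

lemma swap_vars_mult: "swap_vars i (f * g) = swap_vars i f * swap_vars i g"
  by (induction g rule: poly_mapping_add_induct)
    (simp_all add: swap_vars_add distrib_left swap_vars_mult_single)

lemma swap_vars_X: "swap_vars i (X j) = X (adj i j)"
  by (simp add: X_def swap_vars_single swap_exps_single)

lemma X_neq: "i \<noteq> j \<Longrightarrow> X i \<noteq> X j"
proof
  assume "i \<noteq> j" "X i = X j"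
  then have "Poly_Mapping.single (i::nat) (1::nat) = Poly_Mapping.single j 1"
    unfolding X_def by (metis lookup_single_eq lookup_single_not_eq zero_neq_one)
  then show False using \<open>i \<noteq> j\<close> by (metis lookup_single_eq lookup_single_not_eq zero_neq_one)
qed

text \<open>The polynomials form an integral domain, so the nonzero factor
  \<open>X i - X (Suc i)\<close> can be cancelled.\<close>

lemma divided_diff_eq:
  assumes "f - swap_vars i f = (X i - X (Suc i)) * g"
  shows "divided_diff i f = g"
  unfolding divided_diff_def
proof (rule the_equality)
  fix h assume "(X i - X (Suc i)) * h = f - swap_vars i f"
  then have "(X i - X (Suc i)) * h = (X i - X (Suc i)) * g" using assms by simp
  then show "h = g" using X_neq[of i "Suc i"] by simp
qed (use assms in simp)

lemma swap_vars_factor: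
  "swap_vars i (factor k c f w) = factor k (swap_vars i c) (\<lambda>w. swap_vars i (f w)) w"
  by (simp add: factor_def nil_op_def swap_vars_add swap_vars_mult)

lemma swap_vars_act:
  "swap_vars i (act xs f w) = act (map (apsnd (swap_vars i)) xs) (\<lambda>w. swap_vars i (f w)) w"
proof (induction xs arbitrary: f)
  case (Cons x xs)
  obtain k c where x: "x = (k, c)" by (cases x)
  have "(\<lambda>w. swap_vars i (factor k c f w)) = factor k (swap_vars i c) (\<lambda>w. swap_vars i (f w))"
    by (rule ext) (rule swap_vars_factor)
  then show "swap_vars i (act (x # xs) f w) = act (map (apsnd (swap_vars i)) (x # xs)) (\<lambda>w. swap_vars i (f w)) w"
    using Cons.IH[of "factor k c f"] x by simp
qed simp

section \<open>Divided differences of the staircase product\<close>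

lemma nil_op_nil_op: "nil_op k (nil_op k f) = (\<lambda>_. 0)"
  by (rule ext) (auto simp: nil_op_def)

lemma nil_op_linear: "nil_op k (\<lambda>w. f w + c * g w) = (\<lambda>w. nil_op k f w + c * nil_op k g w)"
  by (rule ext) (simp add: nil_op_def)

lemma factor_linear: "factor k d (\<lambda>w. f w + c * g w) = (\<lambda>w. factor k d f w + c * factor k d g w)"
  by (rule ext) (simp add: factor_def nil_op_linear algebra_simps)

lemma act_linear: "act xs (\<lambda>w. f w + c * g w) = (\<lambda>w. act xs f w + c * act xs g w)"
  by (induction xs arbitrary: f g) (auto simp: factor_linear)

text \<open>Follows from the commutation of factors, since \<open>factor k 1 f\<close> exceeds
  \<open>f\<close> by \<open>nil_op k f\<close>.\<close>

lemma nil_op_factor_commute: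
  assumes "Suc k < l \<or> Suc l < k"
  shows "nil_op k (factor l d f) = factor l d (nil_op k f)"
proof
  fix w :: "nat \<Rightarrow> nat"
  have "factor k 1 (factor l d f) w = factor l d (factor k 1 f) w"
    using factor_commute'[of l k 1 d f] assms by metis
  moreover have "factor k 1 f = (\<lambda>w. f w + 1 * nil_op k f w)" by (rule ext) (simp add: factor_def)
  ultimately have "factor k 1 (factor l d f) w = factor l d (\<lambda>w. f w + 1 * nil_op k f w) w" by metis
  then show "nil_op k (factor l d f) w = factor l d (nil_op k f) w"
    unfolding factor_linear by (simp add: factor_def[of k])
qed

lemma nil_op_act_commute:
  assumes "\<And>l d. (l, d) \<in> set xs \<Longrightarrow> Suc k < l \<or> Suc l < k"
  shows "nil_op k (act xs f) = act xs (nil_op k f)"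
  using assms
proof (induction xs arbitrary: f)
  case (Cons x xs)
  obtain l d where x: "x = (l, d)" by (cases x)
  have "nil_op k (act xs (factor l d f)) = act xs (nil_op k (factor l d f))"
    by (rule Cons.IH) (use Cons.prems in auto)
  also have "nil_op k (factor l d f) = factor l d (nil_op k f)"
    using Cons.prems[of l d] x by (intro nil_op_factor_commute) auto
  finally show "nil_op k (act (x # xs) f) = act (x # xs) (nil_op k f)" using x by simp
qed simp

text \<open>The two products are the symmetric \<open>A_i(x) A_i(y)\<close> multiplied by the factor
  of \<open>i\<close> with parameter \<open>- y\<close> and \<open>- x\<close>. Their difference is
  \<open>x - y\<close> times the symmetric product times the generator, and the square-zero relation
  lets either product take the place of the symmetric one.\<close>

lemma act_desc_pair:
  assumes "i < n"
  shows "act (desc_factors n i x @ desc_factors n (Suc i) y) f =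
    (\<lambda>w. act (desc_factors n i y @ desc_factors n (Suc i) x) f w +
      (x - y) * nil_op i (act (desc_factors n i x @ desc_factors n (Suc i) y) f) w)"
proof -
  define G where "G = act (desc_factors n i x @ desc_factors n i y) f"
  have G: "G = act (desc_factors n i y @ desc_factors n i x) f" unfolding G_def by (rule act_desc_desc)
  have inv: "act (desc_factors n (Suc i) y) g = factor i (- y) (act (desc_factors n i y) g)" for y g
    using assms by (simp add: desc_factors_snoc factor_add)
  have 1: "act (desc_factors n i x @ desc_factors n (Suc i) y) f = factor i (- y) G"
    by (simp add: inv G_def)
  have 2: "act (desc_factors n i y @ desc_factors n (Suc i) x) f = factor i (- x) G"
    by (simp add: inv G)
  have "factor i (- y) G = (\<lambda>w. G w + (- y) * nil_op i G w)" by (rule ext) (simp add: factor_def)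
  then have "nil_op i (factor i (- y) G) = nil_op i G"
    unfolding nil_op_linear nil_op_nil_op by (simp only: nil_op_linear nil_op_nil_op) simp
  then show ?thesis unfolding 1 2 by (intro ext) (simp add: factor_def algebra_simps)
qed

definition staircase :: "nat \<Rightarrow> (nat \<Rightarrow> mpoly) \<Rightarrow> (nat \<times> mpoly) list" where
  "staircase n v = concat (map (\<lambda>j. desc_factors n j (v j)) [1..<n])"

text \<open>Exchanging \<open>v i\<close> and \<open>v (Suc i)\<close> changes two adjacent factors
  only, and the generator of \<open>i\<close> commutes with all later ones, whose letters are at
  least \<open>i + 2\<close>.\<close>

lemma staircase_divided_diff:
  assumes i: "1 \<le> i" "i < n"
  shows "act (staircase n v) f w - act (staircase n (v \<circ> adj i)) f w =
    (v i - v (Suc i)) * nil_op i (act (staircase n v) f) w"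
proof -
  let ?L = "\<lambda>v. concat (map (\<lambda>j. desc_factors n j (v j)) [1..<i])"
  let ?R = "\<lambda>v. concat (map (\<lambda>j. desc_factors n j (v j)) [Suc (Suc i)..<n])"
  have split: "act (staircase n v) f = act (?R v) (act (desc_factors n i (v i) @ desc_factors n (Suc i) (v (Suc i))) (act (?L v) f))"
    for v :: "nat \<Rightarrow> mpoly"
  proof -
    have "[1..<n] = [1..<i] @ [i..<n]" using upt_add_eq_append[of 1 i "n - i"] i by simp
    moreover have "[i..<n] = i # [Suc i..<n]" using i by (simp add: upt_conv_Cons)
    ultimately have "act (staircase n v) f = act (concat (map (\<lambda>j. desc_factors n j (v j)) [Suc i..<n]))
        (act (desc_factors n i (v i)) (act (?L v) f))" by (simp add: staircase_def)
    then show ?thesis by (cases "Suc i < n") (simp_all add: upt_conv_Cons)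
  qed
  have "?L (v \<circ> adj i) = ?L v" by (intro arg_cong[of _ _ concat] map_cong) auto
  moreover have "?R (v \<circ> adj i) = ?R v" by (intro arg_cong[of _ _ concat] map_cong) auto
  ultimately have sp: "act (staircase n (v \<circ> adj i)) f =
      act (?R v) (act (desc_factors n i (v (Suc i)) @ desc_factors n (Suc i) (v i)) (act (?L v) f))"
    using split[of "v \<circ> adj i"] by simp
  define F where "F = act (desc_factors n i (v i) @ desc_factors n (Suc i) (v (Suc i))) (act (?L v) f)"
  define F' where "F' = act (desc_factors n i (v (Suc i)) @ desc_factors n (Suc i) (v i)) (act (?L v) f)"
  have FF: "F = (\<lambda>w. F' w + (v i - v (Suc i)) * nil_op i F w)"
    unfolding F_def F'_def by (rule act_desc_pair[OF i(2)])
  have s1: "act (staircase n v) f = act (?R v) F" using split[of v] F_def by simp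
  have s2: "act (staircase n (v \<circ> adj i)) f = act (?R v) F'" using sp F'_def by simp
  have "act (?R v) F = (\<lambda>w. act (?R v) F' w + (v i - v (Suc i)) * act (?R v) (nil_op i F) w)"
    by (subst FF) (rule act_linear)
  from fun_cong[OF this, of w]
  have "act (?R v) F w = act (?R v) F' w + (v i - v (Suc i)) * act (?R v) (nil_op i F) w" .
  moreover have "act (?R v) (nil_op i F) = nil_op i (act (?R v) F)"
    by (rule nil_op_act_commute[symmetric]) (auto simp: set_desc_factors)
  ultimately show ?thesis unfolding s1 s2 by simp
qed

definition schub :: "nat \<Rightarrow> (nat \<Rightarrow> nat) \<Rightarrow> mpoly" where
  "schub n = act (staircase n X) (unit_at id)"

lemma divided_diff_schub:
  assumes "i \<in> {1..<n}" "w (Suc i) < w i"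
  shows "divided_diff i (schub n w) = schub n (w \<circ> adj i)"
proof (rule divided_diff_eq)
  have "map (apsnd (swap_vars i)) (staircase n X) = staircase n (X \<circ> adj i)"
    by (simp add: staircase_def desc_factors_def map_concat comp_def swap_vars_X)
  moreover have "(\<lambda>w. swap_vars i (unit_at id w)) = unit_at id" by (auto simp: unit_at_def)
  ultimately have "swap_vars i (schub n w) = act (staircase n (X \<circ> adj i)) (unit_at id) w"
    unfolding schub_def swap_vars_act by simp
  then show "schub n w - swap_vars i (schub n w) = (X i - X (Suc i)) * schub n (w \<circ> adj i)"
    using staircase_divided_diff[of i n X "unit_at id" w] assms by (simp add: schub_def nil_op_def)
qed

lemma act_snoc_apply:
  "act (xs @ [(k, c)]) f w = act xs f w + c * (if w (Suc k) < w k then act xs f (w \<circ> adj k) else 0)"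
  by (simp add: factor_def nil_op_def)

text \<open>If the word of all letters is reduced, only the full subword reaches its product. The
  vanishing on longer permutations kills the term that omits the last letter.\<close>

lemma act_top_coeff:
  assumes "fst ` set xs \<subseteq> {1..<n}"
  shows "(\<forall>w\<in>Sym n. length xs < ninv w \<longrightarrow> act xs (unit_at id) w = 0) \<and>
    (ninv (word_prod (map fst xs)) = length xs \<longrightarrow>
      act xs (unit_at id) (word_prod (map fst xs)) = prod_list (map snd xs))"
  using assms
proof (induction xs rule: rev_induct)
  case Nil
  show "(\<forall>w\<in>Sym n. length [] < ninv w \<longrightarrow> act [] (unit_at id) w = 0) \<and>
    (ninv (word_prod (map fst [])) = length [] \<longrightarrow>
      act [] (unit_at id) (word_prod (map fst [])) = prod_list (map snd []))"
    by (auto simp: unit_at_def simp flip: id_def)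
next
  case (snoc x xs)
  obtain k c where x: "x = (k, c)" by (cases x)
  have k: "k \<in> {1..<n}" and xs: "fst ` set xs \<subseteq> {1..<n}" using snoc.prems x by auto
  have ih1: "act xs (unit_at id) w = 0" if "w \<in> Sym n" "length xs < ninv w" for w
    using snoc.IH[OF xs] that by blast
  have ih2: "act xs (unit_at id) (word_prod (map fst xs)) = prod_list (map snd xs)"
    if "ninv (word_prod (map fst xs)) = length xs"
    using snoc.IH[OF xs] that by blast
  have S: "word_prod (map fst xs) \<in> Sym n" by (rule word_prod_Sym) (use xs in simp)
  show "(\<forall>w\<in>Sym n. length (xs @ [x]) < ninv w \<longrightarrow> act (xs @ [x]) (unit_at id) w = 0) \<and>
    (ninv (word_prod (map fst (xs @ [x]))) = length (xs @ [x]) \<longrightarrow>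
      act (xs @ [x]) (unit_at id) (word_prod (map fst (xs @ [x]))) = prod_list (map snd (xs @ [x])))"
  proof (intro conjI ballI impI)
    fix w assume w: "w \<in> Sym n" "length (xs @ [x]) < ninv w"
    have "act xs (unit_at id) (w \<circ> adj k) = 0" if "w (Suc k) < w k"
      using w k ninv_desc[OF w(1) that] by (intro ih1) (simp_all add: comp_adj_Sym_iff)
    then show "act (xs @ [x]) (unit_at id) w = 0"
      unfolding x act_snoc_apply using ih1[OF w(1)] w(2) by simp
  next
    let ?v = "word_prod (map fst xs)"
    assume len: "ninv (word_prod (map fst (xs @ [x]))) = length (xs @ [x])"
    have e: "word_prod (map fst (xs @ [x])) = ?v \<circ> adj k" using x by (simp add: word_prod_append)
    have asc: "?v k < ?v (Suc k)"
    proof (rule ccontr)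
      assume "\<not> ?v k < ?v (Suc k)"
      then have "?v (Suc k) < ?v k" using bij_asc_or_desc[OF bij_word_prod] by blast
      from ninv_desc[OF S this] have "ninv ?v = Suc (Suc (length xs))" using len unfolding e by simp
      then show False using ninv_word_prod[of "map fst xs"] by simp
    qed
    have n1: "ninv (?v \<circ> adj k) = Suc (ninv ?v)" by (rule ninv_asc[OF S asc])
    then have nv: "ninv ?v = length xs" using len unfolding e by simp
    have "act xs (unit_at id) (?v \<circ> adj k) = 0"
      using n1 nv S k by (intro ih1) (simp_all add: comp_adj_Sym_iff del: comp_apply)
    then show "act (xs @ [x]) (unit_at id) (word_prod (map fst (xs @ [x]))) = prod_list (map snd (xs @ [x]))"
      unfolding e unfolding x act_snoc_apply using asc ih2[OF nv] by (simp add: mult.commute)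
  qed
qed

section \<open>The longest permutation and existence of Schubert polynomials\<close>

lemma word_prod_desc:
  assumes "k \<le> n"
  shows "word_prod (rev [k..<n]) i = (if i < k \<or> n < i then i else if i = k then n else i - 1)"
  using assms
proof (induction "n - k" arbitrary: k i)
  case (Suc d)
  have "rev [k..<n] = rev [Suc k..<n] @ [k]" using Suc.hyps(2) by (simp add: upt_conv_Cons)
  then have "word_prod (rev [k..<n]) i = word_prod (rev [Suc k..<n]) (adj k i)"
    by (simp add: word_prod_append)
  moreover have "word_prod (rev [Suc k..<n]) j = (if j < Suc k \<or> n < j then j else if j = Suc k then n else j - 1)" for j
    using Suc.hyps(1)[of "Suc k" j] Suc.hyps(2) by simp
  ultimately show ?case using Suc.hyps(2) by (auto simp: transpose_def)
next
  case 0
  then have "n = k" by simp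
  then show ?case by simp
qed

lemma word_prod_staircase_aux:
  "m < n \<Longrightarrow> word_prod (concat (map (\<lambda>j. rev [j..<n]) [1..<Suc m])) i =
    (if i = 0 \<or> n < i then i else if i \<le> m then Suc n - i else i - m)"
proof (induction m arbitrary: i)
  case 0
  show ?case by simp
next
  case (Suc m)
  have "word_prod (concat (map (\<lambda>j. rev [j..<n]) [1..<Suc (Suc m)])) i =
      word_prod (concat (map (\<lambda>j. rev [j..<n]) [1..<Suc m])) (word_prod (rev [Suc m..<n]) i)"
    by (simp add: word_prod_append)
  then show ?case using Suc.prems word_prod_desc[of "Suc m" n i]
      Suc.IH[of "word_prod (rev [Suc m..<n]) i"] by auto
qed

lemma staircase_letters: "map fst (staircase n v) = concat (map (\<lambda>j. rev [j..<n]) [1..<n])"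
  by (simp add: staircase_def desc_factors_def map_concat comp_def rev_map[symmetric])

lemma word_prod_staircase: "word_prod (map fst (staircase n v)) = longest n"
proof (cases "n \<le> 1")
  case True
  then have "[1..<n] = []" by simp
  then have "word_prod (map fst (staircase n v)) = id" unfolding staircase_letters by (simp only: list.map concat.simps word_prod_Nil)
  moreover have "longest n = id" using True by (auto simp: longest_def fun_eq_iff)
  ultimately show ?thesis by simp
next
  case False
  then obtain m where m: "n = Suc m" by (cases n) auto
  show ?thesis
  proof
    fix i
    show "word_prod (map fst (staircase n v)) i = longest n i"
      using word_prod_staircase_aux[of m n i] False unfolding staircase_letters m
      by (auto simp: longest_def simp del: upt_Suc)
  qed
qed

lemma staircase_letters_subset: "fst ` set (staircase n v) \<subseteq> {1..<n}"
  by (auto simp: staircase_def set_desc_factors)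

lemma longest_Sym: "longest n \<in> Sym n"
  unfolding word_prod_staircase[of n X, symmetric]
  by (rule word_prod_Sym) (use staircase_letters_subset[of n X] in simp)

lemma longest_longest: "longest n \<circ> longest n = id"
  by (auto simp: longest_def fun_eq_iff)

lemma length_staircase: "length (staircase n v) = (\<Sum>i\<in>{1..<n}. n - i)"
  by (simp add: staircase_def length_concat comp_def desc_factors_def interv_sum_list_conv_sum_set_nat)

lemma ninv_longest: "ninv (longest n) = (\<Sum>i\<in>{1..<n}. n - i)"
proof -
  have "invs (longest n) = Sigma {1..<n} (\<lambda>i. {i<..n})"
    by (auto simp: invs_def longest_def split: if_splits)
  then show ?thesis by (simp add: ninv_def)
qed

lemma schub_longest: "schub n (longest n) = (\<Prod>i\<in>{1..<n}. X i ^ (n - i))"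
proof -
  have "schub n (longest n) = prod_list (map snd (staircase n X))"
    using act_top_coeff[OF staircase_letters_subset[of n X]] ninv_longest length_staircase[of n X]
    unfolding schub_def word_prod_staircase by simp
  also have "\<dots> = prod_list (map (\<lambda>i. X i ^ (n - i)) [1..<n])"
  proof -
    have "prod_list (map snd (desc_factors n j c)) = c ^ (n - j)" for j c
      by (simp add: desc_factors_def comp_def map_replicate_const prod_list_replicate flip: rev_map)
    moreover have "prod_list (concat xss) = prod_list (map prod_list xss)" for xss :: "mpoly list list"
      by (induction xss) simp_all
    ultimately show ?thesis by (simp add: staircase_def map_concat comp_def)
  qed
  also have "\<dots> = (\<Prod>i\<in>{1..<n}. X i ^ (n - i))"
    using prod.distinct_set_conv_list[of "[1..<n]" "\<lambda>i. X i ^ (n - i)"] by simp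
  finally show ?thesis .
qed

lemma is_schubert_schub:
  assumes "is_schubert n w f"
  shows "w \<in> Sym n \<and> f = schub n w"
  using assms
proof induction
  case longest
  show ?case using longest_Sym schub_longest by simp
next
  case (descent w f i)
  then show "w \<circ> adj i \<in> Sym n \<and> divided_diff i f = schub n (w \<circ> adj i)"
    using divided_diff_schub[of i n w] by (simp add: comp_adj_Sym_iff)
qed

lemma adj_comp_longest:
  assumes "k \<in> {1..<n}"
  shows "adj k \<circ> longest n = longest n \<circ> adj (n - k)"
proof -
  have "inv (longest n) = longest n" by (rule inv_unique_comp) (rule longest_longest)+
  moreover have "longest n k = Suc (n - k)" "longest n (Suc k) = n - k"
    using assms by (auto simp: longest_def)
  ultimately show ?thesis
    using transpose_comp_eq[OF bij_Sym[OF longest_Sym], of k "Suc k"] by (simp add: transpose_commute)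
qed

text \<open>Ascending from the identity to \<open>u\<close> is descending from
  \<open>longest n\<close> to \<open>u \<circ> longest n\<close>: an ascent of \<open>u\<close> at
  \<open>k\<close> is a descent of the product at \<open>n - k\<close>.\<close>

lemma is_schubert_exists_aux:
  "u \<in> Sym n \<Longrightarrow> is_schubert n (u \<circ> longest n) (schub n (u \<circ> longest n))"
proof (induction u rule: Sym_induct)
  case id
  show "is_schubert n (id \<circ> longest n) (schub n (id \<circ> longest n))"
    using is_schubert.longest[of n] by (simp add: schub_longest)
next
  case (asc u k)
  let ?w = "u \<circ> longest n"
  have e: "u \<circ> adj k \<circ> longest n = ?w \<circ> adj (n - k)"
    using adj_comp_longest[OF asc.hyps(2)] by (simp only: comp_assoc)
  have i: "n - k \<in> {1..<n}" using asc.hyps(2) by auto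
  have "longest n (n - k) = Suc k" "longest n (Suc (n - k)) = k"
    using asc.hyps(2) by (auto simp: longest_def)
  then have d: "?w (Suc (n - k)) < ?w (n - k)" using asc.hyps(3) by simp
  show "is_schubert n (u \<circ> adj k \<circ> longest n) (schub n (u \<circ> adj k \<circ> longest n))"
    unfolding e divided_diff_schub[OF i d, symmetric]
    by (rule is_schubert.descent[OF asc.IH i d])
qed

lemma schubert_eq:
  assumes "w \<in> Sym n"
  shows "schubert n w = schub n w"
proof -
  have "w \<circ> longest n \<circ> longest n = w" using longest_longest by (metis comp_assoc comp_id)
  then have "is_schubert n w (schub n w)"
    using is_schubert_exists_aux[OF comp_Sym[OF assms longest_Sym]] by metis
  then show ?thesis unfolding schubert_def
    by (rule the_equality) (use is_schubert_schub in blast)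
qed

section \<open>Expansion over sets of cells\<close>

lemma inv_schubert_eq:
  assumes "y \<in> Inv n"
  shows "inv_schubert n y = act_Inv n (map cell_factor (lower_cells n True)) (unit_at id) y"
proof -
  interpret boundary_module n id "inv_atoms n" True by (rule inv_atoms_boundary)
  have "inv_schubert n y = (\<Sum>w\<in>inv_atoms n y. schub n w)"
    unfolding inv_schubert_def atoms_eq[OF assms]
    by (rule sum.cong) (auto simp: inv_atoms_def schubert_eq)
  also have "\<dots> = to_Inv (schub n) y" using assms by (simp add: to_Inv_def)
  finally show ?thesis unfolding schub_def staircase_def to_Inv_staircase .
qed

lemma inv_schubert_FPF_eq:
  assumes "z \<in> Inv_FPF n"
  shows "inv_schubert_FPF n z = act_Inv n (map cell_factor (lower_cells n False)) (unit_at (one_FPF n)) z"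
proof -
  interpret boundary_module n "one_FPF n" "fpf_atoms n" False
    using Inv_FPF_even[OF assms] by (rule fpf_atoms_boundary)
  have "inv_schubert_FPF n z = (\<Sum>w\<in>fpf_atoms n z. schub n w)"
    unfolding inv_schubert_FPF_def atoms_FPF_eq[OF assms]
    by (rule sum.cong) (auto simp: fpf_atoms_def schubert_eq)
  also have "\<dots> = to_Inv (schub n) z" using Inv_FPF_Inv[OF assms] by (simp add: to_Inv_def)
  finally show ?thesis unfolding schub_def staircase_def to_Inv_staircase .
qed

text \<open>\<open>rev_run\<close> takes an involution word from \<open>e\<close> to \<open>y\<close> with its last letter first.\<close>

primrec rev_run :: "nat \<Rightarrow> (nat \<Rightarrow> nat) \<Rightarrow> nat list \<Rightarrow> (nat \<Rightarrow> nat) \<Rightarrow> bool" where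
  "rev_run n e [] y \<longleftrightarrow> y = e"
| "rev_run n e (k # ks) y \<longleftrightarrow> y \<in> Inv n \<and> y (Suc k) < y k \<and> rev_run n e ks (tw k y)"

definition run :: "nat \<Rightarrow> (nat \<Rightarrow> nat) \<Rightarrow> nat list \<Rightarrow> (nat \<Rightarrow> nat) \<Rightarrow> bool" where
  "run n e ks y \<longleftrightarrow> rev_run n e (rev ks) y"

lemma run_Nil [simp]: "run n e [] y \<longleftrightarrow> y = e" by (simp add: run_def)

lemma run_snoc: "run n e (ks @ [k]) y \<longleftrightarrow> y \<in> Inv n \<and> y (Suc k) < y k \<and> run n e ks (tw k y)"
  by (simp add: run_def)

definition word_of :: "(nat \<times> nat) set \<Rightarrow> (nat \<times> nat) list \<Rightarrow> nat list" where
  "word_of D cs = map cell_letter (filter (\<lambda>c. c \<in> D) cs)"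

lemma word_of_Nil [simp]: "word_of D [] = []" by (simp add: word_of_def)
lemma word_of_append: "word_of D (xs @ ys) = word_of D xs @ word_of D ys" by (simp add: word_of_def)
lemma word_of_Cons: "word_of D (c # xs) = (if c \<in> D then [cell_letter c] else []) @ word_of D xs"
  by (simp add: word_of_def)
lemma word_of_cong: "(\<And>c. c \<in> set xs \<Longrightarrow> c \<in> D \<longleftrightarrow> c \<in> D') \<Longrightarrow> word_of D xs = word_of D' xs"
  by (simp add: word_of_def cong: filter_cong)

lemma sum_Pow_insert:
  assumes "finite A" "c \<notin> A"
  shows "(\<Sum>D\<in>Pow (insert c A). f D) = (\<Sum>D\<in>Pow A. f D) + (\<Sum>D\<in>Pow A. f (insert c D))"
proof -
  have "Pow (insert c A) = Pow A \<union> insert c ` Pow A" by (rule Pow_insert)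
  moreover have "Pow A \<inter> insert c ` Pow A = {}" using assms by auto
  moreover have "inj_on (insert c) (Pow A)" using assms by (intro inj_onI) (auto simp: insert_ident)
  ultimately show ?thesis using assms by (simp add: sum.union_disjoint sum.reindex)
qed

text \<open>Multiplying out, each cell contributes 1 or its weight together with its letter;
  \<open>D\<close> is the set of cells of the second kind.\<close>

lemma act_Inv_expand:
  assumes "distinct cs"
  shows "act_Inv n (map cell_factor cs) (unit_at e) y =
    (\<Sum>D\<in>Pow (set cs). if run n e (word_of D cs) y then \<Prod>c\<in>D. cell_weight c else 0)"
  using assms
proof (induction cs arbitrary: y rule: rev_induct)
  case Nil
  show ?case by (simp add: unit_at_def)
next
  case (snoc c cs)
  let ?F = "\<lambda>y D. if run n e (word_of D cs) y then \<Prod>c\<in>D. cell_weight c else 0"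
  let ?G = "\<lambda>D. if run n e (word_of D (cs @ [c])) y then \<Prod>c\<in>D. cell_weight c else 0"
  have c: "c \<notin> set cs" and d: "distinct cs" using snoc.prems by auto
  have ih: "act_Inv n (map cell_factor cs) (unit_at e) y = (\<Sum>D\<in>Pow (set cs). ?F y D)" for y
    by (rule snoc.IH[OF d])
  have "act_Inv n (map cell_factor (cs @ [c])) (unit_at e) y =
      (\<Sum>D\<in>Pow (set cs). ?F y D) + cell_weight c *
      (if y \<in> Inv n \<and> y (Suc (cell_letter c)) < y (cell_letter c)
        then \<Sum>D\<in>Pow (set cs). ?F (tw (cell_letter c) y) D else 0)"
    by (simp add: cell_factor_def[of c] factor_Inv_def nil_op_Inv_def ih)
  also have "(\<Sum>D\<in>Pow (set cs). ?F y D) = (\<Sum>D\<in>Pow (set cs). ?G D)"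
  proof (rule sum.cong)
    fix D assume "D \<in> Pow (set cs)"
    then have "word_of D (cs @ [c]) = word_of D cs" using c by (auto simp: word_of_append word_of_Cons)
    then show "?F y D = ?G D" by simp
  qed simp
  also have "cell_weight c *
      (if y \<in> Inv n \<and> y (Suc (cell_letter c)) < y (cell_letter c)
        then \<Sum>D\<in>Pow (set cs). ?F (tw (cell_letter c) y) D else 0) = (\<Sum>D\<in>Pow (set cs). ?G (insert c D))"
  proof -
    have "?G (insert c D) = cell_weight c * (if y \<in> Inv n \<and> y (Suc (cell_letter c)) < y (cell_letter c)
        then ?F (tw (cell_letter c) y) D else 0)" if "D \<in> Pow (set cs)" for D
    proof -
      have D: "finite D" "c \<notin> D" using that c finite_subset by auto
      have "word_of (insert c D) cs = word_of D cs" using c by (intro word_of_cong) auto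
      then have w: "word_of (insert c D) (cs @ [c]) = word_of D cs @ [cell_letter c]"
        by (simp add: word_of_append word_of_Cons)
      show ?thesis unfolding w run_snoc using D by simp
    qed
    then have "(\<Sum>D\<in>Pow (set cs). ?G (insert c D)) = (\<Sum>D\<in>Pow (set cs). cell_weight c *
        (if y \<in> Inv n \<and> y (Suc (cell_letter c)) < y (cell_letter c) then ?F (tw (cell_letter c) y) D else 0))"
      by (rule sum.cong[OF refl])
    then show ?thesis
      by (cases "y \<in> Inv n \<and> y (Suc (cell_letter c)) < y (cell_letter c)") (auto simp: sum_distrib_left[symmetric])
  qed
  also have "(\<Sum>D\<in>Pow (set cs). ?G D) + (\<Sum>D\<in>Pow (set cs). ?G (insert c D)) = (\<Sum>D\<in>Pow (set (cs @ [c])). ?G D)"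
    using sum_Pow_insert[of "set cs" c ?G] c by simp
  finally show ?case .
qed

lemma distinct_content_cells: "distinct (content_cells n d)"
  by (simp add: content_cells_def distinct_map inj_on_def)

lemma distinct_lower_cells: "distinct (lower_cells n g)"
proof -
  have "distinct (concat (map (content_cells n) ds))" if "distinct ds" for ds
    using that
  proof (induction ds)
    case (Cons d ds)
    then show ?case using distinct_content_cells by (auto simp: set_content_cells)
  qed simp
  then show ?thesis by (simp add: lower_cells_def)
qed

lemma lower_cells_True: "1 \<le> n \<Longrightarrow> lower_cells n True = content_cells n 0 @ lower_cells n False"
  by (simp add: lower_cells_def upt_conv_Cons)

lemma act_Inv_sum:
  "act_Inv n (map cell_factor (lower_cells n g)) (unit_at e) y =
    (\<Sum>D\<in>{D. D \<subseteq> set (lower_cells n g) \<and> run n e (word_of D (lower_cells n g)) y}. \<Prod>c\<in>D. cell_weight c)"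
proof -
  have "{D. D \<subseteq> set (lower_cells n g) \<and> run n e (word_of D (lower_cells n g)) y} =
      {D \<in> Pow (set (lower_cells n g)). run n e (word_of D (lower_cells n g)) y}" by blast
  then show ?thesis unfolding act_Inv_expand[OF distinct_lower_cells]
    by (simp only:) (rule sum.inter_filter[symmetric], simp)
qed

section \<open>Pipe dreams as words\<close>

lemma snoc_eq_append_Cons:
  "xs @ [c] = ys @ c' # zs \<longleftrightarrow> (ys = xs \<and> c' = c \<and> zs = []) \<or> (\<exists>zs'. zs = zs' @ [c] \<and> xs = ys @ c' # zs')"
  by (cases zs rule: rev_cases) auto

text \<open>The track on which a path starting on a given track ends when crossings at \<open>ks\<close> are passed in order.\<close>

definition track :: "nat list \<Rightarrow> nat \<Rightarrow> nat" where
  "track ks = word_prod (rev ks)"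

lemma track_Nil [simp]: "track [] = id" by (simp add: track_def)
lemma track_append: "track (ks @ ls) = track ls \<circ> track ks" by (simp add: track_def word_prod_append)
lemma track_Cons: "track (k # ks) = track ks \<circ> adj k" by (simp add: track_def word_prod_append)
lemma track_snoc: "track (ks @ [k]) = adj k \<circ> track ks" by (simp add: track_def)
lemma track_Sym: "set ks \<subseteq> {1..<n} \<Longrightarrow> track ks \<in> Sym n" by (simp add: track_def word_prod_Sym)
lemma bij_track: "bij (track ks)" by (simp add: track_def bij_word_prod)
lemma track_eq_iff [simp]: "track ks a = track ks b \<longleftrightarrow> a = b" using bij_track bij_is_inj injD by metis
lemma ninv_track: "ninv (track ks) \<le> length ks" using ninv_word_prod[of "rev ks"] by (simp add: track_def)

lemma track_fix: "(\<And>k. k \<in> set ks \<Longrightarrow> t \<noteq> k \<and> t \<noteq> Suc k) \<Longrightarrow> track ks t = t"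
  by (induction ks) (simp_all add: track_Cons)

lemma track_cross:
  assumes "distinct ks" "\<And>a b. a \<in> set ks \<Longrightarrow> b \<in> set ks \<Longrightarrow> b \<noteq> Suc a" "t \<in> set ks"
  shows "track ks t = Suc t" "track ks (Suc t) = t"
proof -
  obtain xs ys where ks: "ks = xs @ t # ys" using assms(3) by (meson split_list)
  have xs: "t \<noteq> k \<and> t \<noteq> Suc k \<and> Suc t \<noteq> Suc k \<and> Suc t \<noteq> k" if "k \<in> set xs" for k
    using assms that unfolding ks by auto
  have ys: "t \<noteq> k \<and> t \<noteq> Suc k \<and> Suc t \<noteq> Suc k \<and> Suc t \<noteq> k" if "k \<in> set ys" for k
    using assms that unfolding ks by auto
  have "track xs t = t" "track xs (Suc t) = Suc t" "track ys t = t" "track ys (Suc t) = Suc t"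
    using xs ys by (auto intro!: track_fix)
  then show "track ks t = Suc t" "track ks (Suc t) = t"
    unfolding ks by (simp_all add: track_append track_Cons)
qed

text \<open>Refines the order by \<open>content\<close>, which increases along every pipe. Mirror
  images have the same letter and stand in opposite order, so a symmetric \<open>D\<close> has a
  word that is palindromic around its diagonal part.\<close>

definition all_cells :: "nat \<Rightarrow> (nat \<times> nat) list" where
  "all_cells n = rev (lower_cells n False) @ content_cells n 0 @ map prod.swap (lower_cells n False)"

definition content :: "nat \<times> nat \<Rightarrow> int" where
  "content c = int (snd c) - int (fst c)"

lemma triangle_iff: "(i, j) \<in> triangle n \<longleftrightarrow> 1 \<le> i \<and> 1 \<le> j \<and> i + j \<le> n"
  by (auto simp: triangle_def)

lemma set_all_cells: "set (all_cells n) = triangle n"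
proof -
  have "(i, j) \<in> set (all_cells n) \<longleftrightarrow> (i, j) \<in> triangle n" for i j
    unfolding all_cells_def set_append set_rev set_map Un_iff pair_in_swap_image set_lower_cells
      set_content_cells triangle_iff by auto
  then show ?thesis by auto
qed

lemma distinct_all_cells: "distinct (all_cells n)"
  using distinct_lower_cells[of n False] distinct_content_cells[of n 0]
  by (auto simp: all_cells_def distinct_map set_lower_cells set_content_cells inj_on_def)

lemma sorted_all_cells: "sorted_wrt (\<lambda>x y. content x \<le> content y) (all_cells n)"
proof -
  let ?L = "lower_cells n False"
  have le: "snd c \<le> fst c" if "c \<in> set ?L" for c by (cases c) (use that in \<open>simp add: set_lower_cells\<close>)
  have L: "sorted_wrt (\<lambda>x y. fst x - snd x \<le> fst y - snd y) ?L" by (rule lower_cells_sorted)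
  have "sorted_wrt (\<lambda>x y. content y \<le> content x) ?L"
    by (rule sorted_wrt_mono_rel[OF _ L]) (use le in \<open>force simp: content_def\<close>)
  moreover have "sorted_wrt (\<lambda>x y. content (prod.swap x) \<le> content (prod.swap y)) ?L"
    by (rule sorted_wrt_mono_rel[OF _ L]) (use le in \<open>force simp: content_def\<close>)
  moreover have "sorted_wrt (\<lambda>x y. content x \<le> content y) (content_cells n 0)"
    by (rule sorted_wrtI_all) (auto simp: set_content_cells content_def)
  ultimately show ?thesis
    by (auto simp: all_cells_def sorted_wrt_append sorted_wrt_rev sorted_wrt_map set_lower_cells
      set_content_cells content_def)
qed

lemma cell_letter_range: "c \<in> triangle n \<Longrightarrow> cell_letter c \<in> {1..<n}"
  by (cases c) (auto simp: triangle_iff cell_letter_def)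

context
  fixes n :: nat and D :: "(nat \<times> nat) set"
begin

text \<open>
  A pipe dream is swept by diagonals of constant content. Before content \<open>d\<close> is processed, the path
  with left endpoint \<open>p\<close> is on track \<open>track_at d p\<close>; cell \<open>(i, j)\<close> sits between tracks \<open>i + j - 1\<close> and \<open>i + j\<close>.
\<close>

definition block :: "int \<Rightarrow> nat list" where
  "block d = map cell_letter (filter (\<lambda>c. c \<in> D \<and> content c = d) (all_cells n))"

definition track_at :: "int \<Rightarrow> nat \<Rightarrow> nat" where
  "track_at d = track (map cell_letter (filter (\<lambda>c. c \<in> D \<and> content c < d) (all_cells n)))"

lemma set_block: "k \<in> set (block d) \<longleftrightarrow> (\<exists>c\<in>triangle n. c \<in> D \<and> content c = d \<and> cell_letter c = k)"
  by (auto simp: block_def set_all_cells)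

lemma filter_sorted_split:
  assumes "sorted_wrt (\<lambda>x y. content x \<le> content y) xs"
  shows "filter (\<lambda>c. c \<in> D \<and> content c < d + 1) xs =
    filter (\<lambda>c. c \<in> D \<and> content c < d) xs @ filter (\<lambda>c. c \<in> D \<and> content c = d) xs"
  using assms
proof (induction xs)
  case (Cons x xs)
  have ih: "filter (\<lambda>c. c \<in> D \<and> content c < d + 1) xs =
    filter (\<lambda>c. c \<in> D \<and> content c < d) xs @ filter (\<lambda>c. c \<in> D \<and> content c = d) xs"
    using Cons by simp
  show ?case
  proof (cases "content x < d")
    case True
    then show ?thesis using ih by simp
  next
    case False
    then have "filter (\<lambda>c. c \<in> D \<and> content c < d) xs = []"
      using Cons.prems by (fastforce simp: filter_empty_conv)
    then show ?thesis using ih False by auto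
  qed
qed simp

lemma track_at_Suc: "track_at (d + 1) = track (block d) \<circ> track_at d"
  unfolding track_at_def block_def filter_sorted_split[OF sorted_all_cells]
  by (simp add: track_append)

lemma letter_content_inj:
  assumes "c \<in> triangle n" "c' \<in> triangle n" "content c = content c'"
  shows "cell_letter c = cell_letter c' \<longleftrightarrow> c = c'"
  using assms by (cases c; cases c') (auto simp: triangle_iff content_def cell_letter_def)

text \<open>Along a diagonal \<open>i + j\<close> keeps its parity. Hence the crossings of one block
  act on disjoint pairs of tracks.\<close>

lemma letter_content_Suc:
  assumes "c \<in> triangle n" "c' \<in> triangle n" "content c = content c'"
  shows "cell_letter c' \<noteq> Suc (cell_letter c)"
proof
  assume l: "cell_letter c' = Suc (cell_letter c)"
  obtain a b a' b' where c: "c = (a, b)" "c' = (a', b')" by (cases c; cases c')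
  have "b + a' = b' + a" using assms(3) unfolding c content_def by simp
  moreover have "a' + b' = Suc (a + b)" using l assms(1,2) unfolding c cell_letter_def triangle_iff fst_conv snd_conv by linarith
  ultimately show False by presburger
qed

lemma distinct_block: "distinct (block d)"
  unfolding block_def distinct_map
  using distinct_all_cells letter_content_inj by (auto simp: inj_on_def set_all_cells)

lemma block_apart: "a \<in> set (block d) \<Longrightarrow> b \<in> set (block d) \<Longrightarrow> b \<noteq> Suc a"
  using letter_content_Suc by (auto simp: set_block)

lemma block_cross:
  assumes "(i, j) \<in> triangle n" "(i, j) \<in> D"
  shows "track (block (int j - int i)) (i + j - 1) = i + j"
    and "track (block (int j - int i)) (i + j) = i + j - 1"
proof -
  have "i + j - 1 \<in> set (block (int j - int i))"
    unfolding set_block using assms by (intro bexI[of _ "(i, j)"]) (auto simp: content_def cell_letter_def)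
  from track_cross[OF distinct_block block_apart this] assms
  show "track (block (int j - int i)) (i + j - 1) = i + j" "track (block (int j - int i)) (i + j) = i + j - 1"
    by (auto simp: triangle_iff)
qed

lemma block_avoid:
  assumes "1 \<le> i" "1 \<le> j" "(i, j) \<notin> D \<or> (i, j) \<notin> triangle n"
  shows "track (block (int j - int i)) (i + j - 1) = i + j - 1"
    and "track (block (int j - int i)) (i + j) = i + j"
proof -
  have "i + j - 1 \<noteq> k \<and> i + j - 1 \<noteq> Suc k \<and> i + j \<noteq> k \<and> i + j \<noteq> Suc k"
    if k: "k \<in> set (block (int j - int i))" for k
  proof -
    obtain a b where ab: "(a, b) \<in> triangle n" "(a, b) \<in> D" "int b - int a = int j - int i" "k = a + b - 1"
      using k by (auto simp: set_block content_def cell_letter_def)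
    have "a \<noteq> i" using ab assms by auto
    moreover have eq: "b + i = j + a" using ab(3) by linarith
    ultimately have "a + b \<noteq> i + j" by linarith
    moreover have "a + b \<noteq> Suc (i + j)" using eq by presburger
    moreover have "Suc (a + b) \<noteq> i + j" using eq by presburger
    ultimately show ?thesis using ab(1,4) assms(1,2) unfolding triangle_iff by linarith
  qed
  then show "track (block (int j - int i)) (i + j - 1) = i + j - 1" "track (block (int j - int i)) (i + j) = i + j"
    by (auto intro!: track_fix)
qed

text \<open>Left and bottom edges of a cell of content \<open>d\<close> get time \<open>d\<close>,
  right and top edges \<open>d + 1\<close>, so every strand takes one unit of time. The bottom edge
  is \<open>TopE (i + 1) j\<close>, whence the \<open>+ 1\<close> in the second clause.\<close>

fun edge_time :: "edge \<Rightarrow> int" where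
  "edge_time (LeftE i j) = int j - int i"
| "edge_time (TopE i j) = int j - int i + 1"

fun edge_track :: "edge \<Rightarrow> nat" where
  "edge_track (LeftE i j) = i + j - 1"
| "edge_track (TopE i j) = i + j - 1"

fun edge_valid :: "edge \<Rightarrow> bool" where
  "edge_valid (LeftE i j) \<longleftrightarrow> 1 \<le> i \<and> 1 \<le> j \<and> i + j \<le> Suc n"
| "edge_valid (TopE i j) \<longleftrightarrow> 1 \<le> i \<and> 1 \<le> j \<and> i + j \<le> Suc n"

lemma strands_track:
  assumes "(a, b) \<in> strands n D"
  shows "edge_time b = edge_time a + 1 \<and> track (block (edge_time a)) (edge_track a) = edge_track b"
  using assms
proof cases
  case (cross_h i j)
  then show ?thesis using block_cross(1)[of i j] by (simp add: triangle_iff)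
next
  case (cross_v i j)
  then show ?thesis using block_cross(2)[of i j] by (simp add: triangle_iff)
next
  case (avoid_lt i j)
  then show ?thesis using block_avoid(1)[of i j] by (simp add: triangle_iff)
next
  case (avoid_br i j)
  then show ?thesis using block_avoid(2)[of i j] by (simp add: triangle_iff)
next
  case (diag i j)
  then show ?thesis using block_avoid(1)[of i j] by (simp add: triangle_iff)
qed

lemma pipe_track:
  assumes "1 \<le> p" "e \<in> pipe n D p"
  shows "track_at (edge_time e) p = edge_track e"
proof -
  have "(LeftE p 1, e) \<in> (strands n D)\<^sup>*" using assms(2) by (simp add: pipe_def)
  then show ?thesis
  proof induction
    case base
    \<comment> \<open>A cell of content below \<open>1 - p\<close> has a letter above
      \<open>p\<close>, so no crossing before the start of the pipe touches track
      \<open>p\<close>.\<close>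
    have "track_at (1 - int p) p = p"
      unfolding track_at_def
      by (rule track_fix) (auto simp: set_all_cells triangle_iff content_def cell_letter_def)
    then show ?case by simp
  next
    case (step y z)
    then show ?case using strands_track[OF step(2)] track_at_Suc[of "edge_time y"] by simp
  qed
qed

text \<open>A measure for tracing an edge back to the left border. It grows along strands; the final
  \<open>+ 1\<close> accounts for a path from the left to the top edge of the same cell.\<close>

fun edge_height :: "edge \<Rightarrow> nat" where
  "edge_height (LeftE i j) = 2 * j + 2 * (n - i)"
| "edge_height (TopE i j) = 2 * j + 2 * (n - i) + 1"

lemma edge_pipe: "edge_valid e \<Longrightarrow> \<exists>p\<in>{1..n}. e \<in> pipe n D p"
proof (induction "edge_height e" arbitrary: e rule: less_induct)
  case less
  have step: ?case if "(e', e) \<in> strands n D" "edge_valid e'" "edge_height e' < edge_height e" for e'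
    using less(1)[OF that(3,2)] that(1) by (auto simp: pipe_def intro: rtrancl_into_rtrancl)
  show ?case
  proof (cases e)
    case (LeftE i j)
    show ?thesis
    proof (cases "j = 1")
      case True
      then show ?thesis using less(2) LeftE by (intro bexI[of _ i]) (auto simp: pipe_def)
    next
      case False
      then obtain k where k: "j = k + 1" "1 \<le> k" using less(2) LeftE by (cases j) auto
      then have t: "(i, k) \<in> triangle n" using less(2) LeftE by (simp add: triangle_iff)
      show ?thesis
      proof (cases "(i, k) \<in> D")
        case True
        then show ?thesis using step[of "LeftE i k"] strands.cross_h[OF t True] less(2) LeftE k by simp
      next
        case False
        then show ?thesis using step[of "TopE (i + 1) k"] strands.avoid_br[OF t False] less(2) LeftE k by simp
      qed
    qed
  next
    case (TopE i j)
    show ?thesis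
    proof (cases "i + j = n + 1")
      case True
      then have "(LeftE i j, TopE i j) \<in> strands n D" using less(2) TopE by (intro strands.diag) auto
      then show ?thesis using step[of "LeftE i j"] less(2) TopE by simp
    next
      case False
      then have t: "(i, j) \<in> triangle n" using less(2) TopE by (simp add: triangle_iff)
      show ?thesis
      proof (cases "(i, j) \<in> D")
        case True
        have "n - Suc i < n - i" using t unfolding triangle_iff by linarith
        then show ?thesis using step[of "TopE (i + 1) j"] strands.cross_v[OF t True] less(2) TopE t
          by (simp add: triangle_iff)
      next
        case False
        then show ?thesis using step[of "LeftE i j"] strands.avoid_lt[OF t False] less(2) TopE by simp
      qed
    qed
  qed
qed

lemma track_at_eq_iff [simp]: "track_at d a = track_at d b \<longleftrightarrow> a = b"
  by (simp add: track_at_def)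

text \<open>Some pipe runs through \<open>e\<close> by \<open>edge_pipe\<close>, and two pipes are
  never on the same track at the same time.\<close>

lemma pipe_iff:
  assumes "edge_valid e" "1 \<le> p"
  shows "e \<in> pipe n D p \<longleftrightarrow> track_at (edge_time e) p = edge_track e"
proof
  assume "track_at (edge_time e) p = edge_track e"
  moreover obtain q where q: "q \<in> {1..n}" "e \<in> pipe n D q" using edge_pipe assms by blast
  ultimately have "track_at (edge_time e) p = track_at (edge_time e) q" using pipe_track[of q e] by simp
  then show "e \<in> pipe n D p" using q by simp
qed (use pipe_track assms in blast)

lemma pipe_crossing_iff:
  assumes c: "c \<in> triangle n" and p: "1 \<le> p" "1 \<le> q"
  shows "(case c of (i, j) \<Rightarrow>
     LeftE i j \<in> pipe n D p \<and> TopE (i + 1) j \<in> pipe n D q \<or>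
     LeftE i j \<in> pipe n D q \<and> TopE (i + 1) j \<in> pipe n D p) \<longleftrightarrow>
    {track_at (content c) p, track_at (content c) q} = {cell_letter c, Suc (cell_letter c)}"
proof -
  obtain i j where ij: "c = (i, j)" by (cases c)
  have v: "edge_valid (LeftE i j)" "edge_valid (TopE (i + 1) j)" using c ij by (auto simp: triangle_iff)
  have "Suc (i + j - 1) = i + j" using c ij by (simp add: triangle_iff)
  then show ?thesis unfolding ij using pipe_iff[OF v(1)] pipe_iff[OF v(2)] p
    by (auto simp: content_def cell_letter_def doubleton_eq_iff)
qed

text \<open>The list puts cells of equal content one after another, while the sweep treats them at
  once. The difference is harmless because the others on the diagonal of \<open>c\<close> touch
  neither track of \<open>c\<close>.\<close>

lemma track_prefix:
  assumes "all_cells n = xs @ c # ys" "k = cell_letter c \<or> k = Suc (cell_letter c)"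
  shows "track (word_of D xs) p = k \<longleftrightarrow> track_at (content c) p = k"
proof -
  have s: "sorted_wrt (\<lambda>x y. content x \<le> content y) (xs @ c # ys)" using sorted_all_cells assms(1) by metis
  have cx: "c \<in> triangle n" "set xs \<subseteq> triangle n" "c \<notin> set xs"
    using set_all_cells[of n] distinct_all_cells[of n] unfolding assms(1) by auto
  have "filter (\<lambda>x. x \<in> D \<and> content x < content c) (c # ys) = []"
    using s by (fastforce simp: filter_empty_conv sorted_wrt_append)
  then have "filter (\<lambda>x. x \<in> D \<and> content x < content c) (all_cells n) = filter (\<lambda>x. x \<in> D \<and> content x < content c) xs"
    unfolding assms(1) by simp
  then have t: "track_at (content c) = track (map cell_letter (filter (\<lambda>x. x \<in> D \<and> content x < content c) xs))"
    by (simp add: track_at_def)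
  let ?b = "map cell_letter (filter (\<lambda>x. x \<in> D \<and> content x = content c) xs)"
  have "filter (\<lambda>x. x \<in> D) xs = filter (\<lambda>x. x \<in> D \<and> content x < content c + 1) xs"
    using s by (intro filter_cong) (fastforce simp: sorted_wrt_append)+
  also have "\<dots> = filter (\<lambda>x. x \<in> D \<and> content x < content c) xs @ filter (\<lambda>x. x \<in> D \<and> content x = content c) xs"
    by (rule filter_sorted_split) (use s in \<open>simp add: sorted_wrt_append\<close>)
  finally have e: "track (word_of D xs) = track ?b \<circ> track_at (content c)"
    unfolding t word_of_def by (simp add: track_append)
  have "track ?b k = k"
  proof (rule track_fix)
    fix l assume "l \<in> set ?b"
    then obtain x where x: "x \<in> set xs" "content x = content c" "l = cell_letter x" by auto
    then have "x \<in> triangle n" "x \<noteq> c" using cx by auto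
    then have "cell_letter x \<noteq> cell_letter c" "cell_letter x \<noteq> Suc (cell_letter c)" "cell_letter c \<noteq> Suc (cell_letter x)"
      using letter_content_inj[of x c] letter_content_Suc[of x c] letter_content_Suc[of c x] cx x by auto
    then show "k \<noteq> l \<and> k \<noteq> Suc l" using assms(2) x(3) by auto
  qed
  then show ?thesis unfolding e using track_eq_iff[of ?b "track_at (content c) p" k] by simp
qed

lemma crossing_pair_iff:
  assumes "all_cells n = xs @ c # ys" "1 \<le> p" "1 \<le> q"
  shows "cross_at n D p q c \<longleftrightarrow> c \<in> D \<and>
      {track (word_of D xs) p, track (word_of D xs) q} = {cell_letter c, Suc (cell_letter c)}"
    and "avoid_at n D p q c \<longleftrightarrow> c \<notin> D \<and>
      {track (word_of D xs) p, track (word_of D xs) q} = {cell_letter c, Suc (cell_letter c)}"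
proof -
  have c: "c \<in> triangle n" using set_all_cells[of n] unfolding assms(1) by auto
  have "{track (word_of D xs) p, track (word_of D xs) q} = {cell_letter c, Suc (cell_letter c)} \<longleftrightarrow>
    {track_at (content c) p, track_at (content c) q} = {cell_letter c, Suc (cell_letter c)}"
    using track_prefix[OF assms(1), of "cell_letter c"] track_prefix[OF assms(1), of "Suc (cell_letter c)"]
    by (auto simp: doubleton_eq_iff)
  then show "cross_at n D p q c \<longleftrightarrow> c \<in> D \<and>
      {track (word_of D xs) p, track (word_of D xs) q} = {cell_letter c, Suc (cell_letter c)}"
    "avoid_at n D p q c \<longleftrightarrow> c \<notin> D \<and>
      {track (word_of D xs) p, track (word_of D xs) q} = {cell_letter c, Suc (cell_letter c)}"
    unfolding cross_at_def avoid_at_def using pipe_crossing_iff[OF c assms(2,3)] c by auto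
qed

section \<open>Crossing numbers and reduced words\<close>

definition crossings :: "(nat \<times> nat) list \<Rightarrow> nat \<Rightarrow> nat \<Rightarrow> (nat \<times> nat) set" where
  "crossings xs p q = {c. \<exists>ys zs. xs = ys @ c # zs \<and> c \<in> D \<and>
    {track (word_of D ys) p, track (word_of D ys) q} = {cell_letter c, Suc (cell_letter c)}}"

lemma crossings_Nil [simp]: "crossings [] p q = {}" by (simp add: crossings_def)

lemma crossings_snoc:
  "crossings (xs @ [c]) p q = crossings xs p q \<union>
    (if c \<in> D \<and> {track (word_of D xs) p, track (word_of D xs) q} = {cell_letter c, Suc (cell_letter c)} then {c} else {})"
proof -
  define Q where "Q ys c \<longleftrightarrow> c \<in> D \<and>
    {track (word_of D ys) p, track (word_of D ys) q} = {cell_letter c, Suc (cell_letter c)}" for ys c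
  have cr: "crossings zs p q = {c. \<exists>ys us. zs = ys @ c # us \<and> Q ys c}" for zs
    unfolding crossings_def Q_def by simp
  show ?thesis unfolding cr Q_def[symmetric] snoc_eq_append_Cons by auto
qed

lemma crossings_subset: "crossings xs p q \<subseteq> set xs"
  by (auto simp: crossings_def)

lemma finite_crossings: "finite (crossings xs p q)"
  by (rule finite_subset[OF crossings_subset]) simp

lemma crossings_parity:
  assumes "distinct xs" "p < q"
  shows "track (word_of D xs) q < track (word_of D xs) p \<longleftrightarrow> odd (card (crossings xs p q))"
  using assms(1)
proof (induction xs rule: rev_induct)
  case Nil
  then show ?case using assms(2) by simp
next
  case (snoc c xs)
  let ?g = "track (word_of D xs)"
  have ih: "?g q < ?g p \<longleftrightarrow> odd (card (crossings xs p q))" and c: "c \<notin> crossings xs p q"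
    using snoc crossings_subset[of xs p q] by auto
  have ne: "?g p \<noteq> ?g q" using assms(2) by simp
  show ?case
  proof (cases "c \<in> D")
    case False
    then show ?thesis using ih by (simp add: crossings_snoc word_of_append word_of_Cons)
  next
    case True
    let ?k = "cell_letter c"
    have t: "track (word_of D (xs @ [c])) = adj ?k \<circ> ?g" using True by (simp add: word_of_append word_of_Cons track_snoc)
    show ?thesis
    proof (cases "{?g p, ?g q} = {?k, Suc ?k}")
      case eq: True
      then have "card (crossings (xs @ [c]) p q) = Suc (card (crossings xs p q))"
        using True c finite_crossings by (simp add: crossings_snoc)
      moreover have "adj ?k (?g q) < adj ?k (?g p) \<longleftrightarrow> \<not> ?g q < ?g p" using eq by (auto simp: doubleton_eq_iff)
      ultimately show ?thesis using ih unfolding t by simp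
    next
      case False
      then have "{?g q, ?g p} \<noteq> {?k, Suc ?k}" by (simp add: insert_commute)
      then have "adj ?k (?g q) < adj ?k (?g p) \<longleftrightarrow> ?g q < ?g p" using ne by (intro adj_less_adj_iff) auto
      then show ?thesis using ih False unfolding t by (simp add: crossings_snoc)
    qed
  qed
qed

text \<open>A last crossing changes the count of one pair only, the pipes \<open>p0\<close> and
  \<open>q0\<close> now on its tracks. It lengthens the permutation iff these have crossed an even
  number of times before.\<close>

lemma crossings_reduced:
  assumes "distinct xs" "set xs \<subseteq> triangle n"
  shows "(\<forall>p\<in>{1..n}. \<forall>q\<in>{1..n}. p \<noteq> q \<longrightarrow> card (crossings xs p q) \<le> 1) \<longleftrightarrow>
    ninv (track (word_of D xs)) = length (word_of D xs)"
  using assms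
proof (induction xs rule: rev_induct)
  case Nil
  show "(\<forall>p\<in>{1..n}. \<forall>q\<in>{1..n}. p \<noteq> q \<longrightarrow> card (crossings [] p q) \<le> 1) \<longleftrightarrow>
    ninv (track (word_of D [])) = length (word_of D [])" by simp
next
  case (snoc c xs)
  let ?g = "track (word_of D xs)" and ?k = "cell_letter c"
  have d: "distinct xs" "c \<notin> set xs" "set xs \<subseteq> triangle n" "c \<in> triangle n" using snoc.prems by auto
  have ih: "(\<forall>p\<in>{1..n}. \<forall>q\<in>{1..n}. p \<noteq> q \<longrightarrow> card (crossings xs p q) \<le> 1) \<longleftrightarrow> ninv ?g = length (word_of D xs)"
    by (rule snoc.IH) (use d in auto)
  have c: "c \<notin> crossings xs p q" for p q using d crossings_subset by blast
  show ?case
  proof (cases "c \<in> D")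
    case False
    then show ?thesis using ih by (simp add: crossings_snoc word_of_append word_of_Cons)
  next
    case True
    have t: "track (word_of D (xs @ [c])) = adj ?k \<circ> ?g" and len: "length (word_of D (xs @ [c])) = Suc (length (word_of D xs))"
      using True by (simp_all add: word_of_append word_of_Cons track_snoc)
    have "set (word_of D xs) \<subseteq> {1..<n}" using d(3) cell_letter_range unfolding word_of_def by auto
    then have gS: "?g \<in> Sym n" by (rule track_Sym)
    have k: "?k \<in> {1..<n}" using cell_letter_range d(4) .
    define p0 q0 where "p0 = inv ?g ?k" and "q0 = inv ?g (Suc ?k)"
    have pq: "p0 \<in> {1..n}" "q0 \<in> {1..n}" unfolding p0_def q0_def
      using Sym_in[OF inv_Sym[OF gS], of ?k] Sym_in[OF inv_Sym[OF gS], of "Suc ?k"] k by auto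
    have g: "?g p0 = ?k" "?g q0 = Suc ?k" unfolding p0_def q0_def
      using bij_Sym[OF gS] by (simp_all add: bij_is_surj surj_f_inv_f)
    have ne: "p0 \<noteq> q0" using g by auto
    have iff: "{?g p, ?g q} = {?k, Suc ?k} \<longleftrightarrow> {p, q} = {p0, q0}" for p q
    proof -
      have e: "{?k, Suc ?k} = {?g p0, ?g q0}" using g by simp
      show ?thesis unfolding e doubleton_eq_iff track_eq_iff by (rule refl)
    qed
    have cr: "card (crossings (xs @ [c]) p q) = card (crossings xs p q) + (if {p, q} = {p0, q0} then 1 else 0)" for p q
      using True c finite_crossings by (simp add: crossings_snoc iff)
    have sym: "crossings xs p q = crossings xs q p" for p q by (simp add: crossings_def insert_commute)
    consider "p0 < q0" | "q0 < p0" using ne by linarith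
    then show ?thesis
    proof cases
      case 1
      have n1: "ninv (adj ?k \<circ> ?g) = Suc (ninv ?g)"
        using ninv_left_asc[OF gS, of ?k] 1 p0_def q0_def by simp
      \<comment> \<open>The two pipes are still in their initial order.\<close>
      have ev: "even (card (crossings xs p0 q0))" using crossings_parity[OF d(1) 1] g by simp
      have "(\<forall>p\<in>{1..n}. \<forall>q\<in>{1..n}. p \<noteq> q \<longrightarrow> card (crossings (xs @ [c]) p q) \<le> 1) \<longleftrightarrow>
          (\<forall>p\<in>{1..n}. \<forall>q\<in>{1..n}. p \<noteq> q \<longrightarrow> card (crossings xs p q) \<le> 1)"
      proof (intro iffI ballI impI)
        fix p q assume a: "\<forall>p\<in>{1..n}. \<forall>q\<in>{1..n}. p \<noteq> q \<longrightarrow> card (crossings (xs @ [c]) p q) \<le> 1"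
          "p \<in> {1..n}" "q \<in> {1..n}" "p \<noteq> q"
        then have "card (crossings (xs @ [c]) p q) \<le> 1" by blast
        then show "card (crossings xs p q) \<le> 1" unfolding cr by simp
      next
        fix p q assume a: "\<forall>p\<in>{1..n}. \<forall>q\<in>{1..n}. p \<noteq> q \<longrightarrow> card (crossings xs p q) \<le> 1"
          "p \<in> {1..n}" "q \<in> {1..n}" "p \<noteq> q"
        have l: "card (crossings xs p q) \<le> 1" using a by blast
        show "card (crossings (xs @ [c]) p q) \<le> 1"
        proof (cases "{p, q} = {p0, q0}")
          case eq: True
          then have "crossings xs p q = crossings xs p0 q0" using sym by (auto simp: doubleton_eq_iff)
          then have "card (crossings xs p q) = 0" using ev l by (cases "card (crossings xs p0 q0)") auto
          then show ?thesis unfolding cr by simp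
        next
          case False
          then show ?thesis unfolding cr using l by simp
        qed
      qed
      then show ?thesis unfolding t len n1 ih by simp
    next
      case 2
      \<comment> \<open>The two pipes have crossed already. A further crossing repeats the pair and
        shortens the permutation, so both sides are false.\<close>
      have "odd (card (crossings xs q0 p0))" using crossings_parity[OF d(1) 2] g by simp
      then have "0 < card (crossings xs q0 p0)" by (rule odd_pos)
      then have "\<not> card (crossings (xs @ [c]) p0 q0) \<le> 1" unfolding cr sym[of p0 q0] by simp
      then have 1: "\<not> (\<forall>p\<in>{1..n}. \<forall>q\<in>{1..n}. p \<noteq> q \<longrightarrow> card (crossings (xs @ [c]) p q) \<le> 1)"
        using pq ne by blast
      have "ninv ?g = Suc (ninv (adj ?k \<circ> ?g))"
        using ninv_left_desc[OF gS, of ?k] 2 p0_def q0_def by simp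
      moreover have "ninv ?g \<le> length (word_of D xs)" by (rule ninv_track)
      ultimately have 3: "ninv (adj ?k \<circ> ?g) \<noteq> Suc (length (word_of D xs))" by linarith
      show ?thesis unfolding t len using 1 3 by blast
    qed
  qed
qed

lemma cross_at_iff:
  assumes "1 \<le> p" "1 \<le> q"
  shows "cross_at n D p q c \<longleftrightarrow> c \<in> crossings (all_cells n) p q"
proof
  assume c: "cross_at n D p q c"
  then have "c \<in> set (all_cells n)" by (simp add: cross_at_def set_all_cells)
  then obtain ys zs where e: "all_cells n = ys @ c # zs" by (meson split_list)
  then show "c \<in> crossings (all_cells n) p q"
    using crossing_pair_iff(1)[OF e assms] c unfolding crossings_def by blast
next
  assume "c \<in> crossings (all_cells n) p q"
  then obtain ys zs where e: "all_cells n = ys @ c # zs" "c \<in> D"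
    "{track (word_of D ys) p, track (word_of D ys) q} = {cell_letter c, Suc (cell_letter c)}"
    unfolding crossings_def by (elim CollectE exE conjE)
  then show "cross_at n D p q c" using crossing_pair_iff(1)[OF e(1) assms] by blast
qed

lemma word_of_all_range: "D \<subseteq> triangle n \<Longrightarrow> set (word_of D (all_cells n)) \<subseteq> {1..<n}"
  using cell_letter_range unfolding word_of_def by auto

lemma top_pipe_iff:
  assumes p: "p \<in> {1..n}" and k: "k \<in> {1..n}"
  shows "TopE 1 k \<in> pipe n D p \<longleftrightarrow> track (word_of D (all_cells n)) p = k"
proof -
  have e: "TopE 1 k \<in> pipe n D p \<longleftrightarrow> track_at (int k) p = k"
    using pipe_iff[of "TopE 1 k" p] p k by simp
  let ?r = "map cell_letter (filter (\<lambda>c. c \<in> D \<and> \<not> content c < int k) (all_cells n))"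
  have "filter (\<lambda>c. c \<in> D) xs = filter (\<lambda>c. c \<in> D \<and> content c < d) xs @ filter (\<lambda>c. c \<in> D \<and> \<not> content c < d) xs"
    if "sorted_wrt (\<lambda>x y. content x \<le> content y) xs" for xs d
    using that
  proof (induction xs)
    case (Cons x xs)
    show ?case
    proof (cases "content x < d")
      case False
      then have "filter (\<lambda>c. c \<in> D \<and> content c < d) xs = []"
        using Cons.prems by (fastforce simp: filter_empty_conv)
      then show ?thesis using False Cons by auto
    qed (use Cons in simp)
  qed simp
  from this[OF sorted_all_cells, where d = "int k"]
  have "track (word_of D (all_cells n)) = track ?r \<circ> track_at (int k)"
    by (simp add: word_of_def track_at_def track_append)
  \<comment> \<open>A cell of content at least \<open>k\<close> has a letter above
    \<open>k\<close>.\<close>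
  moreover have "track ?r k = k"
    by (rule track_fix) (auto simp: set_all_cells triangle_iff content_def cell_letter_def)
  ultimately show ?thesis unfolding e using track_eq_iff[of ?r "track_at (int k) p" k] by simp
qed

lemma PD_iff:
  assumes w: "w \<in> Sym n"
  shows "D \<in> PD n w \<longleftrightarrow> D \<subseteq> triangle n \<and> track (word_of D (all_cells n)) = w \<and>
    ninv w = length (word_of D (all_cells n))"
proof (cases "D \<subseteq> triangle n")
  case True
  have "card {c. cross_at n D p q c} = card (crossings (all_cells n) p q)" if "p \<in> {1..n}" "q \<in> {1..n}" for p q
    using cross_at_iff[of p q] that by simp
  then have red: "reduced_pipe_dream n D \<longleftrightarrow> ninv (track (word_of D (all_cells n))) = length (word_of D (all_cells n))"
    unfolding reduced_pipe_dream_def using True crossings_reduced[OF distinct_all_cells] by (simp add: set_all_cells)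
  have tS: "track (word_of D (all_cells n)) \<in> Sym n" using word_of_all_range[OF True] by (rule track_Sym)
  have "(\<forall>p\<in>{1..n}. TopE 1 (w p) \<in> pipe n D p) \<longleftrightarrow> (\<forall>p\<in>{1..n}. track (word_of D (all_cells n)) p = w p)"
    using top_pipe_iff Sym_in[OF w] by blast
  also have "\<dots> \<longleftrightarrow> track (word_of D (all_cells n)) = w"
  proof
    assume a: "\<forall>p\<in>{1..n}. track (word_of D (all_cells n)) p = w p"
    show "track (word_of D (all_cells n)) = w"
    proof
      fix p
      show "track (word_of D (all_cells n)) p = w p"
        using a permutes_not_in[OF Sym_D[OF w], of p] permutes_not_in[OF Sym_D[OF tS], of p] by (cases "p \<in> {1..n}") auto
    qed
  qed simp
  finally show ?thesis unfolding PD_def using red True by auto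
next
  case False
  then show ?thesis by (simp add: PD_def reduced_pipe_dream_def)
qed

end

section \<open>Involution pipe dreams as involution words\<close>

lemma ninv_adj: "ninv (adj k) = 1"
proof -
  have "ninv (id \<circ> adj k) = Suc (ninv id)" by (rule ninv_asc[OF id_Sym]) simp
  then show ?thesis by simp
qed

text \<open>
  Reading the cells of \<open>L\<close> outwards from the diagonal on both sides: \<open>D\<close> selects the crossings below
  the diagonal and \<open>U\<close> those above it, and \<open>dg\<close> is the word of the diagonal.
\<close>

definition mid_word :: "nat list \<Rightarrow> (nat \<times> nat) set \<Rightarrow> (nat \<times> nat) set \<Rightarrow> (nat \<times> nat) list \<Rightarrow> nat list" where
  "mid_word dg D U L = rev (word_of D L) @ dg @ word_of U L"

lemma mid_word_Nil [simp]: "mid_word dg D U [] = dg" by (simp add: mid_word_def)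

lemma mid_word_snoc: "mid_word dg D U (L @ [c]) =
    (if c \<in> D then [cell_letter c] else []) @ mid_word dg D U L @ (if c \<in> U then [cell_letter c] else [])"
  by (simp add: mid_word_def word_of_append word_of_Cons)

text \<open>
  Condition (2) of almost-symmetry: the two pipes crossing at \<open>c\<close> avoid each other at its mirror image
  iff the involution read between the two cells preserves the pair of tracks of \<open>c\<close>.
\<close>

definition mid_ok :: "nat list \<Rightarrow> (nat \<times> nat) set \<Rightarrow> (nat \<times> nat) set \<Rightarrow> (nat \<times> nat) list \<Rightarrow> bool" where
  "mid_ok dg D U L \<longleftrightarrow> (\<forall>L1 c L2. L = L1 @ c # L2 \<longrightarrow> c \<in> D \<longrightarrow> c \<notin> U \<longrightarrow>
    track (mid_word dg D U L1) ` {cell_letter c, Suc (cell_letter c)} = {cell_letter c, Suc (cell_letter c)})"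

lemma mid_ok_Nil [simp]: "mid_ok dg D U []" by (simp add: mid_ok_def)

lemma mid_ok_snoc: "mid_ok dg D U (L @ [c]) \<longleftrightarrow> mid_ok dg D U L \<and> (c \<in> D \<longrightarrow> c \<notin> U \<longrightarrow>
    track (mid_word dg D U L) ` {cell_letter c, Suc (cell_letter c)} = {cell_letter c, Suc (cell_letter c)})"
proof -
  define Q where "Q ys c \<longleftrightarrow> (c \<in> D \<longrightarrow> c \<notin> U \<longrightarrow>
    track (mid_word dg D U ys) ` {cell_letter c, Suc (cell_letter c)} = {cell_letter c, Suc (cell_letter c)})" for ys c
  have mo: "mid_ok dg D U zs \<longleftrightarrow> (\<forall>ys c us. zs = ys @ c # us \<longrightarrow> Q ys c)" for zs
    unfolding mid_ok_def Q_def by simp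
  show ?thesis unfolding mo Q_def[symmetric] snoc_eq_append_Cons
  proof
    assume a: "\<forall>ys c' us. (ys = L \<and> c' = c \<and> us = []) \<or> (\<exists>zs'. us = zs' @ [c] \<and> L = ys @ c' # zs') \<longrightarrow> Q ys c'"
    show "(\<forall>ys c us. L = ys @ c # us \<longrightarrow> Q ys c) \<and> Q L c" using a by blast
  qed blast
qed

lemma mid_ok_cong:
  assumes "\<And>c. c \<in> set L \<Longrightarrow> c \<in> D \<longleftrightarrow> c \<in> D'" "\<And>c. c \<in> set L \<Longrightarrow> c \<in> U \<longleftrightarrow> c \<in> U'"
  shows "mid_word dg D U L = mid_word dg D' U' L" "mid_ok dg D U L \<longleftrightarrow> mid_ok dg D' U' L"
proof -
  have w: "mid_word dg D U L1 = mid_word dg D' U' L1" if "set L1 \<subseteq> set L" for L1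
  proof -
    have "word_of D L1 = word_of D' L1" "word_of U L1 = word_of U' L1"
      using assms that by (auto intro!: word_of_cong)
    then show ?thesis by (simp add: mid_word_def)
  qed
  then show "mid_word dg D U L = mid_word dg D' U' L" by simp
  show "mid_ok dg D U L \<longleftrightarrow> mid_ok dg D' U' L"
    unfolding mid_ok_def
  proof (intro iff_allI imp_cong refl)
    fix L1 c L2 assume L: "L = L1 @ c # L2"
    show "c \<in> D \<longleftrightarrow> c \<in> D'" "c \<notin> U \<longleftrightarrow> c \<notin> U'" using assms L by auto
    show "(track (mid_word dg D U L1) ` {cell_letter c, Suc (cell_letter c)} = {cell_letter c, Suc (cell_letter c)}) \<longleftrightarrow>
      (track (mid_word dg D' U' L1) ` {cell_letter c, Suc (cell_letter c)} = {cell_letter c, Suc (cell_letter c)})"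
    proof -
      have "mid_word dg D U L1 = mid_word dg D' U' L1" by (rule w) (use L in auto)
      then show ?thesis by simp
    qed
  qed
qed

context
  fixes n :: nat and dg :: "nat list" and e :: "nat \<Rightarrow> nat"
  assumes e: "track dg = e" "e \<in> Inv n" "ninv e = length dg" "set dg \<subseteq> {1..<n}"
begin

text \<open>The middle word stays a reduced word of the involution reached so far: a commuting
  letter adds one inversion and is written on one side, any other adds two and is written on
  both.\<close>

lemma run_imp_mid:
  assumes "distinct L" "set L \<subseteq> triangle n" "run n e (word_of D L) y"
  shows "\<exists>U\<subseteq>D \<inter> set L. track (mid_word dg D U L) = y \<and> ninv y = length (mid_word dg D U L) \<and> mid_ok dg D U L"
  using assms
proof (induction L arbitrary: y rule: rev_induct)
  case Nil
  then show ?case using e by (intro exI[of _ "{}"]) auto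
next
  case (snoc c L)
  let ?k = "cell_letter c"
  have L: "distinct L" "set L \<subseteq> triangle n" "c \<notin> set L" using snoc.prems by auto
  have k: "?k \<in> {1..<n}" using snoc.prems(2) by (intro cell_letter_range) auto
  show ?case
  proof (cases "c \<in> D")
    case False
    then have "run n e (word_of D L) y" using snoc.prems(3) by (simp add: word_of_append word_of_Cons)
    then obtain U where U: "U \<subseteq> D \<inter> set L" "track (mid_word dg D U L) = y"
      "ninv y = length (mid_word dg D U L)" "mid_ok dg D U L"
      using snoc.IH[OF L(1,2)] by blast
    then show ?thesis using False by (intro exI[of _ U]) (auto simp: mid_word_snoc mid_ok_snoc)
  next
    case True
    have "run n e (word_of D L @ [?k]) y" using True snoc.prems(3) by (simp add: word_of_append word_of_Cons)
    then have y: "y \<in> Inv n" "y (Suc ?k) < y ?k" "run n e (word_of D L) (tw ?k y)" by (simp_all add: run_snoc)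
    define t where "t = tw ?k y"
    obtain U where U: "U \<subseteq> D \<inter> set L" "track (mid_word dg D U L) = t"
      "ninv t = length (mid_word dg D U L)" "mid_ok dg D U L"
      using snoc.IH[OF L(1,2) y(3)] t_def by blast
    have t: "t \<in> Inv n" "t ?k < t (Suc ?k)" unfolding t_def
      using tw_Inv[OF y(1) k] tw_desc(1)[OF y(1) k y(2)] by auto
    have yt: "y = tw ?k t" by (simp only: t_def tw_tw)
    have cU: "c \<notin> U" using U(1) L by auto
    show ?thesis
    proof (cases "adj ?k \<circ> t \<circ> adj ?k = t")
      case fixed: True
      then have y': "y = t \<circ> adj ?k" using yt tw_fix by metis
      have f: "t ?k = ?k" "t (Suc ?k) = Suc ?k" using asc_conj_eq(2)[OF t] fixed by auto
      have w: "mid_word dg D U (L @ [c]) = ?k # mid_word dg D U L" using True cU by (simp add: mid_word_snoc)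
      have "track (mid_word dg D U (L @ [c])) = y" unfolding w y' track_Cons U(2) ..
      moreover have "ninv y = length (mid_word dg D U (L @ [c]))"
        unfolding w y' ninv_asc[OF Inv_Sym[OF t(1)] t(2)] using U(3) by simp
      moreover have "mid_ok dg D U (L @ [c])" using U(2,4) f by (simp add: mid_ok_snoc)
      ultimately show ?thesis using U(1) by (intro exI[of _ U]) auto
    next
      case False
      then have y': "y = adj ?k \<circ> t \<circ> adj ?k" using yt tw_move by metis
      let ?U = "insert c U"
      have cong: "mid_word dg D ?U L = mid_word dg D U L" "mid_ok dg D ?U L = mid_ok dg D U L"
        using L by (auto intro!: mid_ok_cong)
      have w: "mid_word dg D ?U (L @ [c]) = ?k # mid_word dg D U L @ [?k]" using True by (simp add: mid_word_snoc cong)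
      have "track (mid_word dg D ?U (L @ [c])) = y" unfolding w y' by (simp only: append_Cons[symmetric] track_snoc track_Cons U(2) comp_assoc)
      moreover have "ninv y = length (mid_word dg D ?U (L @ [c]))"
        unfolding w y' ninv_conj_asc[OF t(1) t(2) False] using U(3) by simp
      moreover have "mid_ok dg D ?U (L @ [c])" using U(4) by (simp add: mid_ok_snoc cong)
      ultimately show ?thesis using U(1) True by (intro exI[of _ ?U]) auto
    qed
  qed
qed

text \<open>Reducedness forces every letter to be an ascent. A letter on both sides then cannot
  commute, and \<open>mid_ok\<close> makes a letter on one side commute, so in either case the step
  is \<open>tw\<close>.\<close>

lemma mid_imp_run:
  assumes "distinct L" "set L \<subseteq> triangle n" "U \<inter> set L \<subseteq> D" "mid_ok dg D U L"
    "ninv (track (mid_word dg D U L)) = length (mid_word dg D U L)"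
  shows "track (mid_word dg D U L) \<in> Inv n \<and> run n e (word_of D L) (track (mid_word dg D U L))"
  using assms
proof (induction L rule: rev_induct)
  case Nil
  show "track (mid_word dg D U []) \<in> Inv n \<and> run n e (word_of D []) (track (mid_word dg D U []))"
    using e by simp
next
  case (snoc c L)
  let ?k = "cell_letter c"
  define t where "t = track (mid_word dg D U L)"
  have k: "?k \<in> {1..<n}" using snoc.prems(2) by (intro cell_letter_range) auto
  have ok: "mid_ok dg D U L" using snoc.prems(4) by (simp add: mid_ok_snoc)
  have ih: "t \<in> Inv n \<and> run n e (word_of D L) t" if "ninv t = length (mid_word dg D U L)"
    unfolding t_def by (rule snoc.IH) (use snoc.prems ok that t_def in auto)
  have le: "ninv t \<le> length (mid_word dg D U L)" unfolding t_def by (rule ninv_track)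
  have red: "ninv (track (mid_word dg D U (L @ [c]))) = length (mid_word dg D U (L @ [c]))" by (rule snoc.prems)
  show "track (mid_word dg D U (L @ [c])) \<in> Inv n \<and> run n e (word_of D (L @ [c])) (track (mid_word dg D U (L @ [c])))"
  proof (cases "c \<in> D")
    case False
    then have "c \<notin> U" using snoc.prems(3) by auto
    then have w: "mid_word dg D U (L @ [c]) = mid_word dg D U L" "word_of D (L @ [c]) = word_of D L"
      using False by (simp_all add: mid_word_snoc word_of_append word_of_Cons)
    show ?thesis unfolding w t_def[symmetric] using ih red w t_def by simp
  next
    case True
    have word: "word_of D (L @ [c]) = word_of D L @ [?k]" using True by (simp add: word_of_append word_of_Cons)
    have fin: ?thesis if "ninv t = length (mid_word dg D U L)" "t ?k < t (Suc ?k)"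
      "track (mid_word dg D U (L @ [c])) = tw ?k t"
    proof -
      have t: "t \<in> Inv n" "run n e (word_of D L) t" using ih that by auto
      show ?thesis unfolding that(3) word run_snoc tw_tw
        using t tw_Inv[OF t(1) k] tw_asc(1)[OF t(1) that(2)] by simp
    qed
    have invs: "finite (invs t)"
      unfolding t_def track_def by (rule ninv_word_prod_aux[THEN conjunct1])
    have asc_desc: "t ?k < t (Suc ?k) \<or> t (Suc ?k) < t ?k" using bij_asc_or_desc bij_track t_def by metis
    show ?thesis
    proof (cases "c \<in> U")
      case cU: True
      then have w: "mid_word dg D U (L @ [c]) = ?k # mid_word dg D U L @ [?k]" using True by (simp add: mid_word_snoc)
      have tr: "track (mid_word dg D U (L @ [c])) = adj ?k \<circ> t \<circ> adj ?k"
        unfolding w t_def by (simp only: append_Cons[symmetric] track_snoc track_Cons comp_assoc)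
      have tr2: "adj ?k \<circ> t \<circ> adj ?k = word_prod (?k # rev (mid_word dg D U L) @ [?k])"
        unfolding t_def track_def by (simp add: word_prod_append comp_assoc)
      have nn: "ninv (adj ?k \<circ> t \<circ> adj ?k) = Suc (Suc (length (mid_word dg D U L)))"
        using red[unfolded tr] w by (simp del: comp_apply)
      have "set (mid_word dg D U L) \<subseteq> {1..<n}"
        using e(4) snoc.prems(2) cell_letter_range unfolding mid_word_def word_of_def by auto
      then have tS: "t \<in> Sym n" unfolding t_def by (rule track_Sym)
      have ad: "ninv (adj ?k \<circ> v) \<le> Suc (ninv v)" if "v \<in> Sym n" for v
        using ninv_comp_le[OF adj_Sym[OF k] that] by (simp add: ninv_adj del: comp_apply)
      \<comment> \<open>The left letter adds at most one inversion, so the right one must already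
        have added one to \<open>t\<close>.\<close>
      have "ninv (adj ?k \<circ> (t \<circ> adj ?k)) \<le> Suc (ninv (t \<circ> adj ?k))"
        using tS k by (intro ad) (simp add: comp_adj_Sym_iff)
      then have n3: "Suc (length (mid_word dg D U L)) \<le> ninv (t \<circ> adj ?k)" using nn by (simp only: comp_assoc)
      have asc: "t ?k < t (Suc ?k)"
      proof (rule ccontr)
        assume "\<not> t ?k < t (Suc ?k)"
        then have "ninv t = Suc (ninv (t \<circ> adj ?k))" using asc_desc ninv_desc_gen[OF invs] by blast
        then show False using n3 le by simp
      qed
      then have nt: "ninv t = length (mid_word dg D U L)" using n3 le ninv_asc_gen[OF invs asc] by simp
      \<comment> \<open>Equality would leave the length unchanged, but it has grown by two.\<close>
      have "adj ?k \<circ> t \<circ> adj ?k \<noteq> t"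
      proof
        assume "adj ?k \<circ> t \<circ> adj ?k = t"
        then show False using nn unfolding nt[symmetric] by (simp del: comp_apply)
      qed
      then show ?thesis using fin[OF nt asc] tr tw_move by metis
    next
      case cU: False
      then have w: "mid_word dg D U (L @ [c]) = ?k # mid_word dg D U L" using True by (simp add: mid_word_snoc)
      have tr: "track (mid_word dg D U (L @ [c])) = t \<circ> adj ?k"
        unfolding w t_def track_Cons ..
      have nn: "ninv (t \<circ> adj ?k) = Suc (length (mid_word dg D U L))"
        using red[unfolded tr] w by (simp del: comp_apply)
      have asc: "t ?k < t (Suc ?k)"
      proof (rule ccontr)
        assume "\<not> t ?k < t (Suc ?k)"
        then have "ninv t = Suc (ninv (t \<circ> adj ?k))" using asc_desc ninv_desc_gen[OF invs] by blast
        then show False using nn le by simp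
      qed
      then have nt: "ninv t = length (mid_word dg D U L)" using nn ninv_asc_gen[OF invs asc] by simp
      \<comment> \<open>Here condition (2) of almost-symmetry enters: a pair of tracks preserved at
        an ascent means that the letter commutes with \<open>t\<close>.\<close>
      have "t ` {?k, Suc ?k} = {?k, Suc ?k}" using snoc.prems(4) True cU by (simp add: mid_ok_snoc t_def)
      then have "adj ?k \<circ> t \<circ> adj ?k = t" using asc_conj_eq(1)[OF conjunct1[OF ih[OF nt]] asc] by simp
      then show ?thesis using fin[OF nt asc] tr tw_fix by metis
    qed
  qed
qed

text \<open>Without fixed points no ascent commutes, so every crossing is mirrored and
  \<open>U\<close> equals \<open>D\<close>.\<close>

lemma run_FPF_imp_mid:
  assumes "e \<in> Inv_FPF n" "distinct L" "set L \<subseteq> triangle n" "run n e (word_of D L) y"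
  shows "y \<in> Inv_FPF n \<and> track (mid_word dg D D L) = y \<and> ninv y = length (mid_word dg D D L)"
  using assms(2-)
proof (induction L arbitrary: y rule: rev_induct)
  case Nil
  then show ?case using e assms(1) by simp
next
  case (snoc c L)
  let ?k = "cell_letter c"
  have L: "distinct L" "set L \<subseteq> triangle n" using snoc.prems by auto
  have k: "?k \<in> {1..<n}" using snoc.prems(2) by (intro cell_letter_range) auto
  show ?case
  proof (cases "c \<in> D")
    case False
    then show ?thesis using snoc.prems(3) snoc.IH[OF L] by (simp add: word_of_append word_of_Cons mid_word_snoc)
  next
    case True
    have "run n e (word_of D L @ [?k]) y" using True snoc.prems(3) by (simp add: word_of_append word_of_Cons)
    then have y: "y \<in> Inv n" "y (Suc ?k) < y ?k" "run n e (word_of D L) (tw ?k y)" by (simp_all add: run_snoc)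
    define t where "t = tw ?k y"
    have ih: "t \<in> Inv_FPF n" "track (mid_word dg D D L) = t" "ninv t = length (mid_word dg D D L)"
      using snoc.IH[OF L y(3)] t_def by auto
    have asc: "t ?k < t (Suc ?k)" unfolding t_def using tw_desc(1)[OF y(1) k y(2)] .
    have yt: "y = adj ?k \<circ> t \<circ> adj ?k" using FPF_asc(2)[OF ih(1) k asc] by (simp only: t_def tw_tw)
    have w: "mid_word dg D D (L @ [c]) = ?k # mid_word dg D D L @ [?k]" using True by (simp add: mid_word_snoc)
    have "track (mid_word dg D D (L @ [c])) = y"
      unfolding w yt by (simp only: append_Cons[symmetric] track_snoc track_Cons ih(2) comp_assoc)
    moreover have "ninv y = length (mid_word dg D D (L @ [c]))"
      unfolding w yt ninv_conj_asc[OF Inv_FPF_Inv[OF ih(1)] asc FPF_asc(1)[OF ih(1) k asc]] using ih(3) by simp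
    moreover have "y \<in> Inv_FPF n" unfolding yt by (rule conj_FPF[OF ih(1) k])
    ultimately show ?thesis by blast
  qed
qed

end

text \<open>Each letter meets two fixed points of the product so far, so \<open>tw\<close> is mere
  multiplication. The diagonal letters can thus serve both as the start of an involution word and as
  the middle of \<open>mid_word\<close>.\<close>

lemma run_sparse:
  assumes "sorted_wrt (\<lambda>a b. Suc a < b) ks" "set ks \<subseteq> {1..<n}"
  shows "track ks \<in> Inv n \<and> ninv (track ks) = length ks \<and> (\<forall>y. run n id (ks @ ls) y \<longleftrightarrow> run n (track ks) ls y)"
  using assms
proof (induction ks arbitrary: ls rule: rev_induct)
  case Nil
  show "track [] \<in> Inv n \<and> ninv (track []) = length [] \<and> (\<forall>y. run n id ([] @ ls) y \<longleftrightarrow> run n (track []) ls y)"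
    by simp
next
  case (snoc k ks)
  have prem: "sorted_wrt (\<lambda>a b. Suc a < b) ks" "set ks \<subseteq> {1..<n}" "k \<in> {1..<n}" "\<And>a. a \<in> set ks \<Longrightarrow> Suc a < k"
    using snoc.prems by (auto simp: sorted_wrt_append)
  have ih0: "track ks \<in> Inv n \<and> ninv (track ks) = length ks \<and>
      (\<forall>y. run n id (ks @ ls) y \<longleftrightarrow> run n (track ks) ls y)" for ls
    by (rule snoc.IH[OF prem(1,2)])
  have ih: "track ks \<in> Inv n" "ninv (track ks) = length ks" using ih0 by blast+
  have ih3: "run n id (ks @ ls) y \<longleftrightarrow> run n (track ks) ls y" for y ls using ih0 by simp
  have f: "track ks k = k" "track ks (Suc k) = Suc k"
    using prem(4) by (fastforce intro!: track_fix)+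
  then have asc: "track ks k < track ks (Suc k)" by simp
  have com: "adj k \<circ> track ks \<circ> adj k = track ks" using asc_conj_eq(2)[OF ih(1) asc] f by simp
  then have "track (ks @ [k]) = track ks \<circ> adj k" unfolding track_snoc conj_eq_comm .
  moreover have "tw k (track ks) = track ks \<circ> adj k" using tw_fix[OF com] .
  ultimately have t: "track (ks @ [k]) = tw k (track ks)" by simp
  have I: "tw k (track ks) \<in> Inv n" using tw_Inv[OF ih(1) prem(3)] .
  have n: "ninv (tw k (track ks)) = length (ks @ [k])"
    using ninv_asc[OF Inv_Sym[OF ih(1)] asc] ih(2) tw_fix[OF com] by simp
  have single: "run n (track ks) [k] y \<longleftrightarrow> y = tw k (track ks)" for y
    using run_snoc[of n "track ks" "[]" k y] I tw_asc(1)[OF ih(1) asc] tw_tw by (metis append_Nil run_Nil)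
  \<comment> \<open>\<open>run\<close> unfolds from the last letter, so removing the first one takes
    an induction on the rest.\<close>
  have "run n (track ks) (k # ls) y \<longleftrightarrow> run n (tw k (track ks)) ls y" for y
  proof (induction ls arbitrary: y rule: rev_induct)
    case Nil
    then show ?case using single by simp
  next
    case (snoc l ls)
    then show ?case using run_snoc[of n "track ks" "k # ls" l y] by (simp add: run_snoc)
  qed
  then show "track (ks @ [k]) \<in> Inv n \<and> ninv (track (ks @ [k])) = length (ks @ [k]) \<and>
      (\<forall>y. run n id ((ks @ [k]) @ ls) y \<longleftrightarrow> run n (track (ks @ [k])) ls y)"
    unfolding t using I n ih3[of "k # ls"] by simp
qed

section \<open>Symmetry conditions in terms of words\<close>

abbreviation mirror :: "(nat \<times> nat) set \<Rightarrow> (nat \<times> nat) set" where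
  "mirror D \<equiv> {c. prod.swap c \<in> D}"

abbreviation diag_word :: "nat \<Rightarrow> (nat \<times> nat) set \<Rightarrow> nat list" where
  "diag_word n D \<equiv> word_of D (content_cells n 0)"

lemma cell_letter_swap [simp]: "cell_letter (prod.swap c) = cell_letter c"
  by (simp add: cell_letter_def add.commute)

lemma word_of_rev: "word_of D (rev L) = rev (word_of D L)"
  by (simp add: word_of_def rev_map rev_filter)

lemma word_of_swap: "word_of D (map prod.swap L) = word_of (mirror D) L"
  by (simp add: word_of_def filter_map comp_def)

lemma word_of_all_cells:
  "word_of D (all_cells n) = mid_word (diag_word n D) D (mirror D) (lower_cells n False)"
  by (simp add: all_cells_def mid_word_def word_of_append word_of_rev word_of_swap)

lemma diag_word_sparse: "sorted_wrt (\<lambda>a b. Suc a < b) (diag_word n D)"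
proof -
  have "sorted_wrt (\<lambda>x y. fst x = snd x \<and> fst y = snd y \<and> 1 \<le> fst x \<and> fst x < fst y) (content_cells n 0)"
    unfolding content_cells_def sorted_wrt_map
    by (rule sorted_wrt_mono_rel[OF _ sorted_wrt_filter[OF sorted_wrt_upt]])
      auto
  from sorted_wrt_filter[OF this, of "\<lambda>c. c \<in> D"] show ?thesis
    unfolding word_of_def sorted_wrt_map
    by (rule sorted_wrt_mono_rel[rotated]) (auto simp: cell_letter_def)
qed

lemma diag_word_subset: "set (diag_word n D) \<subseteq> {1..<n}"
  by (auto simp: word_of_def set_content_cells cell_letter_def)

lemma diag_word_facts:
  "track (diag_word n D) \<in> Inv n" "ninv (track (diag_word n D)) = length (diag_word n D)"
  "run n id (diag_word n D @ ls) y \<longleftrightarrow> run n (track (diag_word n D)) ls y"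
  using run_sparse[OF diag_word_sparse diag_word_subset] by auto

lemma lower_subset_triangle: "set (lower_cells n g) \<subseteq> triangle n"
  by (auto simp: set_lower_cells triangle_iff)

text \<open>The crossing at \<open>c\<close> only exchanges its two pipes on the tracks of
  \<open>c\<close>. They face each other again at the mirror cell, which has the same tracks, iff
  the word read in between maps this pair of tracks to itself.\<close>

lemma almost_symmetric_cell:
  assumes D: "D \<subseteq> triangle n" and split: "lower_cells n False = L1 @ c # L2"
    and c: "c \<in> D" "prod.swap c \<notin> D"
  shows "(\<forall>p\<in>{1..n}. \<forall>q\<in>{1..n}. cross_at n D p q c \<longrightarrow> avoid_at n D p q (prod.swap c)) \<longleftrightarrow>
    track (mid_word (diag_word n D) D (mirror D) L1) ` {cell_letter c, Suc (cell_letter c)} = {cell_letter c, Suc (cell_letter c)}"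
proof -
  let ?k = "cell_letter c"
  define T where "T = track (mid_word (diag_word n D) D (mirror D) L1)"
  define g where "g = track (word_of D (rev L2))"
  let ?W = "rev L1 @ content_cells n 0 @ map prod.swap L1"
  \<comment> \<open>The same list is split at \<open>c\<close> and at its mirror image;
    \<open>?W\<close> is what is read between them.\<close>
  have a1: "all_cells n = rev L2 @ c # (?W @ prod.swap c # map prod.swap L2)"
    unfolding all_cells_def split by simp
  have a2: "all_cells n = (rev L2 @ c # ?W) @ prod.swap c # map prod.swap L2"
    unfolding all_cells_def split by simp
  have "word_of D ?W = mid_word (diag_word n D) D (mirror D) L1"
    by (simp add: mid_word_def word_of_append word_of_rev word_of_swap)
  then have w2: "track (word_of D (rev L2 @ c # ?W)) = T \<circ> adj ?k \<circ> g"
    using c(1) unfolding T_def g_def by (simp add: word_of_append[of D "rev L2"] word_of_Cons track_append track_Cons comp_assoc)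
  have cell: "(cross_at n D p q c \<longrightarrow> avoid_at n D p q (prod.swap c)) \<longleftrightarrow>
      ({g p, g q} = {?k, Suc ?k} \<longrightarrow> T ` {adj ?k (g p), adj ?k (g q)} = {?k, Suc ?k})"
    if "1 \<le> p" "1 \<le> q" for p q
    using crossing_pair_iff(1)[OF a1 that, of D] crossing_pair_iff(2)[OF a2 that, of D] c unfolding w2 g_def[symmetric]
    by simp
  have gS: "g \<in> Sym n"
    unfolding g_def by (rule track_Sym) (use D cell_letter_range in \<open>auto simp: word_of_def\<close>)
  have ctri: "c \<in> triangle n" using c D by blast
  define p0 q0 where "p0 = inv g ?k" and "q0 = inv g (Suc ?k)"
  have pq: "p0 \<in> {1..n}" "q0 \<in> {1..n}" unfolding p0_def q0_def
    using Sym_in[OF inv_Sym[OF gS], of ?k] Sym_in[OF inv_Sym[OF gS], of "Suc ?k"] cell_letter_range[OF ctri] by auto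
  have g0: "g p0 = ?k" "g q0 = Suc ?k" unfolding p0_def q0_def
    using bij_Sym[OF gS] by (simp_all add: bij_is_surj surj_f_inv_f)
  show ?thesis
    unfolding T_def[symmetric]
  proof
    assume "\<forall>p\<in>{1..n}. \<forall>q\<in>{1..n}. cross_at n D p q c \<longrightarrow> avoid_at n D p q (prod.swap c)"
    then have "cross_at n D p0 q0 c \<longrightarrow> avoid_at n D p0 q0 (prod.swap c)" using pq by blast
    moreover have "1 \<le> p0" "1 \<le> q0" using pq by auto
    ultimately have "{g p0, g q0} = {?k, Suc ?k} \<longrightarrow> T ` {adj ?k (g p0), adj ?k (g q0)} = {?k, Suc ?k}"
      by (subst (asm) cell)
    moreover have "{g p0, g q0} = {?k, Suc ?k}" unfolding g0 by (rule refl)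
    ultimately have "T ` {adj ?k (g p0), adj ?k (g q0)} = {?k, Suc ?k}" by (rule mp)
    then show "T ` {?k, Suc ?k} = {?k, Suc ?k}" using g0 by (simp add: insert_commute)
  next
    assume T: "T ` {?k, Suc ?k} = {?k, Suc ?k}"
    show "\<forall>p\<in>{1..n}. \<forall>q\<in>{1..n}. cross_at n D p q c \<longrightarrow> avoid_at n D p q (prod.swap c)"
    proof (intro ballI)
      fix p q assume pq: "p \<in> {1..n}" "q \<in> {1..n}"
      have "T ` {adj ?k (g p), adj ?k (g q)} = {?k, Suc ?k}" if "{g p, g q} = {?k, Suc ?k}"
      proof -
        have "{adj ?k (g p), adj ?k (g q)} = adj ?k ` {g p, g q}" by simp
        also have "\<dots> = {?k, Suc ?k}" unfolding that by (simp add: insert_commute)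
        finally show ?thesis using T by simp
      qed
      then show "cross_at n D p q c \<longrightarrow> avoid_at n D p q (prod.swap c)" using cell[of p q] pq by simp
    qed
  qed
qed

lemma almost_symmetric_iff:
  assumes D: "D \<subseteq> triangle n"
  shows "almost_symmetric n D \<longleftrightarrow> mirror D \<inter> set (lower_cells n False) \<subseteq> D \<and>
    mid_ok (diag_word n D) D (mirror D) (lower_cells n False)"
proof -
  let ?L = "lower_cells n False"
  have lower: "(j, i) \<in> set ?L \<longleftrightarrow> i < j \<and> (j, i) \<in> triangle n" for i j
    by (auto simp: set_lower_cells triangle_iff)
  have tri_swap: "(i, j) \<in> triangle n \<longleftrightarrow> (j, i) \<in> triangle n" for i j by (auto simp: triangle_iff)
  have 1: "(\<forall>i j. i < j \<longrightarrow> (i, j) \<in> D \<longrightarrow> (j, i) \<in> D) \<longleftrightarrow> mirror D \<inter> set ?L \<subseteq> D"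
  proof
    assume a: "\<forall>i j. i < j \<longrightarrow> (i, j) \<in> D \<longrightarrow> (j, i) \<in> D"
    show "mirror D \<inter> set ?L \<subseteq> D"
    proof
      fix c assume c: "c \<in> mirror D \<inter> set ?L"
      obtain j i where "c = (j, i)" by (cases c)
      then show "c \<in> D" using a c lower[of j i] by auto
    qed
  next
    assume a: "mirror D \<inter> set ?L \<subseteq> D"
    show "\<forall>i j. i < j \<longrightarrow> (i, j) \<in> D \<longrightarrow> (j, i) \<in> D"
    proof (intro allI impI)
      fix i j assume "i < j" "(i, j) \<in> D"
      then have "(j, i) \<in> mirror D \<inter> set ?L" using D lower[of j i] tri_swap[of i j] by auto
      then show "(j, i) \<in> D" using a by blast
    qed
  qed
  have 2: "(\<forall>i j. i < j \<longrightarrow> (j, i) \<in> D \<longrightarrow> (i, j) \<notin> D \<longrightarrow>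
      (\<forall>p\<in>{1..n}. \<forall>q\<in>{1..n}. cross_at n D p q (j, i) \<longrightarrow> avoid_at n D p q (i, j))) \<longleftrightarrow>
      mid_ok (diag_word n D) D (mirror D) ?L"
  proof
    assume a: "\<forall>i j. i < j \<longrightarrow> (j, i) \<in> D \<longrightarrow> (i, j) \<notin> D \<longrightarrow>
      (\<forall>p\<in>{1..n}. \<forall>q\<in>{1..n}. cross_at n D p q (j, i) \<longrightarrow> avoid_at n D p q (i, j))"
    show "mid_ok (diag_word n D) D (mirror D) ?L"
      unfolding mid_ok_def
    proof (intro allI impI)
      fix L1 c L2 assume s: "?L = L1 @ c # L2" and c: "c \<in> D" "c \<notin> mirror D"
      obtain j i where ij: "c = (j, i)" by (cases c)
      have "c \<in> set ?L" unfolding s by simp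
      then have "i < j" using lower ij by simp
      then have "\<forall>p\<in>{1..n}. \<forall>q\<in>{1..n}. cross_at n D p q c \<longrightarrow> avoid_at n D p q (prod.swap c)"
        using a c unfolding ij by simp
      then show "track (mid_word (diag_word n D) D (mirror D) L1) ` {cell_letter c, Suc (cell_letter c)} =
          {cell_letter c, Suc (cell_letter c)}"
        using almost_symmetric_cell[OF D s c(1)] c(2) by simp
    qed
  next
    assume ok: "mid_ok (diag_word n D) D (mirror D) ?L"
    show "\<forall>i j. i < j \<longrightarrow> (j, i) \<in> D \<longrightarrow> (i, j) \<notin> D \<longrightarrow>
      (\<forall>p\<in>{1..n}. \<forall>q\<in>{1..n}. cross_at n D p q (j, i) \<longrightarrow> avoid_at n D p q (i, j))"
    proof (intro allI impI)
      fix i j assume ij: "i < j" "(j, i) \<in> D" "(i, j) \<notin> D"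
      then have "(j, i) \<in> set ?L" using lower D by blast
      then obtain L1 L2 where s: "?L = L1 @ (j, i) # L2" by (meson split_list)
      have "track (mid_word (diag_word n D) D (mirror D) L1) ` {cell_letter (j, i), Suc (cell_letter (j, i))} =
          {cell_letter (j, i), Suc (cell_letter (j, i))}"
        using ok s ij unfolding mid_ok_def by simp
      then show "\<forall>p\<in>{1..n}. \<forall>q\<in>{1..n}. cross_at n D p q (j, i) \<longrightarrow> avoid_at n D p q (i, j)"
        using almost_symmetric_cell[OF D s ij(2)] ij(3) by simp
    qed
  qed
  show ?thesis unfolding almost_symmetric_def 1 2 ..
qed

section \<open>Lower halves and involution words\<close>

lemma lower_restrict:
  assumes "D \<subseteq> triangle n"
  shows "D \<inter> {(j, i). j \<in> {1..n} \<and> i \<in> {1..n} \<and> i \<le> j} = D \<inter> set (lower_cells n True)"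
    and "D \<inter> {(j, i). j \<in> {1..n} \<and> i \<in> {1..n} \<and> i < j} = D \<inter> set (lower_cells n False)"
  using assms by (auto simp: set_lower_cells triangle_iff)

lemma strict_lower_subset: "set (lower_cells n False) \<subseteq> set (lower_cells n True)"
  by (auto simp: set_lower_cells)

lemma diag_subset: "set (content_cells n 0) \<subseteq> set (lower_cells n True)"
  by (auto simp: set_lower_cells set_content_cells)

lemma swap_lower_notin: "c \<in> set (lower_cells n False) \<Longrightarrow> prod.swap c \<notin> set (lower_cells n True)"
  by (cases c) (simp add: set_lower_cells)

text \<open>From left to right, \<open>mid_imp_run\<close> reads off the run. Conversely
  \<open>run_imp_mid\<close> supplies the set \<open>U\<close> of crossings to be mirrored above the
  diagonal, and the diagonal part of the half is kept.\<close>

lemma ID_eq: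
  assumes n: "1 \<le> n" and y: "y \<in> Inv n"
  shows "ID n y = {D. D \<subseteq> set (lower_cells n True) \<and> run n id (word_of D (lower_cells n True)) y}"
proof -
  let ?L = "lower_cells n False" and ?D0 = "content_cells n 0"
  have yS: "y \<in> Sym n" using y by (rule Inv_Sym)
  have LT: "lower_cells n True = ?D0 @ ?L" using n by (rule lower_cells_True)
  have runs: "run n id (word_of D (lower_cells n True)) y \<longleftrightarrow> run n (track (diag_word n D)) (word_of D ?L) y" for D
    unfolding LT word_of_append by (rule diag_word_facts(3))
  note ctx = refl diag_word_facts(1) diag_word_facts(2) diag_word_subset
  show ?thesis
  proof (intro equalityI subsetI)
    fix E assume "E \<in> ID n y"
    then obtain D where D: "D \<in> PD n y" "almost_symmetric n D"
      and E: "E = D \<inter> {(j, i). j \<in> {1..n} \<and> i \<in> {1..n} \<and> i \<le> j}"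
      unfolding ID_def by blast
    have pd: "D \<subseteq> triangle n" "track (mid_word (diag_word n D) D (mirror D) ?L) = y"
      "ninv y = length (mid_word (diag_word n D) D (mirror D) ?L)"
      using D(1) unfolding PD_iff[OF yS] word_of_all_cells by auto
    have E': "E = D \<inter> set (lower_cells n True)" unfolding E by (rule lower_restrict[OF pd(1)])
    have as: "mirror D \<inter> set ?L \<subseteq> D" "mid_ok (diag_word n D) D (mirror D) ?L"
      using D(2) almost_symmetric_iff[OF pd(1)] by auto
    have "run n (track (diag_word n D)) (word_of D ?L) y"
      using mid_imp_run[OF ctx distinct_lower_cells lower_subset_triangle as] pd by metis
    then have "run n id (word_of D (lower_cells n True)) y" using runs by simp
    moreover have "word_of E (lower_cells n True) = word_of D (lower_cells n True)"
      unfolding E' by (rule word_of_cong) simp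
    ultimately show "E \<in> {D. D \<subseteq> set (lower_cells n True) \<and> run n id (word_of D (lower_cells n True)) y}"
      using E' by simp
  next
    fix E assume "E \<in> {D. D \<subseteq> set (lower_cells n True) \<and> run n id (word_of D (lower_cells n True)) y}"
    then have E: "E \<subseteq> set (lower_cells n True)" "run n (track (diag_word n E)) (word_of E ?L) y"
      using runs by auto
    obtain U where U: "U \<subseteq> E \<inter> set ?L" "track (mid_word (diag_word n E) E U ?L) = y"
      "ninv y = length (mid_word (diag_word n E) E U ?L)" "mid_ok (diag_word n E) E U ?L"
      using run_imp_mid[OF ctx distinct_lower_cells lower_subset_triangle E(2)] by blast
    define D where "D = E \<union> prod.swap ` U"
    have tri: "D \<subseteq> triangle n"
    proof -
      have "prod.swap c \<in> triangle n" if "c \<in> set ?L" for c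
        by (cases c) (use that in \<open>auto simp: set_lower_cells triangle_iff\<close>)
      then show ?thesis unfolding D_def using E(1) U(1) lower_subset_triangle by blast
    qed
    have low: "c \<in> D \<longleftrightarrow> c \<in> E" if "c \<in> set (lower_cells n True)" for c
    proof -
      have "c \<notin> prod.swap ` U" using that U(1) swap_lower_notin[of _ n] by auto
      then show ?thesis by (simp add: D_def)
    qed
    have up: "c \<in> mirror D \<longleftrightarrow> c \<in> U" if "c \<in> set ?L" for c
    proof -
      have "prod.swap c \<notin> E" using swap_lower_notin[OF that] E(1) by blast
      then show ?thesis by (cases c) (simp add: D_def pair_in_swap_image)
    qed
    have dg: "diag_word n D = diag_word n E" by (rule word_of_cong) (use low diag_subset in blast)
    have lowL: "c \<in> D \<longleftrightarrow> c \<in> E" if "c \<in> set ?L" for c using low that strict_lower_subset by blast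
    have w: "mid_word (diag_word n E) D (mirror D) ?L = mid_word (diag_word n E) E U ?L"
      "mid_ok (diag_word n E) D (mirror D) ?L \<longleftrightarrow> mid_ok (diag_word n E) E U ?L"
      using mid_ok_cong[of ?L D E "mirror D" U] lowL up by blast+
    have "D \<in> PD n y" unfolding PD_iff[OF yS] word_of_all_cells dg w using tri U by simp
    moreover have "mirror D \<inter> set ?L \<subseteq> D" using up U(1) by (auto simp: D_def)
    then have "almost_symmetric n D" unfolding almost_symmetric_iff[OF tri] dg w using U(4) by simp
    moreover have "E = D \<inter> {(j, i). j \<in> {1..n} \<and> i \<in> {1..n} \<and> i \<le> j}"
      unfolding lower_restrict(1)[OF tri] using low E(1) by blast
    ultimately show "E \<in> ID n y" unfolding ID_def by blast
  qed
qed

lemma track_word_prod: "track ks \<circ> word_prod ks = id"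
proof (induction ks)
  case Nil
  show "track [] \<circ> word_prod [] = id" by simp
next
  case (Cons k ks)
  have ih: "track ks \<circ> word_prod ks = id" by (rule Cons.IH)
  show "track (k # ks) \<circ> word_prod (k # ks) = id"
    unfolding track_Cons word_prod_Cons using ih by (simp only: comp_assoc adj_adj_comp)
qed

lemma map_letter_diag: "map cell_letter (content_cells (2 * m) 0) = filter odd [1..<2 * m]"
proof -
  have 1: "filter odd [1..<2 * m] = map (\<lambda>i. 2 * i - 1) [1..<Suc m]"
  proof (induction m)
    case (Suc m)
    then show ?case unfolding filter_odd_upt by simp
  qed simp
  have 2: "filter (\<lambda>i. 2 * i + 0 \<le> 2 * m) [1..<2 * m] = [1..<Suc m]"
  proof (cases "m = 0")
    case False
    have "filter (\<lambda>i. 0 + i \<le> m) [1..<2 * m] = [1..<min (2 * m) (Suc m - 0)]" by (rule filter_le_upt)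
    also have "min (2 * m) (Suc m - 0) = Suc m" using False by simp
    finally show ?thesis by simp
  qed simp
  show ?thesis unfolding content_cells_def 2 1 by (simp add: cell_letter_def mult_2)
qed

lemma diag_word_full:
  assumes "even n" "set (content_cells n 0) \<subseteq> D"
  shows "diag_word n D = filter odd [1..<n]" "track (diag_word n D) = one_FPF n"
proof -
  obtain m where m: "n = 2 * m" using assms(1) by blast
  have "filter (\<lambda>c. c \<in> D) (content_cells n 0) = content_cells n 0"
    using assms(2) by (auto simp: filter_id_conv)
  then show d: "diag_word n D = filter odd [1..<n]"
    using map_letter_diag[of m] unfolding word_of_def m by simp
  let ?t = "track (diag_word n D)"
  have "?t \<circ> word_prod (diag_word n D) = id" by (rule track_word_prod)
  \<comment> \<open>\<open>track\<close> multiplies the letters in reverse order and so gives the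
    inverse of \<open>word_prod\<close>; for an involution the two coincide.\<close>
  moreover have "?t \<circ> ?t = id" using Inv_invol[OF diag_word_facts(1), of D n] by (simp add: fun_eq_iff)
  ultimately have "?t \<circ> word_prod (diag_word n D) = ?t \<circ> ?t" by simp
  then have "word_prod (diag_word n D) = ?t" by (metis \<open>?t \<circ> ?t = id\<close> comp_assoc id_comp)
  then show "?t = one_FPF n" unfolding d one_FPF_def by simp
qed

text \<open>A symmetric word exhibits \<open>z\<close> as a conjugate of its diagonal part. A
  missing diagonal cell would leave its letter fixed by that part, and hence give \<open>z\<close> a
  fixed point.\<close>

lemma symmetric_FPF_diag:
  assumes z: "z \<in> Inv_FPF n" and t: "track (mid_word (diag_word n D) D U L) = z"
    and L: "set L \<subseteq> triangle n" and DU: "\<And>c. c \<in> set L \<Longrightarrow> c \<in> U \<longleftrightarrow> c \<in> D"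
  shows "set (content_cells n 0) \<subseteq> D"
proof (rule subsetI, rule ccontr)
  fix c assume c: "c \<in> set (content_cells n 0)" "c \<notin> D"
  let ?w = "word_of D L" and ?k = "cell_letter c"
  have "word_of U L = ?w" by (rule word_of_cong) (use DU in blast)
  then have zw: "z = track ?w \<circ> track (diag_word n D) \<circ> track (rev ?w)"
    using t by (simp add: mid_word_def track_append comp_assoc)
  have wS: "track ?w \<in> Sym n" by (rule track_Sym) (use L cell_letter_range in \<open>auto simp: word_of_def\<close>)
  have rw: "track (rev ?w) = word_prod ?w" by (simp add: track_def)
  have inv1: "word_prod ?w (track ?w i) = i" for i
  proof -
    have "track ?w (word_prod ?w (track ?w i)) = track ?w i"
      using fun_cong[OF track_word_prod[of ?w], of "track ?w i"] by simp
    then show ?thesis by (simp only: track_eq_iff)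
  qed
  have k: "?k \<in> {1..n}" by (cases c) (use c(1) in \<open>auto simp: set_content_cells cell_letter_def\<close>)
  have fix_k: "track (diag_word n D) ?k = ?k"
  proof (rule track_fix)
    fix l assume "l \<in> set (diag_word n D)"
    then obtain x where x: "x \<in> set (content_cells n 0)" "x \<in> D" "l = cell_letter x" by (auto simp: word_of_def)
    obtain a b i j where "x = (a, b)" "c = (i, j)" by (cases x; cases c)
    then have xc: "x = (b, b)" "c = (j, j)" "1 \<le> b" "1 \<le> j"
      using x c by (auto simp: set_content_cells)
    then have "b \<noteq> j" using x(2) c(2) by auto
    then have "b + b \<noteq> j + j" "b + b \<noteq> Suc (j + j)" "Suc (b + b) \<noteq> j + j" by presburger+
    then show "?k \<noteq> l \<and> ?k \<noteq> Suc l" using xc x(3) by (auto simp: cell_letter_def)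
  qed
  have "z (track ?w ?k) = track ?w ?k" unfolding zw rw using inv1 fix_k by simp
  moreover have "track ?w ?k \<in> {1..n}" using Sym_in[OF wS k] .
  ultimately show False using Inv_FPF_neq[OF z] by blast
qed

text \<open>All diagonal cells belong to \<open>D\<close>, so their word is that of
  \<open>one_FPF n\<close> and runs start there. The diagonal carries no information, which is why
  \<open>FD\<close> records cells strictly below it.\<close>

lemma FD_eq:
  assumes z: "z \<in> Inv_FPF n"
  shows "FD n z = {D. D \<subseteq> set (lower_cells n False) \<and> run n (one_FPF n) (word_of D (lower_cells n False)) z}"
proof -
  let ?L = "lower_cells n False"
  have zS: "z \<in> Sym n" using z by (intro Inv_Sym Inv_FPF_Inv)
  have n: "even n" using z by (rule Inv_FPF_even)
  note ctx = refl diag_word_facts(1) diag_word_facts(2) diag_word_subset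
  show ?thesis
  proof (intro equalityI subsetI)
    fix E assume "E \<in> FD n z"
    then obtain D where D: "D \<in> PD n z" "symmetric D"
      and E: "E = D \<inter> {(j, i). j \<in> {1..n} \<and> i \<in> {1..n} \<and> i < j}"
      unfolding FD_def by blast
    have pd: "D \<subseteq> triangle n" "track (mid_word (diag_word n D) D (mirror D) ?L) = z"
      "ninv z = length (mid_word (diag_word n D) D (mirror D) ?L)"
      using D(1) unfolding PD_iff[OF zS] word_of_all_cells by auto
    have E': "E = D \<inter> set ?L" unfolding E by (rule lower_restrict[OF pd(1)])
    have sym: "c \<in> mirror D \<longleftrightarrow> c \<in> D" for c using D(2) unfolding symmetric_def by (cases c) auto
    have ok: "mid_ok (diag_word n D) D (mirror D) ?L" unfolding mid_ok_def using sym by blast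
    have "set (content_cells n 0) \<subseteq> D"
      by (rule symmetric_FPF_diag[OF z pd(2) lower_subset_triangle sym])
    then have e: "track (diag_word n D) = one_FPF n" by (rule diag_word_full[OF n])
    have "mirror D \<inter> set ?L \<subseteq> D" using sym by blast
    from mid_imp_run[OF ctx distinct_lower_cells lower_subset_triangle this ok] pd
    have "run n (track (diag_word n D)) (word_of D ?L) z" by metis
    then have "run n (one_FPF n) (word_of D ?L) z" unfolding e .
    moreover have "word_of E ?L = word_of D ?L" unfolding E' by (rule word_of_cong) simp
    ultimately show "E \<in> {D. D \<subseteq> set ?L \<and> run n (one_FPF n) (word_of D ?L) z}" using E' by simp
  next
    fix E assume "E \<in> {D. D \<subseteq> set ?L \<and> run n (one_FPF n) (word_of D ?L) z}"
    then have E: "E \<subseteq> set ?L" "run n (one_FPF n) (word_of E ?L) z" by auto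
    define D where "D = E \<union> prod.swap ` E \<union> set (content_cells n 0)"
    have tri: "D \<subseteq> triangle n"
    proof -
      have "prod.swap c \<in> triangle n" if "c \<in> set ?L" for c
        by (cases c) (use that in \<open>auto simp: set_lower_cells triangle_iff\<close>)
      then show ?thesis unfolding D_def using E(1) lower_subset_triangle diag_subset by blast
    qed
    have low: "c \<in> D \<longleftrightarrow> c \<in> E" if "c \<in> set ?L" for c
    proof -
      have "c \<notin> prod.swap ` E" using that E(1) swap_lower_notin[of _ n] strict_lower_subset by fastforce
      moreover have "c \<notin> set (content_cells n 0)"
        by (cases c) (use that in \<open>auto simp: set_lower_cells set_content_cells\<close>)
      ultimately show ?thesis by (simp add: D_def)
    qed
    have swap_in: "prod.swap c \<in> D" if "c \<in> D" for c
      by (cases c) (use that in \<open>auto simp: D_def pair_in_swap_image set_content_cells\<close>)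
    have sym: "c \<in> mirror D \<longleftrightarrow> c \<in> D" for c using swap_in[of c] swap_in[of "prod.swap c"] by auto
    have dg: "set (content_cells n 0) \<subseteq> D" by (auto simp: D_def)
    note e = diag_word_full(2)[OF n dg]
    have wL: "word_of E ?L = word_of D ?L" by (rule word_of_cong) (use low in blast)
    have F: "track (diag_word n D) \<in> Inv_FPF n" unfolding e using n by (rule one_FPF_FPF)
    have "run n (track (diag_word n D)) (word_of D ?L) z" using E(2) unfolding e wL .
    from run_FPF_imp_mid[OF ctx F distinct_lower_cells lower_subset_triangle this]
    have mid: "track (mid_word (diag_word n D) D D ?L) = z" "ninv z = length (mid_word (diag_word n D) D D ?L)" by auto
    have w: "mid_word (diag_word n D) D (mirror D) ?L = mid_word (diag_word n D) D D ?L"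
      by (rule mid_ok_cong(1)) (use sym in auto)
    have "D \<in> PD n z" unfolding PD_iff[OF zS] word_of_all_cells w using tri mid by simp
    moreover have "symmetric D" unfolding symmetric_def using swap_in by fastforce
    moreover have "E = D \<inter> {(j, i). j \<in> {1..n} \<and> i \<in> {1..n} \<and> i < j}"
      unfolding lower_restrict(2)[OF tri] using low E(1) by blast
    ultimately show "E \<in> FD n z" unfolding FD_def by blast
  qed
qed

lemma half_double: "Const (1 / 2) * (X i + X i) = X i"
  by (simp add: Const_def X_def single_add[symmetric] mult_single)

lemma prod_weight:
  assumes "D \<subseteq> set (lower_cells n g)"
  shows "(\<Prod>(i, j)\<in>D. Const (2 powi (- kronecker i j)) * (X i + X j)) = (\<Prod>c\<in>D. cell_weight c)"
proof (rule prod.cong)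
  fix c assume "c \<in> D"
  obtain j i where c: "c = (j, i)" by (cases c)
  have one: "Const 1 = 1" by (simp add: Const_def)
  show "(case c of (i, j) \<Rightarrow> Const (2 powi (- kronecker i j)) * (X i + X j)) = cell_weight c"
    using half_double[of i] one by (simp add: c kronecker_def cell_weight_def add.commute power_int_minus inverse_eq_divide)
qed simp

lemma prod_weight_FPF:
  assumes "D \<subseteq> set (lower_cells n False)"
  shows "(\<Prod>(i, j)\<in>D. X i + X j) = (\<Prod>c\<in>D. cell_weight c)"
  by (rule prod.cong) (use assms in \<open>auto simp: cell_weight_def set_lower_cells add.commute\<close>)

theorem theorem1p5:
  fixes n :: nat
  assumes "n \<ge> 1"
  shows "(\<forall>y\<in>Inv n. inv_schubert n y =
            (\<Sum>D\<in>ID n y. \<Prod>(i, j)\<in>D. Const (2 powi (- kronecker i j)) * (X i + X j)))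
       \<and> (\<forall>z\<in>Inv_FPF n. inv_schubert_FPF n z =
            (\<Sum>D\<in>FD n z. \<Prod>(i, j)\<in>D. X i + X j))"
proof (intro conjI ballI)
  fix y assume y: "y \<in> Inv n"
  show "inv_schubert n y = (\<Sum>D\<in>ID n y. \<Prod>(i, j)\<in>D. Const (2 powi (- kronecker i j)) * (X i + X j))"
    unfolding inv_schubert_eq[OF y] act_Inv_sum ID_eq[OF assms y]
    by (rule sum.cong) (auto simp: prod_weight)
next
  fix z assume z: "z \<in> Inv_FPF n"
  show "inv_schubert_FPF n z = (\<Sum>D\<in>FD n z. \<Prod>(i, j)\<in>D. X i + X j)"
    unfolding inv_schubert_FPF_eq[OF z] act_Inv_sum FD_eq[OF z]
    by (rule sum.cong) (auto simp: prod_weight_FPF)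
qed

end
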